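(* (Stochastic Minimum Principle, additive noise.) For $g\in L^6([0,T]\times\Lambda)$ let $$J(g)=\mathbb{E}\left[\frac{c_{\overline{\Lambda}}}{2}\int_0^T\int_\Lambda (u^g_t(x)-u_{\overline{\Lambda}}(t,x))^2\,\mathrm{d}x\,\mathrm{d}t+\frac{c_T}{2}\int_\Lambda (u^g_T(x)-u^T(x))^2\,\mathrm{d}x\right]+\frac{\lambda}{2}\int_0^T\int_\Lambda g^2(t,x)\,\mathrm{d}x\,\mathrm{d}t,$$ where $u^g$ solves the state equation with additive noise given in the context, and let $G_{\mathrm{ad}}=\{g\in L^6([0,T]\times\Lambda):\|g\|_{L^6([0,T]\times\Lambda)}\le\kappa\}$. Let $J$ attain a (local) minimum over $G_{\mathrm{ad}}$ at $g^\ast\in G_{\mathrm{ad}}$. Then, for every $h\in G_{\mathrm{ad}}$, $$\mathbb{E}\left[\int_0^T\int_\Lambda(b(t)p_t(x)+\lambda g^\ast(t,x))(h(t,x)-g^\ast(t,x))\,\mathrm{d}x\,\mathrm{d}t\right]\ge0,$$ where $p$ is the solution of the adjoint equation associated with $g^\ast$ (homogeneous Neumann boundary conditions) $$\begin{cases}-\partial_tp_t=\Delta p_t+f'(u^{g^\ast}_t)p_t+c_{\overline{\Lambda}}\left(u^{g^\ast}_t-u_{\overline{\Lambda}}(t,\cdot)\right)&\text{on }[0,T]\times\Lambda\\ p_T(x)=c_T\left(u^{g^\ast}_T(x)-u^T(x)\right)&x\in\Lambda.\end{cases}$$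
   Context: Setting. $\Lambda\subset\mathbb{R}$ is a bounded domain, $T>0$ is fixed, $(\Omega,\mathcal{F},(\mathcal{F}_t)_{t\in[0,T]},\mathbb{P})$ is a given filtered probability space satisfying the usual conditions, $Q:L^2(\Lambda)\to L^2(\Lambda)$ is a nonnegative, symmetric trace class operator, and $(W^Q_t)_{t\in[0,T]}$ is a $Q$-Wiener process on this filtered probability space. Let $u^0\in L^6(\Omega,\mathcal{F}_0,\mathbb{P};L^2(\Lambda))$, $b\in L^\infty([0,T]\times\Lambda)$ (with $b(t)=b(t,\cdot)$), and let $\sigma\in\mathbb{R}$ be a constant. The function $f:\mathbb{R}\to\mathbb{R}$ is continuously differentiable with $f(0)=0$, $\sup_{x\in\mathbb{R}}f'(x)<\infty$, and $|f'(x)|<C(1+|x|^2)$ for all $x\in\mathbb{R}$ and some constant $C$. State equation (additive noise, homogeneous Neumann boundary conditions), for a deterministic control $g:[0,T]\times\Lambda\to\mathbb{R}$: $$\mathrm{d}u^g_t=[\Delta u^g_t+f(u^g_t)+b(t)g(t)]\,\mathrm{d}t+\sigma\,\mathrm{d}W^Q_t\ \text{ on }L^2(\Lambda),\qquad u^g_0=u^0.$$ It is understood in the variational sense with respect to the Gelfand triple $H^1(\Lambda)\subset L^2(\Lambda)\subset(H^1(\Lambda))^\ast$, where ${}_{(H^1)^\ast}\langle\Delta u,v\rangle_{H^1}=-\int_\Lambda\nabla u\cdot\nabla v\,\mathrm{d}x$. Solutions are adapted and lie in $E:=L^2([0,T]\times\Omega,\mathrm{d}t\otimes\mathbb{P};H^1(\Lambda))\cap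 L^6(\Omega,\mathbb{P};C([0,T];L^2(\Lambda)))$; it is known that for every deterministic $g\in L^2([0,T]\times\Lambda)$ there is a unique solution $u^g\in E$. The adjoint equation is solved pathwise (for almost every $\omega$) in the variational sense with respect to the same Gelfand triple, with $p\in L^2([0,T];H^1(\Lambda))\cap C([0,T];L^2(\Lambda))$. Cost data: $c_{\overline{\Lambda}},c_T,\lambda\ge0$ and $\kappa\ge0$ are constants, $u_{\overline{\Lambda}}\in L^2([0,T]\times\Lambda)$, $u^T\in L^2(\Lambda)$. "Local minimum over $G_{\mathrm{ad}}$ at $g^\ast$" means $J(g^\ast)\le J(g)$ for all $g\in G_{\mathrm{ad}}$ in some $L^6([0,T]\times\Lambda)$-neighbourhood of $g^\ast$. *)

theory Defs
  imports "HOL-Probability.Probability"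
begin

text \<open>
  Elements of \<open>L\<^sup>p\<close> and Sobolev spaces are represented by real functions; the function space
  notions below only depend on classes modulo almost everywhere equality. A function
  \<open>[0,T] \<rightarrow> L\<^sup>2(\<Lambda>)\<close> is a curried function \<open>t, x \<mapsto> y t x\<close>; an \<open>L\<^sup>2(\<Lambda>)\<close>-valued process is
  \<open>t, \<omega>, x \<mapsto> u t \<omega> x\<close>, whereas controls and the other elements of \<open>L\<^sup>p([0,T] \<times> \<Lambda>)\<close> are
  functions of the pair \<open>(t, x)\<close>.
\<close>

section \<open>Function spaces\<close>

definition Lp :: "nat \<Rightarrow> 'a measure \<Rightarrow> ('a \<Rightarrow> real) set" where
  "Lp q M = {v \<in> borel_measurable M. integrable M (\<lambda>x. \<bar>v x\<bar> ^ q)}"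

definition Lp_norm :: "nat \<Rightarrow> 'a measure \<Rightarrow> ('a \<Rightarrow> real) \<Rightarrow> real" where
  "Lp_norm q M v = root q (LINT x|M. \<bar>v x\<bar> ^ q)"

definition Linf :: "'a measure \<Rightarrow> ('a \<Rightarrow> real) set" where
  "Linf M = {v \<in> borel_measurable M. \<exists>K. AE x in M. \<bar>v x\<bar> \<le> K}"

abbreviation L2 :: "real set \<Rightarrow> (real \<Rightarrow> real) set" where
  "L2 \<Lambda> \<equiv> Lp 2 (lebesgue_on \<Lambda>)"

abbreviation L2_norm :: "real set \<Rightarrow> (real \<Rightarrow> real) \<Rightarrow> real" where
  "L2_norm \<Lambda> \<equiv> Lp_norm 2 (lebesgue_on \<Lambda>)"

definition L2_inner :: "real set \<Rightarrow> (real \<Rightarrow> real) \<Rightarrow> (real \<Rightarrow> real) \<Rightarrow> real" where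
  "L2_inner \<Lambda> v w = (LINT x|lebesgue_on \<Lambda>. v x * w x)"

abbreviation time_space :: "real \<Rightarrow> real set \<Rightarrow> (real \<times> real) measure" where
  "time_space T \<Lambda> \<equiv> lebesgue_on ({0..T} \<times> \<Lambda>)"

definition test_function :: "real set \<Rightarrow> (real \<Rightarrow> real) \<Rightarrow> bool" where
  "test_function \<Lambda> \<phi> \<longleftrightarrow>
     (\<forall>k x. (deriv ^^ k) \<phi> field_differentiable (at x)) \<and>
     compact (closure {x. \<phi> x \<noteq> 0}) \<and> closure {x. \<phi> x \<noteq> 0} \<subseteq> \<Lambda>"

definition has_weak_derivative :: "real set \<Rightarrow> (real \<Rightarrow> real) \<Rightarrow> (real \<Rightarrow> real) \<Rightarrow> bool" where
  "has_weak_derivative \<Lambda> v w \<longleftrightarrow>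
     (\<forall>\<phi>. test_function \<Lambda> \<phi> \<longrightarrow> L2_inner \<Lambda> v (deriv \<phi>) = - L2_inner \<Lambda> w \<phi>)"

definition H1 :: "real set \<Rightarrow> (real \<Rightarrow> real) set" where
  "H1 \<Lambda> = {v \<in> L2 \<Lambda>. \<exists>w \<in> L2 \<Lambda>. has_weak_derivative \<Lambda> v w}"

text \<open>The choice is unique up to almost everywhere equality on \<open>\<Lambda>\<close>.\<close>

definition weak_deriv :: "real set \<Rightarrow> (real \<Rightarrow> real) \<Rightarrow> real \<Rightarrow> real" where
  "weak_deriv \<Lambda> v = (SOME w. w \<in> L2 \<Lambda> \<and> has_weak_derivative \<Lambda> v w)"

definition H1_norm :: "real set \<Rightarrow> (real \<Rightarrow> real) \<Rightarrow> real" where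
  "H1_norm \<Lambda> v = sqrt ((L2_norm \<Lambda> v)\<^sup>2 + (L2_norm \<Lambda> (weak_deriv \<Lambda> v))\<^sup>2)"

definition L2_continuous_path :: "real \<Rightarrow> real set \<Rightarrow> (real \<Rightarrow> real \<Rightarrow> real) \<Rightarrow> bool" where
  "L2_continuous_path T \<Lambda> y \<longleftrightarrow>
     (\<forall>t\<in>{0..T}. y t \<in> L2 \<Lambda>) \<and>
     (\<forall>t\<in>{0..T}. ((\<lambda>s. L2_norm \<Lambda> (\<lambda>x. y s x - y t x)) \<longlongrightarrow> 0) (at t within {0..T}))"

section \<open>Random variables with values in \<open>L\<^sup>2(\<Lambda>)\<close>\<close>

text \<open>
  As \<open>L\<^sup>2(\<Lambda>)\<close> is separable, its Borel sets are generated by the functionals \<open>\<langle>\<cdot>, v\<rangle>\<close>, so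
  measurability of an \<open>L\<^sup>2(\<Lambda>)\<close>-valued map can be tested with them.
\<close>

definition L2_measurable :: "'w measure \<Rightarrow> real set \<Rightarrow> ('w \<Rightarrow> real \<Rightarrow> real) \<Rightarrow> bool" where
  "L2_measurable N \<Lambda> X \<longleftrightarrow> (\<forall>v \<in> L2 \<Lambda>. (\<lambda>\<omega>. L2_inner \<Lambda> (X \<omega>) v) \<in> borel_measurable N)"

definition L2_generated_sets :: "'w measure \<Rightarrow> real set \<Rightarrow> ('w \<Rightarrow> real \<Rightarrow> real) \<Rightarrow> 'w set set" where
  "L2_generated_sets M \<Lambda> X = sigma_sets (space M)
     {(\<lambda>\<omega>. L2_inner \<Lambda> (X \<omega>) v) -` B \<inter> space M | v B. v \<in> L2 \<Lambda> \<and> B \<in> sets borel}"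

definition adapted_L2 ::
  "real \<Rightarrow> real set \<Rightarrow> (real \<Rightarrow> 'w measure) \<Rightarrow> (real \<Rightarrow> 'w \<Rightarrow> real \<Rightarrow> real) \<Rightarrow> bool" where
  "adapted_L2 T \<Lambda> F u \<longleftrightarrow> (\<forall>t\<in>{0..T}. L2_measurable (F t) \<Lambda> (u t))"

definition usual_filtration :: "real \<Rightarrow> 'w measure \<Rightarrow> (real \<Rightarrow> 'w measure) \<Rightarrow> bool" where
  "usual_filtration T M F \<longleftrightarrow>
     (\<forall>t\<in>{0..T}. subalgebra M (F t)) \<and>
     (\<forall>s\<in>{0..T}. \<forall>t\<in>{s..T}. sets (F s) \<subseteq> sets (F t)) \<and>
     (\<forall>t\<in>{0..<T}. sets (F t) = (\<Inter>s\<in>{t<..T}. sets (F s))) \<and>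
     (\<forall>A\<in>null_sets M. \<forall>N. N \<subseteq> A \<longrightarrow> N \<in> sets (F 0))"

definition L6_initial_value ::
  "real set \<Rightarrow> 'w measure \<Rightarrow> 'w measure \<Rightarrow> ('w \<Rightarrow> real \<Rightarrow> real) \<Rightarrow> bool" where
  "L6_initial_value \<Lambda> M F0 u0 \<longleftrightarrow>
     L2_measurable F0 \<Lambda> u0 \<and> (AE \<omega> in M. u0 \<omega> \<in> L2 \<Lambda>) \<and>
     integrable M (\<lambda>\<omega>. L2_norm \<Lambda> (u0 \<omega>) ^ 6)"

section \<open>The driving noise\<close>

definition orthonormal_basis :: "real set \<Rightarrow> (nat \<Rightarrow> real \<Rightarrow> real) \<Rightarrow> bool" where
  "orthonormal_basis \<Lambda> e \<longleftrightarrow>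
     (\<forall>k. e k \<in> L2 \<Lambda>) \<and>
     (\<forall>j k. L2_inner \<Lambda> (e j) (e k) = (if j = k then 1 else 0)) \<and>
     (\<forall>v\<in>L2 \<Lambda>. (\<forall>k. L2_inner \<Lambda> v (e k) = 0) \<longrightarrow> L2_norm \<Lambda> v = 0)"

definition bounded_L2_operator :: "real set \<Rightarrow> ((real \<Rightarrow> real) \<Rightarrow> real \<Rightarrow> real) \<Rightarrow> bool" where
  "bounded_L2_operator \<Lambda> Q \<longleftrightarrow>
     (\<forall>v\<in>L2 \<Lambda>. Q v \<in> L2 \<Lambda>) \<and>
     (\<forall>v\<in>L2 \<Lambda>. \<forall>w\<in>L2 \<Lambda>. \<forall>a c. AE x in lebesgue_on \<Lambda>.
        Q (\<lambda>y. a * v y + c * w y) x = a * Q v x + c * Q w x) \<and>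
     (\<exists>K. \<forall>v\<in>L2 \<Lambda>. L2_norm \<Lambda> (Q v) \<le> K * L2_norm \<Lambda> v)"

text \<open>For nonnegative symmetric \<open>Q\<close> one has \<open>\<bar>Q\<bar> = Q\<close>, so trace class means finite trace.\<close>

definition covariance_operator :: "real set \<Rightarrow> ((real \<Rightarrow> real) \<Rightarrow> real \<Rightarrow> real) \<Rightarrow> bool" where
  "covariance_operator \<Lambda> Q \<longleftrightarrow>
     bounded_L2_operator \<Lambda> Q \<and>
     (\<forall>v\<in>L2 \<Lambda>. \<forall>w\<in>L2 \<Lambda>. L2_inner \<Lambda> (Q v) w = L2_inner \<Lambda> v (Q w)) \<and>
     (\<forall>v\<in>L2 \<Lambda>. 0 \<le> L2_inner \<Lambda> (Q v) v) \<and>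
     (\<exists>e. orthonormal_basis \<Lambda> e \<and> summable (\<lambda>k. L2_inner \<Lambda> (Q (e k)) (e k)))"

definition centered_gaussian :: "real \<Rightarrow> real measure" where
  "centered_gaussian s =
     (if s = 0 then return borel 0 else density lborel (normal_density 0 (sqrt s)))"

text \<open>
  The law of an \<open>L\<^sup>2(\<Lambda>)\<close>-valued random variable \<open>X\<close> is \<open>N(0, s Q)\<close> iff each \<open>\<langle>X, v\<rangle>\<close> is a centred
  (possibly degenerate) Gaussian with variance \<open>s \<langle>Q v, v\<rangle>\<close>. Independence of the increments of \<open>W\<close>
  among each other follows from adaptedness and the independence of \<open>W t - W s\<close> from \<open>F s\<close>.
\<close>

definition Q_Wiener_process ::
  "real \<Rightarrow> real set \<Rightarrow> 'w measure \<Rightarrow> (real \<Rightarrow> 'w measure) \<Rightarrow> ((real \<Rightarrow> real) \<Rightarrow> real \<Rightarrow> real)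
     \<Rightarrow> (real \<Rightarrow> 'w \<Rightarrow> real \<Rightarrow> real) \<Rightarrow> bool" where
  "Q_Wiener_process T \<Lambda> M F Q W \<longleftrightarrow>
     (AE \<omega> in M. L2_norm \<Lambda> (W 0 \<omega>) = 0) \<and>
     (AE \<omega> in M. L2_continuous_path T \<Lambda> (\<lambda>t. W t \<omega>)) \<and>
     adapted_L2 T \<Lambda> F W \<and>
     (\<forall>s\<in>{0..T}. \<forall>t\<in>{s..T}.
        prob_space.indep_set M (sets (F s))
          (L2_generated_sets M \<Lambda> (\<lambda>\<omega> x. W t \<omega> x - W s \<omega> x))) \<and>
     (\<forall>s\<in>{0..T}. \<forall>t\<in>{s..T}. \<forall>v\<in>L2 \<Lambda>.
        distr M borel (\<lambda>\<omega>. L2_inner \<Lambda> (\<lambda>x. W t \<omega> x - W s \<omega> x) v) =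
          centered_gaussian ((t - s) * L2_inner \<Lambda> (Q v) v))"

section \<open>State equation, adjoint equation and cost\<close>

definition admissible_nonlinearity :: "(real \<Rightarrow> real) \<Rightarrow> bool" where
  "admissible_nonlinearity f \<longleftrightarrow>
     f C1_differentiable_on UNIV \<and> f 0 = 0 \<and> bdd_above (range (deriv f)) \<and>
     (\<exists>C. \<forall>x. \<bar>deriv f x\<bar> < C * (1 + \<bar>x\<bar>\<^sup>2))"

text \<open>
  Adapted elements of \<open>L\<^sup>2([0,T] \<times> \<Omega>; H\<^sup>1(\<Lambda>)) \<inter> L\<^sup>6(\<Omega>; C([0,T]; L\<^sup>2(\<Lambda>)))\<close>. The completed product
  measure is used because paths are only required to be continuous almost surely.
\<close>

definition state_space ::
  "real \<Rightarrow> real set \<Rightarrow> 'w measure \<Rightarrow> (real \<Rightarrow> 'w measure) \<Rightarrow> (real \<Rightarrow> 'w \<Rightarrow> real \<Rightarrow> real) set" where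
  "state_space T \<Lambda> M F = {u.
     adapted_L2 T \<Lambda> F u \<and>
     (AE \<omega> in M. L2_continuous_path T \<Lambda> (\<lambda>t. u t \<omega>)) \<and>
     integrable M (\<lambda>\<omega>. (SUP t\<in>{0..T}. L2_norm \<Lambda> (u t \<omega>)) ^ 6) \<and>
     (AE (t, \<omega>) in lebesgue_on {0..T} \<Otimes>\<^sub>M M. u t \<omega> \<in> H1 \<Lambda>) \<and>
     integrable (completion (lebesgue_on {0..T} \<Otimes>\<^sub>M M)) (\<lambda>(t, \<omega>). (H1_norm \<Lambda> (u t \<omega>))\<^sup>2)}"

text \<open>
  The identity in \<open>(H\<^sup>1(\<Lambda>))\<^sup>*\<close> is tested with \<open>v \<in> H\<^sup>1(\<Lambda>)\<close>; not requiring \<open>v\<close> to vanish at the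
  boundary encodes the Neumann condition. At \<open>t = 0\<close> it is the initial condition, as \<open>W 0 = 0\<close>.
  For \<open>u\<close> in the state space all integrals converge, since \<open>\<bar>f y\<bar> \<le> C (\<bar>y\<bar> + \<bar>y\<bar>\<^sup>3)\<close> and
  \<open>H\<^sup>1(\<Lambda>)\<close> embeds into \<open>L\<^sup>\<infinity>(\<Lambda>)\<close> in dimension one.
\<close>

definition state_solution ::
  "real \<Rightarrow> real set \<Rightarrow> 'w measure \<Rightarrow> (real \<Rightarrow> 'w measure) \<Rightarrow> (real \<Rightarrow> 'w \<Rightarrow> real \<Rightarrow> real)
     \<Rightarrow> real \<Rightarrow> (real \<Rightarrow> real) \<Rightarrow> (real \<times> real \<Rightarrow> real) \<Rightarrow> ('w \<Rightarrow> real \<Rightarrow> real)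
     \<Rightarrow> (real \<times> real \<Rightarrow> real) \<Rightarrow> (real \<Rightarrow> 'w \<Rightarrow> real \<Rightarrow> real) \<Rightarrow> bool" where
  "state_solution T \<Lambda> M F W \<sigma> f b u0 g u \<longleftrightarrow>
     u \<in> state_space T \<Lambda> M F \<and>
     (AE \<omega> in M. \<forall>t\<in>{0..T}. \<forall>v\<in>H1 \<Lambda>.
        L2_inner \<Lambda> (u t \<omega>) v =
          L2_inner \<Lambda> (u0 \<omega>) v +
          (LINT s|lebesgue_on {0..t}.
             - L2_inner \<Lambda> (weak_deriv \<Lambda> (u s \<omega>)) (weak_deriv \<Lambda> v) +
             (LINT x|lebesgue_on \<Lambda>. (f (u s \<omega> x) + b (s, x) * g (s, x)) * v x)) +
          \<sigma> * L2_inner \<Lambda> (W t \<omega>) v)"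

text \<open>
  \<open>y\<close> is one path of the state and \<open>q\<close> the corresponding path of the adjoint state; the backward
  equation is integrated over \<open>[t, T]\<close>.
\<close>

definition adjoint_path_solution ::
  "real \<Rightarrow> real set \<Rightarrow> (real \<Rightarrow> real) \<Rightarrow> real \<Rightarrow> real \<Rightarrow> (real \<times> real \<Rightarrow> real) \<Rightarrow> (real \<Rightarrow> real)
     \<Rightarrow> (real \<Rightarrow> real \<Rightarrow> real) \<Rightarrow> (real \<Rightarrow> real \<Rightarrow> real) \<Rightarrow> bool" where
  "adjoint_path_solution T \<Lambda> f c c\<^sub>T u\<^sub>\<Lambda> u\<^sub>T y q \<longleftrightarrow>
     L2_continuous_path T \<Lambda> q \<and>
     (AE t in lebesgue_on {0..T}. q t \<in> H1 \<Lambda>) \<and>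
     integrable (lebesgue_on {0..T}) (\<lambda>t. (H1_norm \<Lambda> (q t))\<^sup>2) \<and>
     (\<forall>t\<in>{0..T}. \<forall>v\<in>H1 \<Lambda>.
        L2_inner \<Lambda> (q t) v =
          c\<^sub>T * L2_inner \<Lambda> (\<lambda>x. y T x - u\<^sub>T x) v +
          (LINT s|lebesgue_on {t..T}.
             - L2_inner \<Lambda> (weak_deriv \<Lambda> (q s)) (weak_deriv \<Lambda> v) +
             (LINT x|lebesgue_on \<Lambda>.
                (deriv f (y s x) * q s x + c * (y s x - u\<^sub>\<Lambda> (s, x))) * v x)))"

text \<open>\<open>u\<close> is the control-to-state map \<open>g \<mapsto> u\<^sup>g\<close>.\<close>

definition cost ::
  "real \<Rightarrow> real set \<Rightarrow> 'w measure \<Rightarrow> real \<Rightarrow> real \<Rightarrow> real \<Rightarrow> (real \<times> real \<Rightarrow> real) \<Rightarrow> (real \<Rightarrow> real)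
     \<Rightarrow> ((real \<times> real \<Rightarrow> real) \<Rightarrow> real \<Rightarrow> 'w \<Rightarrow> real \<Rightarrow> real) \<Rightarrow> (real \<times> real \<Rightarrow> real) \<Rightarrow> real" where
  "cost T \<Lambda> M c c\<^sub>T l u\<^sub>\<Lambda> u\<^sub>T u g =
     (LINT \<omega>|M.
        c / 2 * (LINT t|lebesgue_on {0..T}. LINT x|lebesgue_on \<Lambda>. (u g t \<omega> x - u\<^sub>\<Lambda> (t, x))\<^sup>2) +
        c\<^sub>T / 2 * (LINT x|lebesgue_on \<Lambda>. (u g T \<omega> x - u\<^sub>T x)\<^sup>2)) +
     l / 2 * (LINT t|lebesgue_on {0..T}. LINT x|lebesgue_on \<Lambda>. (g (t, x))\<^sup>2)"

definition admissible_controls ::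
  "real \<Rightarrow> real set \<Rightarrow> real \<Rightarrow> (real \<times> real \<Rightarrow> real) set" where
  "admissible_controls T \<Lambda> \<kappa> =
     {g \<in> Lp 6 (time_space T \<Lambda>). Lp_norm 6 (time_space T \<Lambda>) g \<le> \<kappa>}"

definition local_min_over ::
  "real \<Rightarrow> real set \<Rightarrow> (real \<times> real \<Rightarrow> real) set \<Rightarrow> ((real \<times> real \<Rightarrow> real) \<Rightarrow> real)
     \<Rightarrow> (real \<times> real \<Rightarrow> real) \<Rightarrow> bool" where
  "local_min_over T \<Lambda> G J g' \<longleftrightarrow>
     g' \<in> G \<and>
     (\<exists>\<delta>>0. \<forall>g\<in>G. Lp_norm 6 (time_space T \<Lambda>) (\<lambda>z. g z - g' z) < \<delta> \<longrightarrow> J g' \<le> J g)"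

end

theory Submission
  imports Defs "HOL-Real_Asymp.Real_Asymp"
begin

text \<open>
  The noise is additive, so it cancels in the difference \<open>w\<close> of the states belonging to two controls:
  along almost every path, \<open>w\<close> solves a deterministic semilinear heat equation with right-hand side
  \<open>f(y + w) - f(y) + \<epsilon> b (h - g')\<close>. Since \<open>f'\<close> is bounded above, an energy estimate and Gronwall's lemma
  give \<open>\<parallel>w t\<parallel> \<le> C \<epsilon>\<close> with a constant that does not depend on the path (\<open>state_lipschitz\<close>). The product
  rule for \<open>w\<close> and the adjoint state \<open>p\<close> (\<open>heat_duality\<close>) identifies the first variation of the cost along
  the path with \<open>\<epsilon> \<integral> \<langle>b (h - g'), p\<rangle> dt\<close> up to the linearisation error
  \<open>\<integral> \<langle>f(y + w) - f(y) - f'(y) w, p\<rangle> dt\<close>, and this error is \<open>o(\<epsilon>)\<close> for \<open>\<epsilon> = 2 ^ -n\<close>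
  (\<open>remainder_tendsto_0\<close>, \<open>pathwise_derivative\<close>). The path-independent constant dominates the difference
  quotients, so the limit may be taken under the expectation (\<open>expected_cost_derivative\<close>). As \<open>p\<close> is only
  given path by path, it is this limit that makes its contribution measurable and integrable in \<open>\<omega>\<close>.
  The admissible set is convex, so \<open>J g' \<le> J (g' + 2 ^ -n (h - g'))\<close> for large \<open>n\<close>; dividing by \<open>2 ^ -n\<close>
  gives the inequality.

  The heat equation is treated mode by mode. In dimension one the domain is an interval, and the
  cosines are the eigenfunctions of the negative Neumann Laplacian: for \<open>v\<close> in \<open>H\<^sup>1\<close> the inner product of the
  weak derivative with \<open>(cosine k)'\<close> is the eigenvalue times the coefficient of \<open>v\<close>
  (\<open>weak_deriv_inner_cosine_deriv\<close>). Hence every coefficient of a weak solution solves a scalar linear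
  equation, for which the product rule is an instance of Fubini's theorem
  (\<open>product_rule_integrals\<close>). In the duality between \<open>w\<close> and \<open>p\<close> the eigenvalues cancel in each mode; in the
  energy estimate they have the good sign and control \<open>w\<close> in \<open>L\<^sup>2(0,T; H\<^sup>1)\<close>. Summation over the modes is
  Parseval's identity (\<open>Parseval_norm\<close>), and the embedding of \<open>H\<^sup>1\<close> into \<open>L\<^sup>\<infinity>\<close>, by which the cubic growth
  of \<open>f\<close> is handled, is the absolute summability of the coefficients (\<open>H1_summable_coef\<close>).
\<close>

section \<open>Smooth cut-off functions\<close>

text \<open>
  Coinductively, a function is smooth if it has a derivative that is smooth. Membership is then shown
  by exhibiting a class of functions that is closed under differentiation.
\<close>

coinductive smooth :: "(real \<Rightarrow> real) \<Rightarrow> bool" where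
  smoothI: "(\<And>x. (\<phi> has_real_derivative \<phi>' x) (at x)) \<Longrightarrow> smooth \<phi>' \<Longrightarrow> smooth \<phi>"

lemma smooth_coinduct:
  assumes "P \<phi>" and step: "\<And>\<phi>. P \<phi> \<Longrightarrow> \<exists>\<phi>'. P \<phi>' \<and> (\<forall>x. (\<phi> has_real_derivative \<phi>' x) (at x))"
  shows "smooth \<phi>"
  using \<open>P \<phi>\<close> by (coinduction arbitrary: \<phi> rule: smooth.coinduct) (use step in blast)

lemma
  assumes "smooth \<phi>"
  shows smooth_deriv: "smooth (deriv \<phi>)"
    and smooth_DERIV: "(\<phi> has_real_derivative deriv \<phi> x) (at x)"
proof -
  from assms obtain \<phi>' where d: "\<And>x. (\<phi> has_real_derivative \<phi>' x) (at x)" and s: "smooth \<phi>'"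
    by cases blast
  have "deriv \<phi> = \<phi>'" using d by (auto intro: DERIV_imp_deriv)
  with d s show "smooth (deriv \<phi>)" "(\<phi> has_real_derivative deriv \<phi> x) (at x)" by simp_all
qed

lemma smooth_continuous: "smooth \<phi> \<Longrightarrow> continuous_on A \<phi>"
  by (blast intro: smooth_DERIV DERIV_isCont continuous_at_imp_continuous_on)

lemma smooth_iterated_deriv: "smooth \<phi> \<Longrightarrow> smooth ((deriv ^^ k) \<phi>)"
  by (induction k) (auto intro: smooth_deriv)

lemma smooth_field_differentiable: "smooth \<phi> \<Longrightarrow> \<phi> field_differentiable (at x)"
  using smooth_DERIV field_differentiable_def by blast

lemma smooth_affine:
  assumes "smooth \<phi>" shows "smooth (\<lambda>x. c * \<phi> (a * x + b))"
proof (rule smooth_coinduct[where P = "\<lambda>g. \<exists>\<phi> c. smooth \<phi> \<and> g = (\<lambda>x. c * \<phi> (a * x + b))"])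
  fix g assume "\<exists>\<phi> c. smooth \<phi> \<and> g = (\<lambda>x. c * \<phi> (a * x + b))"
  then obtain \<phi> c where \<phi>: "smooth \<phi>" and g: "g = (\<lambda>x. c * \<phi> (a * x + b))" by blast
  from \<phi> have s: "smooth (deriv \<phi>)" and d: "\<And>x. (\<phi> has_real_derivative deriv \<phi> x) (at x)"
    by (auto intro: smooth_deriv smooth_DERIV)
  have "(g has_real_derivative (c * a) * deriv \<phi> (a * x + b)) (at x)" for x
    unfolding g by (auto intro!: derivative_eq_intros DERIV_chain2[OF d])
  with s show "\<exists>g'. (\<exists>\<phi> c. smooth \<phi> \<and> g' = (\<lambda>x. c * \<phi> (a * x + b))) \<and>
      (\<forall>x. (g has_real_derivative g' x) (at x))"
    by (intro exI[of _ "\<lambda>x. (c * a) * deriv \<phi> (a * x + b)"]) blast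
qed (use assms in blast)

lemma smooth_const: "smooth (\<lambda>_. c)"
  by (rule smooth_coinduct[where P = "\<lambda>g. \<exists>c. g = (\<lambda>_. c)"]) (auto intro!: exI[of _ "\<lambda>_. 0"])

lemma smooth_sin_cos:
  shows "smooth (\<lambda>x. a * sin (m * x + b))" "smooth (\<lambda>x. a * cos (m * x + b))"
proof -
  have "smooth (\<lambda>x. a * sin x + b * cos x)" for a b
  proof (rule smooth_coinduct[where P = "\<lambda>g. \<exists>a b. g = (\<lambda>x. a * sin x + b * cos x)"])
    fix g :: "real \<Rightarrow> real" assume "\<exists>a b. g = (\<lambda>x. a * sin x + b * cos x)"
    then obtain a b where g: "g = (\<lambda>x. a * sin x + b * cos x)" by blast
    have "\<forall>x. (g has_real_derivative (- b) * sin x + a * cos x) (at x)"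
      unfolding g by (auto intro!: derivative_eq_intros)
    then show "\<exists>g'. (\<exists>a b. g' = (\<lambda>x. a * sin x + b * cos x)) \<and>
        (\<forall>x. (g has_real_derivative g' x) (at x))"
      by (intro exI[of _ "\<lambda>x. (- b) * sin x + a * cos x"]) blast
  qed blast
  from this[of 1 0] this[of 0 1] have "smooth sin" "smooth cos" by simp_all
  then show "smooth (\<lambda>x. a * sin (m * x + b))" "smooth (\<lambda>x. a * cos (m * x + b))"
    by (auto intro: smooth_affine)
qed

text \<open>
  A derivative of a product or reciprocal of smooth functions is no longer of the same form, so
  coinduction is run on the closure of the smooth functions under all three operations at once.
\<close>

inductive smooth_closure :: "(real \<Rightarrow> real) \<Rightarrow> bool" where
  base: "smooth \<phi> \<Longrightarrow> smooth_closure \<phi>"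
| add: "smooth_closure \<phi> \<Longrightarrow> smooth_closure \<psi> \<Longrightarrow> smooth_closure (\<lambda>x. \<phi> x + \<psi> x)"
| mult: "smooth_closure \<phi> \<Longrightarrow> smooth_closure \<psi> \<Longrightarrow> smooth_closure (\<lambda>x. \<phi> x * \<psi> x)"
| inverse: "smooth_closure \<phi> \<Longrightarrow> (\<And>x. \<phi> x \<noteq> 0) \<Longrightarrow> smooth_closure (\<lambda>x. inverse (\<phi> x))"

lemma smooth_closure_smooth:
  assumes "smooth_closure \<phi>" shows "smooth \<phi>"
proof (rule smooth_coinduct[where P = smooth_closure, OF assms])
  fix \<phi> assume "smooth_closure \<phi>"
  then show "\<exists>\<phi>'. smooth_closure \<phi>' \<and> (\<forall>x. (\<phi> has_real_derivative \<phi>' x) (at x))"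
  proof induction
    case (base \<phi>)
    then show ?case by cases (auto intro: smooth_closure.base)
  next
    case (add \<phi> \<psi>)
    then obtain \<phi>' \<psi>' where "smooth_closure \<phi>'" "smooth_closure \<psi>'"
      "\<forall>x. (\<phi> has_real_derivative \<phi>' x) (at x)" "\<forall>x. (\<psi> has_real_derivative \<psi>' x) (at x)" by blast
    then show ?case
      by (intro exI[of _ "\<lambda>x. \<phi>' x + \<psi>' x"]) (auto intro: smooth_closure.add DERIV_add)
  next
    case (mult \<phi> \<psi>)
    then obtain \<phi>' \<psi>' where "smooth_closure \<phi>'" "smooth_closure \<psi>'"
      "\<forall>x. (\<phi> has_real_derivative \<phi>' x) (at x)" "\<forall>x. (\<psi> has_real_derivative \<psi>' x) (at x)" by blast
    with mult.hyps show ?case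
      by (intro exI[of _ "\<lambda>x. \<phi>' x * \<psi> x + \<psi>' x * \<phi> x"])
        (auto intro!: smooth_closure.add smooth_closure.mult DERIV_mult)
  next
    case (inverse \<phi>)
    then obtain \<phi>' where *: "smooth_closure \<phi>'" "\<forall>x. (\<phi> has_real_derivative \<phi>' x) (at x)" by blast
    have "((\<lambda>x. inverse (\<phi> x)) has_real_derivative
        ((- 1) * \<phi>' x) * (inverse (\<phi> x) * inverse (\<phi> x))) (at x)" for x
      using * inverse.hyps by (auto intro!: derivative_eq_intros)
    moreover have "smooth_closure (\<lambda>x. ((- 1) * \<phi>' x) * (inverse (\<phi> x) * inverse (\<phi> x)))"
      using * inverse.hyps
      by (intro smooth_closure.mult smooth_closure.inverse smooth_closure.base[OF smooth_const]) auto
    ultimately show ?case by blast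
  qed
qed

lemma smooth_mult: "smooth \<phi> \<Longrightarrow> smooth \<psi> \<Longrightarrow> smooth (\<lambda>x. \<phi> x * \<psi> x)"
  by (blast intro: smooth_closure_smooth smooth_closure.intros)

text \<open>
  The standard flat functions. With a polynomial prefactor they form a class that is closed under
  differentiation.
\<close>

definition flat_exp :: "real poly \<Rightarrow> real \<Rightarrow> real" where
  "flat_exp r x = (if x > 0 then poly r (1 / x) * exp (- (1 / x)) else 0)"

lemma poly_times_exp_minus_tendsto:
  "((\<lambda>y::real. y ^ k * poly r y * exp (- y)) \<longlongrightarrow> 0) at_top"
proof (induction r arbitrary: k)
  case 0
  then show ?case by simp
next
  case (pCons a r)
  have "((\<lambda>y. a * (y ^ k / exp y) + y ^ Suc k * poly r y * exp (- y)) \<longlongrightarrow> a * 0 + 0) at_top"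
    by (intro tendsto_add tendsto_mult tendsto_const pCons.IH tendsto_power_div_exp_0)
  then show ?case by (simp add: algebra_simps exp_minus divide_inverse)
qed

text \<open>
  Differentiating \<open>r(1/x) exp(-1/x)\<close> replaces the polynomial \<open>r\<close> by \<open>X\<^sup>2 (r - r')\<close>; at the origin
  the exponential beats every polynomial in \<open>1/x\<close>.
\<close>

lemma flat_exp_deriv:
  "(flat_exp r has_real_derivative flat_exp ([:0, 0, 1:] * (r - pderiv r)) x) (at x)"
proof (cases x "0 :: real" rule: linorder_cases)
  case less
  have "((\<lambda>_. 0) has_real_derivative 0) (at x)" by simp
  then have "(flat_exp r has_real_derivative 0) (at x)"
    using less by (elim DERIV_cong_ev[THEN iffD1, rotated -1])
      (auto simp: flat_exp_def intro!: eventually_mono[OF eventually_nhds_in_open[of "{..<0}"]])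
  with less show ?thesis by (simp add: flat_exp_def)
next
  case greater
  have "((\<lambda>x. poly r (1 / x) * exp (- (1 / x))) has_real_derivative
      poly r (1 / x) * (exp (- (1 / x)) * (1 / x\<^sup>2)) + exp (- (1 / x)) * (poly (pderiv r) (1 / x) * (- 1 / x\<^sup>2))) (at x)"
    using greater
    by (auto intro!: derivative_eq_intros DERIV_chain2[OF poly_DERIV] simp: power2_eq_square field_simps)
  then have "(flat_exp r has_real_derivative
      poly r (1 / x) * (exp (- (1 / x)) * (1 / x\<^sup>2)) + exp (- (1 / x)) * (poly (pderiv r) (1 / x) * (- 1 / x\<^sup>2))) (at x)"
    using greater by (elim DERIV_cong_ev[THEN iffD1, rotated -1])
      (auto simp: flat_exp_def intro!: eventually_mono[OF eventually_nhds_in_open[of "{0<..}"]])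
  with greater show ?thesis
    by (simp add: flat_exp_def power2_eq_square algebra_simps)
next
  case equal
  have "((\<lambda>h::real. (flat_exp r (0 + h) - flat_exp r 0) / h) \<longlongrightarrow> 0) (at 0)"
    unfolding filterlim_split_at_real[of _ _ 0] filterlim_at_split
  proof
    show "((\<lambda>h::real. (flat_exp r (0 + h) - flat_exp r 0) / h) \<longlongrightarrow> 0) (at_left 0)"
      by (rule tendsto_eventually) (auto simp: flat_exp_def eventually_at_filter)
    have "((\<lambda>h::real. (1/h) ^ 1 * poly r (1/h) * exp (- (1/h))) \<longlongrightarrow> 0) (at_right 0)"
      using filterlim_compose[OF poly_times_exp_minus_tendsto[of 1 r] filterlim_inverse_at_top_right]
      by (simp add: divide_inverse)
    then show "((\<lambda>h::real. (flat_exp r (0 + h) - flat_exp r 0) / h) \<longlongrightarrow> 0) (at_right 0)"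
      by (rule Lim_transform_eventually)
        (auto simp: flat_exp_def eventually_at_filter)
  qed
  then have "(flat_exp r has_real_derivative 0) (at 0)" by (simp add: DERIV_def)
  with equal show ?thesis by (simp add: flat_exp_def)
qed

lemma smooth_flat_exp: "smooth (flat_exp r)"
  by (rule smooth_coinduct[where P = "\<lambda>g. \<exists>r. g = flat_exp r"]) (use flat_exp_deriv in blast)+

definition smooth_step :: "real \<Rightarrow> real" where
  "smooth_step x = flat_exp 1 (x - 1) * inverse (flat_exp 1 (x - 1) + flat_exp 1 (2 - x))"

lemma smooth_smooth_step: "smooth smooth_step"
proof -
  have "smooth (\<lambda>x. flat_exp 1 (x - 1))" "smooth (\<lambda>x. flat_exp 1 (2 - x))"
    using smooth_affine[OF smooth_flat_exp, of 1 1 1 "-1"] smooth_affine[OF smooth_flat_exp, of 1 1 "-1" 2]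
    by simp_all
  moreover have "flat_exp 1 (x - 1) + flat_exp 1 (2 - x) \<noteq> 0" for x
  proof -
    have "flat_exp 1 (x - 1) \<ge> 0" "flat_exp 1 (2 - x) \<ge> 0"
      "x > 1 \<Longrightarrow> flat_exp 1 (x - 1) > 0" "x < 2 \<Longrightarrow> flat_exp 1 (2 - x) > 0"
      by (auto simp: flat_exp_def)
    then show ?thesis by (cases "x > 1") force+
  qed
  ultimately have "smooth_closure smooth_step"
    unfolding smooth_step_def[abs_def]
    by (intro smooth_closure.mult smooth_closure.inverse smooth_closure.add) (auto intro: smooth_closure.base)
  then show ?thesis by (rule smooth_closure_smooth)
qed

lemma smooth_step_simps: "x \<le> 1 \<Longrightarrow> smooth_step x = 0" "x \<ge> 2 \<Longrightarrow> smooth_step x = 1"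
  by (auto simp: smooth_step_def flat_exp_def)

lemma smooth_step_bounds: "0 \<le> smooth_step x" "smooth_step x \<le> 1"
proof -
  have "flat_exp 1 y \<ge> 0" for y by (simp add: flat_exp_def)
  from this[of "x - 1"] this[of "2 - x"]
  show "0 \<le> smooth_step x" "smooth_step x \<le> 1"
    by (auto simp: smooth_step_def divide_inverse[symmetric] divide_simps)
qed

lemma deriv_smooth_step_eq_0: "x > 2 \<Longrightarrow> deriv smooth_step x = 0"
proof -
  assume "x > 2"
  have "((\<lambda>_. 1) has_real_derivative 0) (at x)" by simp
  then have "(smooth_step has_real_derivative 0) (at x)"
    using \<open>x > 2\<close> by (elim DERIV_cong_ev[THEN iffD1, rotated -1])
      (auto simp: smooth_step_simps intro!: eventually_mono[OF eventually_nhds_in_open[of "{2<..}"]])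
  then show ?thesis by (rule DERIV_imp_deriv)
qed

lemma deriv_smooth_step_bounded:
  obtains C where "C \<ge> 0" "\<And>x. x \<ge> 0 \<Longrightarrow> \<bar>deriv smooth_step x\<bar> \<le> C"
proof -
  have "continuous_on {0..2} (deriv smooth_step)"
    using smooth_smooth_step by (intro smooth_continuous smooth_deriv)
  then have "bounded (deriv smooth_step ` {0..2})"
    by (intro compact_imp_bounded compact_continuous_image) auto
  then obtain C where C: "\<And>x. x \<in> {0..2} \<Longrightarrow> \<bar>deriv smooth_step x\<bar> \<le> C"
    unfolding bounded_iff by (metis imageI real_norm_def)
  have "0 \<le> C" using C[of 0] by simp
  moreover have "\<bar>deriv smooth_step x\<bar> \<le> C" if "x \<ge> 0" for x
    using C[of x] deriv_smooth_step_eq_0[of x] that \<open>0 \<le> C\<close> by (cases "x > 2") auto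
  ultimately show thesis by (rule that)
qed

definition cutoff :: "real \<Rightarrow> real \<Rightarrow> nat \<Rightarrow> real \<Rightarrow> real" where
  "cutoff c d n x = smooth_step (real (Suc n) * (x - c)) * smooth_step (real (Suc n) * (d - x))"

lemma smooth_cutoff: "smooth (cutoff c d n)"
proof -
  have "smooth (\<lambda>x. smooth_step (real (Suc n) * (x - c)))" "smooth (\<lambda>x. smooth_step (real (Suc n) * (d - x)))"
    using smooth_affine[OF smooth_smooth_step, of 1 "real (Suc n)" "- real (Suc n) * c"]
      smooth_affine[OF smooth_smooth_step, of 1 "- real (Suc n)" "real (Suc n) * d"]
    by (simp_all add: algebra_simps)
  then show ?thesis unfolding cutoff_def[abs_def] by (rule smooth_mult)
qed

lemma cutoff_bounds: "0 \<le> cutoff c d n x" "cutoff c d n x \<le> 1"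
  by (auto simp: cutoff_def smooth_step_bounds mult_le_one)

lemma test_function_cutoff_mult:
  assumes "smooth \<psi>" "{c<..<d} \<subseteq> \<Lambda>"
  shows "test_function \<Lambda> (\<lambda>x. cutoff c d n x * \<psi> x)"
proof -
  let ?\<phi> = "\<lambda>x. cutoff c d n x * \<psi> x"
  have sm: "smooth ?\<phi>" using assms smooth_cutoff by (intro smooth_mult)
  \<comment> \<open>both factors of the cut-off vanish where their argument is at most 1\<close>
  have "x \<in> {c + 1 / real (Suc n)..d - 1 / real (Suc n)}" if "?\<phi> x \<noteq> 0" for x
  proof -
    have "real (Suc n) * (x - c) > 1" "real (Suc n) * (d - x) > 1"
      using that smooth_step_simps(1) unfolding cutoff_def
      by (metis linorder_not_le mult_zero_left, metis linorder_not_le mult_zero_left mult_zero_right)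
    then show ?thesis by (simp add: field_simps)
  qed
  then have cl: "closure {x. ?\<phi> x \<noteq> 0} \<subseteq> {c + 1 / real (Suc n)..d - 1 / real (Suc n)}"
    by (intro closure_minimal) auto
  then have "compact (closure {x. ?\<phi> x \<noteq> 0})"
    by (meson bounded_closed_interval bounded_subset closed_closure compact_eq_bounded_closed)
  moreover have "{c + 1 / real (Suc n)..d - 1 / real (Suc n)} \<subseteq> {c<..<d}"
    by (auto simp: add_strict_increasing2 less_le_trans[of c "c + 1 / real (Suc n)"] le_less_trans[of _ "d - 1 / real (Suc n)" d])
  ultimately show ?thesis
    unfolding test_function_def using cl assms(2) smooth_field_differentiable[OF smooth_iterated_deriv[OF sm]]
    by blast
qed

text \<open>
  Both arguments of the step function exceed 2 eventually, and to the right of 2 it is constant.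
\<close>

lemma cutoff_eventually_one:
  assumes "x \<in> {c<..<d}"
  shows "\<forall>\<^sub>F n in sequentially. cutoff c d n x = 1 \<and> deriv (cutoff c d n) x = 0"
proof -
  have "filterlim (\<lambda>n. real (Suc n) * y) at_top sequentially" if "y > 0" for y
    using that by real_asymp
  from this[of "x - c"] this[of "d - x"] assms
  have "\<forall>\<^sub>F n in sequentially. real (Suc n) * (x - c) > 2" "\<forall>\<^sub>F n in sequentially. real (Suc n) * (d - x) > 2"
    by (auto simp: filterlim_at_top_dense)
  then show ?thesis
  proof eventually_elim
    case (elim n)
    have "open {y. real (Suc n) * (y - c) > 2 \<and> real (Suc n) * (d - y) > 2}"
      by (intro open_Collect_conj open_Collect_less continuous_intros)
    then have "\<forall>\<^sub>F y in nhds x. cutoff c d n y = 1"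
      by (rule eventually_mono[OF eventually_nhds_in_open])
        (use elim in \<open>auto simp: cutoff_def smooth_step_simps\<close>)
    moreover have "((\<lambda>_. 1) has_real_derivative 0) (at x)" by simp
    ultimately have "(cutoff c d n has_real_derivative 0) (at x)"
      by (elim DERIV_cong_ev[THEN iffD1, rotated -1]) (auto elim: eventually_mono)
    then have "deriv (cutoff c d n) x = 0" by (rule DERIV_imp_deriv)
    with elim show ?case by (auto simp: cutoff_def smooth_step_simps)
  qed
qed

text \<open>
  \<open>cutoff c d n\<close> climbs from 0 to 1 within distance \<open>2 / (n + 1)\<close> of the end points, with slope of
  order \<open>n\<close>; weighted with the distance to the end point the slope stays bounded.
\<close>

lemma deriv_cutoff_bound:
  obtains C where "C \<ge> 0"
    "\<And>n x. x \<in> {c<..<d} \<Longrightarrow> \<bar>deriv (cutoff c d n) x\<bar> * min (x - c) (d - x) \<le> C"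
proof -
  obtain C where C: "C \<ge> 0" "\<And>x. x \<ge> 0 \<Longrightarrow> \<bar>deriv smooth_step x\<bar> \<le> C"
    using deriv_smooth_step_bounded by blast
  \<comment> \<open>the slope of the step vanishes beyond 2\<close>
  have *: "\<bar>deriv smooth_step y\<bar> * y \<le> 2 * C" if "y \<ge> 0" for y
    using C(2)[OF that] that deriv_smooth_step_eq_0[of y] C(1)
    by (cases "y > 2") (auto simp: mult.commute[of _ y] mult.commute[of _ 2] intro: mult_mono)
  show thesis
  proof (rule that[of "4 * C"])
    fix n x assume x: "x \<in> {c<..<d}"
    let ?N = "real (Suc n)" and ?m = "min (x - c) (d - x)"
    have d: "\<And>x. (smooth_step has_real_derivative deriv smooth_step x) (at x)"
      using smooth_smooth_step by (blast intro: smooth_DERIV)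
    have "(cutoff c d n has_real_derivative
        ?N * deriv smooth_step (?N * (x - c)) * smooth_step (?N * (d - x)) -
        ?N * deriv smooth_step (?N * (d - x)) * smooth_step (?N * (x - c))) (at x)"
      unfolding cutoff_def[abs_def]
      by (auto intro!: derivative_eq_intros DERIV_chain2[OF d] simp: algebra_simps)
    then have e: "deriv (cutoff c d n) x =
        ?N * deriv smooth_step (?N * (x - c)) * smooth_step (?N * (d - x)) -
        ?N * deriv smooth_step (?N * (d - x)) * smooth_step (?N * (x - c))"
      by (rule DERIV_imp_deriv)
    have "\<bar>?N * deriv smooth_step y * smooth_step z\<bar> * m \<le> 2 * C"
      if "m \<ge> 0" "?N * m \<le> y" for y z m
    proof -
      have "0 \<le> y" using that by (meson mult_nonneg_nonneg of_nat_0_le_iff order_trans)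
      have "\<bar>?N * deriv smooth_step y * smooth_step z\<bar> * m
          = \<bar>deriv smooth_step y\<bar> * (?N * m) * smooth_step z"
        using smooth_step_bounds[of z] by (simp add: abs_mult)
      also have "\<dots> \<le> \<bar>deriv smooth_step y\<bar> * (?N * m) * 1"
        using smooth_step_bounds[of z] that by (intro mult_left_mono) auto
      also have "\<dots> \<le> \<bar>deriv smooth_step y\<bar> * y" using that by (auto intro!: mult_left_mono)
      finally show ?thesis using *[OF \<open>0 \<le> y\<close>] by simp
    qed
    note slope = this
    have "?m \<ge> 0" "?N * ?m \<le> ?N * (x - c)" "?N * ?m \<le> ?N * (d - x)"
      using x by (auto intro: mult_left_mono)
    then have "\<bar>?N * deriv smooth_step (?N * (x - c)) * smooth_step (?N * (d - x))\<bar> * ?m +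
        \<bar>?N * deriv smooth_step (?N * (d - x)) * smooth_step (?N * (x - c))\<bar> * ?m \<le> 2 * C + 2 * C"
      by (intro add_mono slope)
    moreover have "\<bar>deriv (cutoff c d n) x\<bar> * ?m \<le>
        (\<bar>?N * deriv smooth_step (?N * (x - c)) * smooth_step (?N * (d - x))\<bar> +
         \<bar>?N * deriv smooth_step (?N * (d - x)) * smooth_step (?N * (x - c))\<bar>) * ?m"
      unfolding e using x by (intro mult_right_mono) auto
    ultimately show "\<bar>deriv (cutoff c d n) x\<bar> * ?m \<le> 4 * C" by (simp only: distrib_right)
  qed (use C in simp)
qed

section \<open>The space \<open>L\<^sup>2\<close> and Parseval's identity\<close>

lemma L2_iff: "v \<in> L2 \<Lambda> \<longleftrightarrow>
    v \<in> borel_measurable (lebesgue_on \<Lambda>) \<and> integrable (lebesgue_on \<Lambda>) (\<lambda>x. (v x)\<^sup>2)"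
  by (simp add: Lp_def)

lemma L2_mult_integrable:
  assumes "v \<in> L2 \<Lambda>" "w \<in> L2 \<Lambda>"
  shows "integrable (lebesgue_on \<Lambda>) (\<lambda>x. v x * w x)"
proof (rule Bochner_Integration.integrable_bound)
  show "integrable (lebesgue_on \<Lambda>) (\<lambda>x. (v x)\<^sup>2 + (w x)\<^sup>2)" using assms by (auto simp: L2_iff)
  have "\<bar>v x * w x\<bar> \<le> (v x)\<^sup>2 + (w x)\<^sup>2" for x
  proof -
    have "2 * (\<bar>v x\<bar> * \<bar>w x\<bar>) \<le> (v x)\<^sup>2 + (w x)\<^sup>2"
      using sum_squares_bound[of "\<bar>v x\<bar>" "\<bar>w x\<bar>"] by simp
    moreover have "0 \<le> \<bar>v x\<bar> * \<bar>w x\<bar>" by simp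
    ultimately show ?thesis unfolding abs_mult by linarith
  qed
  then show "AE x in lebesgue_on \<Lambda>. norm (v x * w x) \<le> norm ((v x)\<^sup>2 + (w x)\<^sup>2)"
    by (simp add: order_trans[OF _ abs_ge_self])
qed (use assms in \<open>auto simp: L2_iff\<close>)

lemma L2_scale: "v \<in> L2 \<Lambda> \<Longrightarrow> (\<lambda>x. a * v x) \<in> L2 \<Lambda>"
  by (auto simp: L2_iff power_mult_distrib)

lemma L2_add:
  assumes "v \<in> L2 \<Lambda>" "w \<in> L2 \<Lambda>" shows "(\<lambda>x. v x + w x) \<in> L2 \<Lambda>"
  using assms L2_mult_integrable[OF assms] by (auto simp: L2_iff power2_sum mult.assoc)

lemma L2_diff:
  assumes "v \<in> L2 \<Lambda>" "w \<in> L2 \<Lambda>" shows "(\<lambda>x. v x - w x) \<in> L2 \<Lambda>"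
  using L2_add[OF assms(1) L2_scale[OF assms(2), of "- 1"]] by simp

lemma L2_sum: "(\<And>k. k \<in> A \<Longrightarrow> v k \<in> L2 \<Lambda>) \<Longrightarrow> (\<lambda>x. \<Sum>k\<in>A. v k x) \<in> L2 \<Lambda>"
proof (induction A rule: infinite_finite_induct)
  case (insert k A)
  then show ?case using L2_add[of "v k" \<Lambda> "\<lambda>x. \<Sum>k\<in>A. v k x"] by simp
qed (auto simp: L2_iff)

lemma L2_inner_commute: "L2_inner \<Lambda> v w = L2_inner \<Lambda> w v"
  by (simp add: L2_inner_def mult.commute)

lemma L2_inner_add_left:
  assumes "v \<in> L2 \<Lambda>" "w \<in> L2 \<Lambda>" "z \<in> L2 \<Lambda>"
  shows "L2_inner \<Lambda> (\<lambda>x. v x + w x) z = L2_inner \<Lambda> v z + L2_inner \<Lambda> w z"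
  using assms by (simp add: L2_inner_def distrib_right L2_mult_integrable)

lemma L2_inner_diff_left:
  assumes "v \<in> L2 \<Lambda>" "w \<in> L2 \<Lambda>" "z \<in> L2 \<Lambda>"
  shows "L2_inner \<Lambda> (\<lambda>x. v x - w x) z = L2_inner \<Lambda> v z - L2_inner \<Lambda> w z"
  using assms by (simp add: L2_inner_def left_diff_distrib L2_mult_integrable)

lemma L2_inner_scale_left: "L2_inner \<Lambda> (\<lambda>x. a * v x) z = a * L2_inner \<Lambda> v z"
  by (simp add: L2_inner_def mult.assoc)

lemma L2_inner_sum_left:
  assumes "\<And>k. k \<in> A \<Longrightarrow> v k \<in> L2 \<Lambda>" "z \<in> L2 \<Lambda>"
  shows "L2_inner \<Lambda> (\<lambda>x. \<Sum>k\<in>A. v k x) z = (\<Sum>k\<in>A. L2_inner \<Lambda> (v k) z)"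
  using assms
  by (simp add: L2_inner_def sum_distrib_right L2_mult_integrable Bochner_Integration.integral_sum)

lemma L2_inner_cong_AE:
  assumes "AE x in lebesgue_on \<Lambda>. v x = v' x" "v \<in> L2 \<Lambda>" "v' \<in> L2 \<Lambda>" "z \<in> L2 \<Lambda>"
  shows "L2_inner \<Lambda> v z = L2_inner \<Lambda> v' z"
  unfolding L2_inner_def
  by (rule integral_cong_AE) (use assms in \<open>auto simp: L2_iff\<close>)

lemma L2_norm_nonneg: "0 \<le> L2_norm \<Lambda> v"
  by (simp add: Lp_norm_def)

lemma L2_norm_square: "(L2_norm \<Lambda> v)\<^sup>2 = L2_inner \<Lambda> v v"
proof -
  have "(L2_norm \<Lambda> v)\<^sup>2 = (LINT x|lebesgue_on \<Lambda>. (v x)\<^sup>2)"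
    unfolding Lp_norm_def by (subst real_root_pow_pos2) auto
  then show ?thesis by (simp add: L2_inner_def power2_eq_square)
qed

lemma L2_norm_square_integral: "(L2_norm \<Lambda> v)\<^sup>2 = (LINT x|lebesgue_on \<Lambda>. (v x)\<^sup>2)"
  unfolding L2_norm_square by (simp add: L2_inner_def power2_eq_square)

lemma L2_norm_scale: "L2_norm \<Lambda> (\<lambda>x. a * v x) = \<bar>a\<bar> * L2_norm \<Lambda> v"
  by (rule power2_eq_imp_eq)
    (simp_all add: L2_norm_nonneg power_mult_distrib L2_norm_square_integral)

lemma L2_norm_minus_commute: "L2_norm \<Lambda> (\<lambda>x. v x - w x) = L2_norm \<Lambda> (\<lambda>x. w x - v x)"
  by (simp add: Lp_norm_def power2_commute)

lemma L2_norm_cong_AE: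
  assumes "AE x in lebesgue_on \<Lambda>. v x = v' x" "v \<in> L2 \<Lambda>" "v' \<in> L2 \<Lambda>"
  shows "L2_norm \<Lambda> v = L2_norm \<Lambda> v'"
  unfolding Lp_norm_def
  by (intro arg_cong[of _ _ "root 2"] integral_cong_AE) (use assms in \<open>auto simp: L2_iff\<close>)

lemma L2_norm_square_add:
  assumes "v \<in> L2 \<Lambda>" "w \<in> L2 \<Lambda>"
  shows "(L2_norm \<Lambda> (\<lambda>x. v x + w x))\<^sup>2 = (L2_norm \<Lambda> v)\<^sup>2 + 2 * L2_inner \<Lambda> v w + (L2_norm \<Lambda> w)\<^sup>2"
  using assms L2_mult_integrable[OF assms]
  by (simp add: L2_norm_square_integral power2_sum L2_inner_def L2_iff mult.assoc)

lemma L2_norm_square_diff: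
  assumes "v \<in> L2 \<Lambda>" "w \<in> L2 \<Lambda>"
  shows "(L2_norm \<Lambda> (\<lambda>x. v x - w x))\<^sup>2 = (L2_norm \<Lambda> v)\<^sup>2 - 2 * L2_inner \<Lambda> v w + (L2_norm \<Lambda> w)\<^sup>2"
  using assms L2_mult_integrable[OF assms]
  by (simp add: L2_norm_square_integral power2_diff L2_inner_def L2_iff mult.assoc)

text \<open>
  The quadratic \<open>\<parallel>t v + w\<parallel>\<^sup>2\<close> in \<open>t\<close> is nonnegative; evaluate it at its minimiser.
\<close>

lemma L2_Cauchy_Schwarz:
  assumes "v \<in> L2 \<Lambda>" "w \<in> L2 \<Lambda>"
  shows "\<bar>L2_inner \<Lambda> v w\<bar> \<le> L2_norm \<Lambda> v * L2_norm \<Lambda> w"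
proof -
  let ?a = "L2_norm \<Lambda> w" and ?b = "L2_norm \<Lambda> v"
  have sq: "0 \<le> t\<^sup>2 * ?b\<^sup>2 + 2 * (t * L2_inner \<Lambda> v w) + ?a\<^sup>2" for t
    using L2_norm_square_add[OF L2_scale[OF assms(1)] assms(2), of t]
      zero_le_power2[of "L2_norm \<Lambda> (\<lambda>x. t * v x + w x)"]
    by (simp add: L2_norm_scale L2_inner_scale_left power_mult_distrib)
  have "(L2_inner \<Lambda> v w)\<^sup>2 \<le> ?b\<^sup>2 * ?a\<^sup>2"
  proof (cases "?b = 0")
    case True
    have "L2_inner \<Lambda> v w = 0"
    proof (rule ccontr)
      \<comment> \<open>the quadratic has degenerated to an affine function of \<open>t\<close>; choose \<open>t\<close> where it equals \<open>-1\<close>\<close>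
      assume ne: "L2_inner \<Lambda> v w \<noteq> 0"
      from sq[of "- (?a\<^sup>2 + 1) / (2 * L2_inner \<Lambda> v w)"] True ne
      have "0 \<le> - (?a\<^sup>2 + 1) + ?a\<^sup>2" by (simp add: field_simps)
      then show False by simp
    qed
    then show ?thesis by simp
  next
    case False
    from sq[of "- L2_inner \<Lambda> v w / ?b\<^sup>2"] False
    have "0 \<le> (- L2_inner \<Lambda> v w / ?b\<^sup>2)\<^sup>2 * ?b\<^sup>2 + 2 * (- L2_inner \<Lambda> v w / ?b\<^sup>2 * L2_inner \<Lambda> v w) + ?a\<^sup>2"
      by simp
    also have "\<dots> = ?a\<^sup>2 - (L2_inner \<Lambda> v w)\<^sup>2 / ?b\<^sup>2"
      using False by (simp add: field_simps power2_eq_square)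
    finally show ?thesis using False by (simp add: field_simps)
  qed
  then have "\<bar>L2_inner \<Lambda> v w\<bar>\<^sup>2 \<le> (?b * ?a)\<^sup>2" by (simp add: power_mult_distrib)
  then show ?thesis by (rule power2_le_imp_le) (simp add: L2_norm_nonneg)
qed

lemma L2_triangle:
  assumes "v \<in> L2 \<Lambda>" "w \<in> L2 \<Lambda>"
  shows "L2_norm \<Lambda> (\<lambda>x. v x + w x) \<le> L2_norm \<Lambda> v + L2_norm \<Lambda> w"
proof (rule power2_le_imp_le)
  show "(L2_norm \<Lambda> (\<lambda>x. v x + w x))\<^sup>2 \<le> (L2_norm \<Lambda> v + L2_norm \<Lambda> w)\<^sup>2"
    using L2_Cauchy_Schwarz[OF assms] by (simp add: L2_norm_square_add assms power2_sum)
qed (simp add: L2_norm_nonneg)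

lemma L2_triangle_diff:
  assumes "v \<in> L2 \<Lambda>" "w \<in> L2 \<Lambda>"
  shows "L2_norm \<Lambda> v \<le> L2_norm \<Lambda> w + L2_norm \<Lambda> (\<lambda>x. v x - w x)"
  using L2_triangle[OF assms(2) L2_diff[OF assms]] by simp

lemma L2_triangle_minus:
  assumes "v \<in> L2 \<Lambda>" "w \<in> L2 \<Lambda>"
  shows "L2_norm \<Lambda> (\<lambda>x. v x - w x) \<le> L2_norm \<Lambda> v + L2_norm \<Lambda> w"
  using L2_triangle[OF assms(1) L2_scale[OF assms(2), of "- 1"]] L2_norm_scale[of \<Lambda> "- 1" w] by simp

lemma L2_norm_square_diff_le:
  assumes "v \<in> L2 \<Lambda>" "w \<in> L2 \<Lambda>"
  shows "(L2_norm \<Lambda> (\<lambda>x. v x - w x))\<^sup>2 \<le> 2 * (L2_norm \<Lambda> v)\<^sup>2 + 2 * (L2_norm \<Lambda> w)\<^sup>2"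
proof -
  have "(L2_norm \<Lambda> (\<lambda>x. v x - w x))\<^sup>2 \<le> (L2_norm \<Lambda> v + L2_norm \<Lambda> w)\<^sup>2"
    by (intro power_mono L2_triangle_minus assms L2_norm_nonneg)
  also have "\<dots> \<le> 2 * (L2_norm \<Lambda> v)\<^sup>2 + 2 * (L2_norm \<Lambda> w)\<^sup>2"
    using sum_squares_bound[of "L2_norm \<Lambda> v" "L2_norm \<Lambda> w"] by (simp add: power2_sum)
  finally show ?thesis .
qed

lemma L2_dominated:
  assumes v: "v \<in> L2 \<Lambda>" and u: "u \<in> borel_measurable (lebesgue_on \<Lambda>)" and m: "0 \<le> m"
    and le: "AE x in lebesgue_on \<Lambda>. \<bar>u x\<bar> \<le> m * \<bar>v x\<bar>"
  shows "u \<in> L2 \<Lambda>" "L2_norm \<Lambda> u \<le> m * L2_norm \<Lambda> v"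
proof -
  have le2: "AE x in lebesgue_on \<Lambda>. (u x)\<^sup>2 \<le> m\<^sup>2 * (v x)\<^sup>2"
    using le
  proof eventually_elim
    case (elim x)
    then have "\<bar>u x\<bar>\<^sup>2 \<le> (m * \<bar>v x\<bar>)\<^sup>2" by (rule power_mono) simp
    then show ?case by (simp add: power_mult_distrib)
  qed
  have iv: "integrable (lebesgue_on \<Lambda>) (\<lambda>x. m\<^sup>2 * (v x)\<^sup>2)" using v by (simp add: L2_iff)
  have "integrable (lebesgue_on \<Lambda>) (\<lambda>x. (u x)\<^sup>2)"
    by (rule Bochner_Integration.integrable_bound[OF iv]) (use u le2 in auto)
  with u show uL: "u \<in> L2 \<Lambda>" by (simp add: L2_iff)
  show "L2_norm \<Lambda> u \<le> m * L2_norm \<Lambda> v"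
  proof (rule power2_le_imp_le)
    have "(L2_norm \<Lambda> u)\<^sup>2 \<le> (LINT x|lebesgue_on \<Lambda>. m\<^sup>2 * (v x)\<^sup>2)"
      unfolding L2_norm_square_integral using uL iv le2 by (intro integral_mono_AE) (auto simp: L2_iff)
    then show "(L2_norm \<Lambda> u)\<^sup>2 \<le> (m * L2_norm \<Lambda> v)\<^sup>2"
      by (simp add: L2_norm_square_integral power_mult_distrib)
  qed (simp add: m L2_norm_nonneg)
qed

lemma L2_inner_le:
  assumes L: "u \<in> L2 \<Lambda>" "v \<in> L2 \<Lambda>" "w \<in> L2 \<Lambda>" and le: "AE x in lebesgue_on \<Lambda>. u x * v x \<le> m * (w x)\<^sup>2"
  shows "L2_inner \<Lambda> u v \<le> m * (L2_norm \<Lambda> w)\<^sup>2"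
proof -
  have "L2_inner \<Lambda> u v \<le> (LINT x|lebesgue_on \<Lambda>. m * (w x)\<^sup>2)"
    unfolding L2_inner_def
    by (intro integral_mono_AE L2_mult_integrable L le integrable_mult_right) (use L in \<open>simp add: L2_iff\<close>)
  then show ?thesis by (simp add: L2_norm_square_integral)
qed

lemma L2_bounded:
  assumes "\<Lambda> \<in> lmeasurable" "v \<in> borel_measurable (lebesgue_on \<Lambda>)" "AE x in lebesgue_on \<Lambda>. \<bar>v x\<bar> \<le> K"
  shows "v \<in> L2 \<Lambda>"
proof -
  interpret finite_measure "lebesgue_on \<Lambda>" by (rule finite_measure_lebesgue_on) fact
  have "AE x in lebesgue_on \<Lambda>. norm ((v x)\<^sup>2) \<le> K\<^sup>2"
    using assms(3) by eventually_elim (auto simp: abs_le_square_iff[symmetric])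
  then have "integrable (lebesgue_on \<Lambda>) (\<lambda>x. (v x)\<^sup>2)"
    using assms(2) by (intro integrable_const_bound) auto
  with assms show ?thesis by (simp add: L2_iff)
qed

lemma L2_imp_integrable:
  assumes "\<Lambda> \<in> lmeasurable" "v \<in> L2 \<Lambda>" shows "integrable (lebesgue_on \<Lambda>) v"
  using L2_mult_integrable[OF assms(2) L2_bounded[OF assms(1), of "\<lambda>_. 1" 1]] by simp

text \<open>
  Riesz--Fischer for the partial sums of an orthogonal expansion: they are Cauchy by Bessel's
  inequality, a subsequence converges almost everywhere, and by Fatou the limit is also the
  \<open>L\<^sup>2\<close>-limit. Totality of the system identifies this limit.
\<close>

theorem Parseval_norm:
  assumes meas: "\<Lambda> \<in> lmeasurable" and basis: "orthonormal_basis \<Lambda> e" and v: "v \<in> L2 \<Lambda>"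
  shows "(\<lambda>k. (L2_inner \<Lambda> v (e k))\<^sup>2) sums (L2_norm \<Lambda> v)\<^sup>2"
    and "(\<lambda>n. L2_norm \<Lambda> (\<lambda>x. v x - (\<Sum>k<n. L2_inner \<Lambda> v (e k) * e k x))) \<longlonglongrightarrow> 0"
proof -
  interpret finite_measure "lebesgue_on \<Lambda>" by (rule finite_measure_lebesgue_on) fact
  define c where "c k = L2_inner \<Lambda> v (e k)" for k
  define S where "S n x = (\<Sum>k<n. c k * e k x)" for n x
  have e: "\<And>k. e k \<in> L2 \<Lambda>" and ee: "\<And>j k. L2_inner \<Lambda> (e j) (e k) = (if j = k then 1 else 0)"
    using basis by (auto simp: orthonormal_basis_def)
  have eS: "(\<lambda>x. \<Sum>k\<in>A. c k * e k x) \<in> L2 \<Lambda>" for A by (intro L2_sum L2_scale e)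
  then have S: "S n \<in> L2 \<Lambda>" for n by (simp add: S_def[abs_def])
  have inner_S: "L2_inner \<Lambda> (\<lambda>x. \<Sum>k\<in>A. c k * e k x) (e j) = (if j \<in> A then c j else 0)"
    if "finite A" for A j
    using that by (subst L2_inner_sum_left) (simp_all add: L2_scale e L2_inner_scale_left ee if_distrib[of "(*) _"] sum.delta cong: if_cong)
  have norm_sum: "(L2_norm \<Lambda> (\<lambda>x. \<Sum>k\<in>A. c k * e k x))\<^sup>2 = (\<Sum>k\<in>A. (c k)\<^sup>2)" if "finite A" for A
  proof -
    have "(L2_norm \<Lambda> (\<lambda>x. \<Sum>k\<in>A. c k * e k x))\<^sup>2 =
        (\<Sum>j\<in>A. L2_inner \<Lambda> (\<lambda>x. c j * e j x) (\<lambda>x. \<Sum>k\<in>A. c k * e k x))"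
      unfolding L2_norm_square by (rule L2_inner_sum_left) (auto intro: eS L2_scale e)
    also have "\<dots> = (\<Sum>j\<in>A. (c j)\<^sup>2)"
      using that inner_S[OF that]
      by (intro sum.cong) (simp_all add: L2_inner_scale_left L2_inner_commute[of _ "e _"] power2_eq_square)
    finally show ?thesis .
  qed
  have inner_vS: "L2_inner \<Lambda> v (S n) = (\<Sum>k<n. (c k)\<^sup>2)" for n
    unfolding S_def[abs_def] L2_inner_commute[of _ v]
    by (subst L2_inner_sum_left)
      (simp_all add: v L2_scale e L2_inner_scale_left c_def L2_inner_commute[of _ _ v] power2_eq_square)
  have norm_diff: "(L2_norm \<Lambda> (\<lambda>x. v x - S n x))\<^sup>2 = (L2_norm \<Lambda> v)\<^sup>2 - (\<Sum>k<n. (c k)\<^sup>2)" for n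
    using norm_sum[of "{..<n}"] by (simp add: L2_norm_square_diff v S inner_vS) (simp add: S_def[abs_def])
  have bessel: "(\<Sum>k<n. (c k)\<^sup>2) \<le> (L2_norm \<Lambda> v)\<^sup>2" for n
    using norm_diff[of n] zero_le_power2[of "L2_norm \<Lambda> (\<lambda>x. v x - S n x)"] by linarith
  have sm: "summable (\<lambda>k. (c k)\<^sup>2)"
    by (rule summableI_nonneg_bounded[OF _ bessel]) simp
  define tail where "tail n = (\<Sum>k. (c (k + n))\<^sup>2)" for n
  have tail_0: "tail \<longlonglongrightarrow> 0" unfolding tail_def by (rule suminf_exist_split2[OF sm])
  have tail_nonneg: "0 \<le> tail n" for n
    unfolding tail_def by (intro suminf_nonneg summable_ignore_initial_segment[OF sm]) simp
  have SS: "(L2_norm \<Lambda> (\<lambda>x. S m x - S n x))\<^sup>2 \<le> tail n" if "n \<le> m" for m n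
  proof -
    have "S m x - S n x = (\<Sum>k\<in>{n..<m}. c k * e k x)" for x
      using that by (simp add: S_def lessThan_atLeast0 sum_diff_nat_ivl)
    then have "(L2_norm \<Lambda> (\<lambda>x. S m x - S n x))\<^sup>2 = (\<Sum>k\<in>{n..<m}. (c k)\<^sup>2)"
      by (simp add: norm_sum)
    also have "\<dots> = (\<Sum>k<m - n. (c (k + n))\<^sup>2)"
      using that sum.shift_bounds_nat_ivl[of "\<lambda>k. (c k)\<^sup>2" 0 n "m - n"] by (simp add: lessThan_atLeast0)
    also have "\<dots> \<le> tail n"
      unfolding tail_def by (intro sum_le_suminf summable_ignore_initial_segment[OF sm]) auto
    finally show ?thesis .
  qed
  have L1: "integrable (lebesgue_on \<Lambda>) (S n)" for n by (rule L2_imp_integrable[OF meas S])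
  have one: "(\<lambda>_. 1) \<in> L2 \<Lambda>" by (rule L2_bounded[OF meas, of _ 1]) auto
  have L1_bound: "(LINT x|lebesgue_on \<Lambda>. \<bar>w x\<bar>) \<le> L2_norm \<Lambda> w * L2_norm \<Lambda> (\<lambda>_. 1)" if "w \<in> L2 \<Lambda>" for w
  proof -
    have "(\<lambda>x. \<bar>w x\<bar>) \<in> L2 \<Lambda>" using that by (auto simp: L2_iff)
    from L2_Cauchy_Schwarz[OF this one] show ?thesis by (simp add: L2_inner_def Lp_norm_def)
  qed
  have "\<exists>N. \<forall>i\<ge>N. \<forall>j\<ge>N. (LINT x|lebesgue_on \<Lambda>. norm (S i x - S j x)) < \<epsilon>" if "\<epsilon> > 0" for \<epsilon>
  proof -
    define a where "a = L2_norm \<Lambda> (\<lambda>_. 1) + 1"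
    have a: "a > 0" "L2_norm \<Lambda> (\<lambda>_. 1) \<le> a" using L2_norm_nonneg[of \<Lambda> "\<lambda>_. 1"] by (auto simp: a_def)
    have "\<forall>\<^sub>F n in sequentially. tail n < (\<epsilon> / a)\<^sup>2"
      using tail_0 a that by (intro order_tendstoD) auto
    then obtain N where N: "\<And>n. n \<ge> N \<Longrightarrow> tail n < (\<epsilon> / a)\<^sup>2" by (auto simp: eventually_sequentially)
    have le: "(LINT x|lebesgue_on \<Lambda>. norm (S i x - S j x)) < \<epsilon>" if "N \<le> j" "j \<le> i" for i j
    proof -
      have "(L2_norm \<Lambda> (\<lambda>x. S i x - S j x))\<^sup>2 < (\<epsilon> / a)\<^sup>2"
        using SS[OF that(2)] N[OF that(1)] by linarith
      then have "L2_norm \<Lambda> (\<lambda>x. S i x - S j x) < \<epsilon> / a"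
        by (rule power2_less_imp_less) (use \<open>\<epsilon> > 0\<close> a in simp)
      then have "L2_norm \<Lambda> (\<lambda>x. S i x - S j x) * a < \<epsilon>" using a by (simp add: field_simps)
      moreover have "(LINT x|lebesgue_on \<Lambda>. \<bar>S i x - S j x\<bar>) \<le> L2_norm \<Lambda> (\<lambda>x. S i x - S j x) * a"
        using L1_bound[OF L2_diff[OF S S], of i j] a(2)
        by (meson L2_norm_nonneg mult_left_mono order_trans)
      ultimately show ?thesis by simp
    qed
    show ?thesis
    proof (intro exI[of _ N] allI impI)
      fix i j assume ij: "N \<le> i" "N \<le> j"
      show "(LINT x|lebesgue_on \<Lambda>. norm (S i x - S j x)) < \<epsilon>"
        using le[of j i] le[of i j] ij by (cases "j \<le> i") (simp_all add: abs_minus_commute)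
    qed
  qed
  \<comment> \<open>on a set of finite measure, Cauchy in \<open>L\<^sup>2\<close> implies Cauchy in \<open>L\<^sup>1\<close>\<close>
  then obtain r where r: "strict_mono r" "AE x in lebesgue_on \<Lambda>. Cauchy (\<lambda>i. S (r i) x)"
    using cauchy_L1_AE_cauchy_subseq[of "lebesgue_on \<Lambda>" S] L1 by metis
  define s where "s x = lim (\<lambda>i. S (r i) x)" for x
  have Sm: "S n \<in> borel_measurable (lebesgue_on \<Lambda>)" for n using S by (simp add: L2_iff)
  have sm_s: "s \<in> borel_measurable (lebesgue_on \<Lambda>)"
    unfolding s_def[abs_def] by (intro borel_measurable_lim_metric Sm)
  have lim_s: "AE x in lebesgue_on \<Lambda>. (\<lambda>i. S (r i) x) \<longlonglongrightarrow> s x"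
    using r(2) by eventually_elim (simp add: s_def Cauchy_convergent convergent_LIMSEQ_iff[symmetric])
  have fatou: "(\<integral>\<^sup>+x. ennreal ((s x - S n x)\<^sup>2) \<partial>lebesgue_on \<Lambda>) \<le> ennreal (tail n)" for n
  proof -
    have "(\<integral>\<^sup>+x. ennreal ((s x - S n x)\<^sup>2) \<partial>lebesgue_on \<Lambda>) =
        (\<integral>\<^sup>+x. liminf (\<lambda>i. ennreal ((S (r i) x - S n x)\<^sup>2)) \<partial>lebesgue_on \<Lambda>)"
    proof (rule nn_integral_cong_AE)
      show "AE x in lebesgue_on \<Lambda>. ennreal ((s x - S n x)\<^sup>2) = liminf (\<lambda>i. ennreal ((S (r i) x - S n x)\<^sup>2))"
        using lim_s
      proof eventually_elim
        case (elim x)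
        then have "(\<lambda>i. ennreal ((S (r i) x - S n x)\<^sup>2)) \<longlonglongrightarrow> ennreal ((s x - S n x)\<^sup>2)"
          by (intro tendsto_ennrealI tendsto_intros)
          from lim_imp_Liminf[OF sequentially_bot this] show ?case by (rule sym)
      qed
    qed
    also have "\<dots> \<le> liminf (\<lambda>i. \<integral>\<^sup>+x. ennreal ((S (r i) x - S n x)\<^sup>2) \<partial>lebesgue_on \<Lambda>)"
      using Sm by (intro nn_integral_liminf) measurable
    also have "\<dots> \<le> liminf (\<lambda>i. ennreal (tail n))"
    proof (rule Liminf_mono, rule eventually_sequentiallyI[of n])
      fix i assume "n \<le> i"
      then have i: "n \<le> r i" using seq_suble[OF r(1), of i] by linarith
      have "(\<integral>\<^sup>+x. ennreal ((S (r i) x - S n x)\<^sup>2) \<partial>lebesgue_on \<Lambda>) =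
          ennreal ((L2_norm \<Lambda> (\<lambda>x. S (r i) x - S n x))\<^sup>2)"
        unfolding L2_norm_square_integral
        using L2_diff[OF S S] by (intro nn_integral_eq_integral) (auto simp: L2_iff)
      also have "\<dots> \<le> ennreal (tail n)" using SS[OF i] by (rule ennreal_leI)
      finally show "(\<integral>\<^sup>+x. ennreal ((S (r i) x - S n x)\<^sup>2) \<partial>lebesgue_on \<Lambda>) \<le> ennreal (tail n)" .
    qed
    also have "\<dots> = ennreal (tail n)" by (simp add: Liminf_const)
    finally show ?thesis .
  qed
  have sS: "(\<lambda>x. s x - S n x) \<in> L2 \<Lambda>" "(L2_norm \<Lambda> (\<lambda>x. s x - S n x))\<^sup>2 \<le> tail n" for n
  proof -
    have i: "integrable (lebesgue_on \<Lambda>) (\<lambda>x. (s x - S n x)\<^sup>2)"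
      using fatou[of n] sm_s Sm by (intro integrableI_bounded) (auto simp: le_less_trans)
    then show "(\<lambda>x. s x - S n x) \<in> L2 \<Lambda>" using sm_s Sm by (auto simp: L2_iff)
    have "ennreal ((L2_norm \<Lambda> (\<lambda>x. s x - S n x))\<^sup>2) \<le> ennreal (tail n)"
      using fatou[of n] i by (simp add: L2_norm_square_integral nn_integral_eq_integral)
    then show "(L2_norm \<Lambda> (\<lambda>x. s x - S n x))\<^sup>2 \<le> tail n" using tail_nonneg by simp
  qed
  have s: "s \<in> L2 \<Lambda>" using sS(1)[of 0] by (simp add: S_def)
  have sqrt_tail: "(\<lambda>n. sqrt (tail n)) \<longlonglongrightarrow> 0" using tendsto_real_sqrt[OF tail_0] by simp
  have sS': "L2_norm \<Lambda> (\<lambda>x. s x - S n x) \<le> sqrt (tail n)" for n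
    using sS(2)[of n] by (rule real_le_rsqrt)
  \<comment> \<open>\<open>s\<close> has the same coefficients as \<open>v\<close>, so totality gives \<open>s = v\<close>\<close>
  have "L2_inner \<Lambda> (\<lambda>x. s x - v x) (e k) = 0" for k
  proof -
    have "(\<lambda>n. L2_inner \<Lambda> (\<lambda>x. s x - S n x) (e k)) \<longlonglongrightarrow> 0"
    proof (rule tendsto_rabs_zero_cancel, rule Lim_null_comparison[OF _ tendsto_mult_left_zero[OF sqrt_tail]])
      show "\<forall>\<^sub>F n in sequentially. norm \<bar>L2_inner \<Lambda> (\<lambda>x. s x - S n x) (e k)\<bar> \<le> sqrt (tail n) * L2_norm \<Lambda> (e k)"
        using order_trans[OF L2_Cauchy_Schwarz[OF sS(1) e] mult_right_mono[OF sS' L2_norm_nonneg]] by simp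
    qed
    moreover have "\<forall>\<^sub>F n in sequentially. L2_inner \<Lambda> (\<lambda>x. s x - S n x) (e k) = L2_inner \<Lambda> s (e k) - c k"
      using eventually_gt_at_top[of k]
      by eventually_elim (use inner_S[of "{..<_}"] in \<open>simp add: L2_inner_diff_left s S e, simp add: S_def[abs_def]\<close>)
    ultimately have "(\<lambda>n. L2_inner \<Lambda> s (e k) - c k) \<longlonglongrightarrow> 0" by (rule Lim_transform_eventually)
    then have "L2_inner \<Lambda> s (e k) - c k = 0" using LIMSEQ_unique tendsto_const by blast
    then show ?thesis by (simp add: L2_inner_diff_left s v e c_def)
  qed
  then have sv: "L2_norm \<Lambda> (\<lambda>x. s x - v x) = 0"
    using basis L2_diff[OF s v] by (auto simp: orthonormal_basis_def)
  have "L2_norm \<Lambda> (\<lambda>x. v x - S n x) \<le> sqrt (tail n)" for n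
    using L2_triangle[OF L2_diff[OF v s] sS(1), of n] sv sS'[of n] L2_norm_minus_commute[of \<Lambda> v s] by simp
  then have lim0: "(\<lambda>n. L2_norm \<Lambda> (\<lambda>x. v x - S n x)) \<longlonglongrightarrow> 0"
    by (intro Lim_null_comparison[OF _ sqrt_tail]) (simp add: L2_norm_nonneg)
  then show "(\<lambda>n. L2_norm \<Lambda> (\<lambda>x. v x - (\<Sum>k<n. L2_inner \<Lambda> v (e k) * e k x))) \<longlonglongrightarrow> 0"
    by (simp add: S_def c_def)
  from tendsto_diff[OF tendsto_const[of "(L2_norm \<Lambda> v)\<^sup>2"] tendsto_power[OF lim0, of 2]]
  have "(\<lambda>n. \<Sum>k<n. (c k)\<^sup>2) \<longlonglongrightarrow> (L2_norm \<Lambda> v)\<^sup>2" by (simp add: norm_diff)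
  then show "(\<lambda>k. (L2_inner \<Lambda> v (e k))\<^sup>2) sums (L2_norm \<Lambda> v)\<^sup>2"
    by (simp add: sums_def c_def)
qed

corollary Parseval:
  assumes meas: "\<Lambda> \<in> lmeasurable" and basis: "orthonormal_basis \<Lambda> e" and v: "v \<in> L2 \<Lambda>" and w: "w \<in> L2 \<Lambda>"
  shows "(\<lambda>k. L2_inner \<Lambda> v (e k) * L2_inner \<Lambda> w (e k)) sums L2_inner \<Lambda> v w"
proof -
  have e: "\<And>k. e k \<in> L2 \<Lambda>" using basis by (auto simp: orthonormal_basis_def)
  define S where "S n x = (\<Sum>k<n. L2_inner \<Lambda> v (e k) * e k x)" for n x
  have S: "S n \<in> L2 \<Lambda>" for n unfolding S_def[abs_def] by (intro L2_sum L2_scale e)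
  have inner: "L2_inner \<Lambda> (S n) w = (\<Sum>k<n. L2_inner \<Lambda> v (e k) * L2_inner \<Lambda> w (e k))" for n
    unfolding S_def[abs_def] using w e
    by (subst L2_inner_sum_left) (simp_all add: L2_scale L2_inner_scale_left L2_inner_commute[of _ w])
  have "(\<lambda>n. L2_inner \<Lambda> (\<lambda>x. v x - S n x) w) \<longlonglongrightarrow> 0"
  proof (rule tendsto_rabs_zero_cancel, rule Lim_null_comparison)
    show "\<forall>\<^sub>F n in sequentially. norm \<bar>L2_inner \<Lambda> (\<lambda>x. v x - S n x) w\<bar>
        \<le> L2_norm \<Lambda> (\<lambda>x. v x - S n x) * L2_norm \<Lambda> w"
      using L2_Cauchy_Schwarz[OF L2_diff[OF v S] w] by simp
    show "(\<lambda>n. L2_norm \<Lambda> (\<lambda>x. v x - S n x) * L2_norm \<Lambda> w) \<longlonglongrightarrow> 0"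
      unfolding S_def by (rule tendsto_mult_left_zero[OF Parseval_norm(2)[OF meas basis v]])
  qed
  from tendsto_diff[OF tendsto_const[of "L2_inner \<Lambda> v w"] this]
  show ?thesis by (simp add: L2_inner_diff_left v w S inner sums_def)
qed

section \<open>Weak derivatives on an interval\<close>

locale bounded_interval =
  fixes lo hi :: real
  assumes lo_less_hi: "lo < hi"
begin

abbreviation "I \<equiv> {lo<..<hi}"

lemma I_lmeasurable: "I \<in> lmeasurable"
  by simp

lemma continuous_on_measurable:
  assumes "continuous_on I v" shows "v \<in> borel_measurable (lebesgue_on I)"
  by (rule continuous_imp_measurable_on_sets_lebesgue[OF assms]) simp

lemma continuous_L2:
  assumes "continuous_on {lo..hi} v" shows "v \<in> L2 I"
proof -
  have "bounded (v ` {lo..hi})"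
    by (intro compact_imp_bounded compact_continuous_image assms) simp
  then obtain K where "\<And>x. x \<in> {lo..hi} \<Longrightarrow> \<bar>v x\<bar> \<le> K"
    unfolding bounded_iff by (metis imageI real_norm_def)
  then have "AE x in lebesgue_on I. \<bar>v x\<bar> \<le> K" by (intro AE_I2) simp
  moreover have "v \<in> borel_measurable (lebesgue_on I)"
    by (rule continuous_on_measurable) (rule continuous_on_subset[OF assms], auto)
  ultimately show ?thesis using L2_bounded[OF I_lmeasurable] by blast
qed

lemma smooth_L2: "smooth v \<Longrightarrow> v \<in> L2 I"
  by (intro continuous_L2 smooth_continuous)

lemma integral_derivative:
  assumes d: "\<And>x. (F has_real_derivative f x) (at x)" and c: "continuous_on {lo..hi} f"
  shows "(LINT x|lebesgue_on I. f x) = F hi - F lo"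
proof -
  have "(f has_integral F hi - F lo) {lo..hi}"
    using lo_less_hi d
    by (intro fundamental_theorem_of_calculus)
      (auto simp: has_real_derivative_iff_has_vector_derivative intro: has_vector_derivative_at_within)
  then have "(f has_integral F hi - F lo) I" by (simp add: has_integral_Icc_iff_Ioo)
  moreover have "(f has_integral (LINT x|lebesgue_on I. f x)) I"
    by (intro has_integral_integral_lebesgue_on L2_imp_integrable[OF I_lmeasurable] continuous_L2 c) simp
  ultimately show ?thesis using has_integral_unique by blast
qed

lemma test_functionD:
  assumes "test_function I \<phi>"
  shows "(\<phi> has_real_derivative deriv \<phi> x) (at x)" "continuous_on A \<phi>" "continuous_on A (deriv \<phi>)"
    "\<phi> lo = 0" "\<phi> hi = 0" "\<phi> \<in> L2 I" "deriv \<phi> \<in> L2 I"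
proof -
  have d: "((deriv ^^ k) \<phi>) field_differentiable (at x)" for k x
    using assms by (auto simp: test_function_def)
  from d[of 0] have 0: "\<phi> field_differentiable (at x)" for x by simp
  from d[of 1] have 1: "deriv \<phi> field_differentiable (at x)" for x by simp
  from 0 show "(\<phi> has_real_derivative deriv \<phi> x) (at x)"
    by (simp add: field_differentiable_derivI)
  have c: "continuous_on A \<phi>" "continuous_on A (deriv \<phi>)" for A
    using 0 1 by (auto intro!: continuous_at_imp_continuous_on field_differentiable_imp_continuous_at)
  then show "continuous_on A \<phi>" "continuous_on A (deriv \<phi>)" "\<phi> \<in> L2 I" "deriv \<phi> \<in> L2 I"
    by (auto intro: continuous_L2)
  have "{x. \<phi> x \<noteq> 0} \<subseteq> I"
    using assms closure_subset[of "{x. \<phi> x \<noteq> 0}"] unfolding test_function_def by blast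
  then show "\<phi> lo = 0" "\<phi> hi = 0" by auto
qed

lemma cutoff_tendsto_indicator: "(\<lambda>n. cutoff c d n x) \<longlonglongrightarrow> indicator {c<..<d} x"
proof (cases "x \<in> {c<..<d}")
  case True
  show ?thesis
    using cutoff_eventually_one[OF True]
    by (intro tendsto_eventually) (use True in \<open>auto elim: eventually_mono\<close>)
next
  case False
  have "cutoff c d n x = 0" for n
  proof -
    have "real (Suc n) * (x - c) \<le> 1 \<or> real (Suc n) * (d - x) \<le> 1"
      using False mult_nonneg_nonpos[of "real (Suc n)" "x - c"] mult_nonneg_nonpos[of "real (Suc n)" "d - x"]
      by force
    then show ?thesis by (auto simp: cutoff_def smooth_step_simps simp del: of_nat_Suc)
  qed
  with False show ?thesis by simp
qed

text \<open>
  Cut-offs converge to indicators of intervals, so the positive and the negative part of \<open>w\<close> are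
  densities of measures that agree on intervals. This is the fundamental lemma of the calculus of
  variations; it gives the uniqueness of weak derivatives and the totality of the cosines.
\<close>

lemma fundamental_lemma:
  assumes w: "integrable (lebesgue_on I) w"
    and zero: "\<And>\<phi>. test_function I \<phi> \<Longrightarrow> L2_inner I w \<phi> = 0"
  shows "AE x in lebesgue_on I. w x = 0"
proof -
  \<comment> \<open>\<open>w\<close> has integral zero over every interval that ends at \<open>hi\<close>\<close>
  have int0: "(LINT x|lebesgue_on I. w x * indicator {c<..<hi} x) = 0" if "lo \<le> c" for c
  proof -
    have "(\<lambda>n. LINT x|lebesgue_on I. w x * cutoff c hi n x) \<longlonglongrightarrow>
        (LINT x|lebesgue_on I. w x * indicator {c<..<hi} x)"
    proof (rule integral_dominated_convergence[where w = "\<lambda>x. \<bar>w x\<bar>"])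
      have "cutoff c hi n \<in> borel_measurable (lebesgue_on I)" for n
        by (intro continuous_on_measurable smooth_continuous smooth_cutoff)
      with w show "(\<lambda>x. w x * cutoff c hi n x) \<in> borel_measurable (lebesgue_on I)" for n by auto
      have "(\<lambda>n. w x * cutoff c hi n x) \<longlonglongrightarrow> w x * indicator {c<..<hi} x" for x
        by (intro tendsto_mult tendsto_const cutoff_tendsto_indicator)
      then show "AE x in lebesgue_on I. (\<lambda>n. w x * cutoff c hi n x) \<longlonglongrightarrow> w x * indicator {c<..<hi} x"
        by simp
      have "(\<lambda>x. indicator {c<..<hi} x :: real) \<in> borel_measurable (lebesgue_on I)"
        by (intro measurable_restrict_space1 borel_measurable_indicator) simp
      with w show "(\<lambda>x. w x * indicator {c<..<hi} x) \<in> borel_measurable (lebesgue_on I)" by auto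
      show "AE x in lebesgue_on I. norm (w x * cutoff c hi n x) \<le> \<bar>w x\<bar>" for n
        using cutoff_bounds[of c hi n] by (auto simp: abs_mult mult_left_le)
    qed (use w in auto)
    moreover have "(LINT x|lebesgue_on I. w x * cutoff c hi n x) = 0" for n
    proof -
      have "test_function I (\<lambda>x. cutoff c hi n x * 1)"
        using that by (intro test_function_cutoff_mult smooth_const) auto
      then show ?thesis using zero by (simp add: L2_inner_def)
    qed
    ultimately show ?thesis by (simp add: LIMSEQ_const_iff)
  qed
  have "(\<lambda>x. if x \<in> I then w x else 0) \<in> borel_measurable lebesgue"
    using w by (intro borel_measurable_if_I) auto
  then obtain w0 where w0: "w0 \<in> borel_measurable lborel"
      and w0_eq: "AE x in lborel. (if x \<in> I then w x else 0) = w0 x"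
    using completion_ex_borel_measurable_real by blast
  then have w0_eq': "AE x in lebesgue. w0 x = (if x \<in> I then w x else 0)"
    by (intro AE_completion) (auto elim: eventually_mono)
  have "integrable lebesgue (\<lambda>x. if x \<in> I then w x else 0)"
    using w integrable_restrict_space[of I lebesgue w] unfolding indicator_scaleR_eq_if by simp
  then have "integrable lebesgue w0"
    by (rule integrable_cong_AE_imp) (use w0 w0_eq' in \<open>auto intro: measurable_completion elim: eventually_mono\<close>)
  then have w0_int: "integrable lborel w0"
    using w0 by (simp add: integrable_completion)
  have w0_0: "(LINT x|lborel. w0 x * indicator {a<..} x) = 0" for a
  proof -
    have "(LINT x|lborel. w0 x * indicator {a<..} x) = (LINT x|lebesgue. w0 x * indicator {a<..} x)"
      using w0 by (subst integral_completion) auto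
    also have "\<dots> = (LINT x|lebesgue. indicator I x *\<^sub>R (w x * indicator {max a lo<..<hi} x))"
    proof (rule integral_cong_AE)
      show "(\<lambda>x. w0 x * indicator {a<..} x) \<in> borel_measurable lebesgue"
        using w0 by (intro measurable_completion) auto
      have "(\<lambda>x. if x \<in> I then w x else 0) \<in> borel_measurable lebesgue" by fact
      then have "(\<lambda>x. (if x \<in> I then w x else 0) * indicator {max a lo<..<hi} x) \<in> borel_measurable lebesgue"
        by (intro borel_measurable_times borel_measurable_indicator) auto
      moreover have "(\<lambda>x. (if x \<in> I then w x else 0) * indicator {max a lo<..<hi} x) =
          (\<lambda>x. indicator I x *\<^sub>R (w x * indicator {max a lo<..<hi} x))"
        by (auto simp: indicator_def)
      ultimately show "(\<lambda>x. indicator I x *\<^sub>R (w x * indicator {max a lo<..<hi} x)) \<in> borel_measurable lebesgue"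
        by simp
      show "AE x in lebesgue. w0 x * indicator {a<..} x = indicator I x *\<^sub>R (w x * indicator {max a lo<..<hi} x)"
        using w0_eq' by eventually_elim (auto simp: indicator_def)
    qed
    also have "\<dots> = (LINT x|lebesgue_on I. w x * indicator {max a lo<..<hi} x)"
      by (subst integral_restrict_space) auto
    also have "\<dots> = 0" by (rule int0) simp
    finally show ?thesis .
  qed
  \<comment> \<open>\<open>ennreal\<close> truncates at zero, so these are the densities of the two parts\<close>
  let ?P = "density lborel (\<lambda>x. ennreal (w0 x))" and ?N = "density lborel (\<lambda>x. ennreal (- w0 x))"
  have em: "emeasure ?P {a<..} = emeasure ?N {a<..}" "emeasure ?P {a<..} < \<infinity>" for a
  proof -
    let ?v = "\<lambda>x. w0 x * indicator {a<..} x"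
    have v: "integrable lborel ?v"
      using integrable_mult_indicator[OF _ w0_int, of "{a<..}"] by (simp add: mult.commute)
    have P: "emeasure ?P {a<..} = (\<integral>\<^sup>+x. ennreal (?v x) \<partial>lborel)"
      using w0 by (subst emeasure_density) (auto intro!: nn_integral_cong simp: indicator_def)
    have N: "emeasure ?N {a<..} = (\<integral>\<^sup>+x. ennreal (- ?v x) \<partial>lborel)"
      using w0 by (subst emeasure_density) (auto intro!: nn_integral_cong simp: indicator_def)
    have fin: "(\<integral>\<^sup>+x. ennreal (?v x) \<partial>lborel) < \<infinity>" "(\<integral>\<^sup>+x. ennreal (- ?v x) \<partial>lborel) < \<infinity>"
      using v by (auto simp: real_integrable_def less_top)
    have "enn2real (\<integral>\<^sup>+x. ennreal (?v x) \<partial>lborel) = enn2real (\<integral>\<^sup>+x. ennreal (- ?v x) \<partial>lborel)"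
      using w0_0[of a] real_lebesgue_integral_def[OF v] by simp
    then show "emeasure ?P {a<..} = emeasure ?N {a<..}" "emeasure ?P {a<..} < \<infinity>"
      using fin unfolding P N by (metis ennreal_enn2real infinity_ennreal_def, simp)
  qed
  have "?P = ?N"
    by (rule measure_eqI_lessThan) (use em in auto)
  then have "AE x in lborel. ennreal (w0 x) = ennreal (- w0 x)"
    using w0 by (intro sigma_finite_measure.density_unique[OF sigma_finite_lborel]) auto
  then have "AE x in lborel. w0 x = 0"
    by eventually_elim (metis ennreal_eq_0_iff ennreal_neg linorder_le_cases neg_0_le_iff_le neg_le_0_iff_le order_antisym)
  then have "AE x in lebesgue. w0 x = 0" by (rule AE_completion)
  with w0_eq' have "AE x in lebesgue. x \<in> I \<longrightarrow> w x = 0" by eventually_elim auto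
  then show ?thesis by (subst AE_restrict_space_iff) auto
qed

lemma weak_derivative_unique:
  assumes "w \<in> L2 I" "has_weak_derivative I v w" "w' \<in> L2 I" "has_weak_derivative I v w'"
  shows "AE x in lebesgue_on I. w x = w' x"
proof -
  have "AE x in lebesgue_on I. w x - w' x = 0"
  proof (rule fundamental_lemma)
    show "integrable (lebesgue_on I) (\<lambda>x. w x - w' x)"
      using assms by (intro L2_imp_integrable L2_diff I_lmeasurable)
    fix \<phi> assume "test_function I \<phi>"
    then show "L2_inner I (\<lambda>x. w x - w' x) \<phi> = 0"
      using assms test_functionD(6)[of \<phi>] by (simp add: L2_inner_diff_left has_weak_derivative_def)
  qed
  then show ?thesis by simp
qed

lemma weak_deriv:
  assumes "v \<in> H1 I"
  shows "weak_deriv I v \<in> L2 I" "has_weak_derivative I v (weak_deriv I v)"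
proof -
  from assms have "\<exists>w. w \<in> L2 I \<and> has_weak_derivative I v w" by (auto simp: H1_def)
  from someI_ex[OF this] show "weak_deriv I v \<in> L2 I" "has_weak_derivative I v (weak_deriv I v)"
    unfolding weak_deriv_def by blast+
qed

lemma H1_smooth:
  assumes "smooth v"
  shows "v \<in> H1 I" "AE x in lebesgue_on I. weak_deriv I v x = deriv v x"
proof -
  have "has_weak_derivative I v (deriv v)"
    unfolding has_weak_derivative_def
  proof (intro allI impI)
    fix \<phi> assume \<phi>: "test_function I \<phi>"
    note c = smooth_continuous[OF assms] smooth_continuous[OF smooth_deriv[OF assms]] test_functionD(2,3)[OF \<phi>]
    have "(LINT x|lebesgue_on I. v x * deriv \<phi> x + deriv v x * \<phi> x) = v hi * \<phi> hi - v lo * \<phi> lo"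
      by (rule integral_derivative)
        (auto intro!: derivative_eq_intros smooth_DERIV assms test_functionD(1)[OF \<phi>] continuous_intros c
          simp: algebra_simps)
    then show "L2_inner I v (deriv \<phi>) = - L2_inner I (deriv v) \<phi>"
      using L2_mult_integrable[OF smooth_L2[OF assms] test_functionD(7)[OF \<phi>]]
        L2_mult_integrable[OF smooth_L2[OF smooth_deriv[OF assms]] test_functionD(6)[OF \<phi>]]
        test_functionD(4,5)[OF \<phi>]
      by (simp add: L2_inner_def)
  qed
  moreover have L2: "v \<in> L2 I" "deriv v \<in> L2 I" by (auto intro: smooth_L2 smooth_deriv assms)
  ultimately show "v \<in> H1 I" by (auto simp: H1_def)
  from weak_derivative_unique[OF weak_deriv[OF this] L2(2) \<open>has_weak_derivative I v (deriv v)\<close>]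
  show "AE x in lebesgue_on I. weak_deriv I v x = deriv v x" .
qed

text \<open>
  The cut-offs have slope of order \<open>n\<close>, but only where a smooth function vanishing at the end points
  is of order \<open>1/n\<close>. Hence such functions may be used in the definition of the weak derivative in
  place of test functions.
\<close>

lemma weak_deriv_by_parts:
  assumes v: "v \<in> H1 I" and \<psi>: "smooth \<psi>" "\<psi> lo = 0" "\<psi> hi = 0"
  shows "L2_inner I (weak_deriv I v) \<psi> = - L2_inner I v (deriv \<psi>)"
proof -
  let ?w = "weak_deriv I v"
  have vL: "v \<in> L2 I" using v by (simp add: H1_def)
  have d\<psi>: "\<And>x. (\<psi> has_real_derivative deriv \<psi> x) (at x)" by (rule smooth_DERIV[OF \<psi>(1)])
  have "bounded (deriv \<psi> ` {lo..hi})"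
    by (intro compact_imp_bounded compact_continuous_image smooth_continuous smooth_deriv \<psi>) simp
  then obtain K where K: "\<And>x. x \<in> {lo..hi} \<Longrightarrow> \<bar>deriv \<psi> x\<bar> \<le> K"
    unfolding bounded_iff by (metis imageI real_norm_def)
  have "0 \<le> K" using K[of lo] lo_less_hi by simp
  have small: "\<bar>\<psi> x\<bar> \<le> K * min (x - lo) (hi - x)" if "x \<in> I" for x
  proof -
    have lip: "norm (\<psi> y - \<psi> z) \<le> K * norm (y - z)" if "y \<in> {lo..hi}" "z \<in> {lo..hi}" for y z
      by (rule field_differentiable_bound[of "{lo..hi}" \<psi> "deriv \<psi>"])
        (use that K in \<open>auto intro: has_field_derivative_at_within[OF d\<psi>]\<close>)
    from lip[of x lo] lip[of x hi] that \<psi> show ?thesis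
      by (auto simp: min_def abs_minus_commute)
  qed
  obtain C where C: "C \<ge> 0" "\<And>n x. x \<in> I \<Longrightarrow> \<bar>deriv (cutoff lo hi n) x\<bar> * min (x - lo) (hi - x) \<le> C"
    using deriv_cutoff_bound by metis
  let ?\<phi> = "\<lambda>n x. cutoff lo hi n x * \<psi> x"
  let ?d = "\<lambda>n x. deriv (cutoff lo hi n) x * \<psi> x + cutoff lo hi n x * deriv \<psi> x"
  have "L2_inner I ?w (?\<phi> n) = - L2_inner I v (?d n)" for n
  proof -
    have "deriv (?\<phi> n) = ?d n"
    proof
      fix x
      have "(?\<phi> n has_real_derivative ?d n x) (at x)"
        using DERIV_mult[OF smooth_DERIV[OF smooth_cutoff, of lo hi n x] d\<psi>[of x]]
        by (simp add: algebra_simps)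
      then show "deriv (?\<phi> n) x = ?d n x" by (rule DERIV_imp_deriv)
    qed
    moreover have "test_function I (?\<phi> n)" by (rule test_function_cutoff_mult) (use \<psi> in auto)
    ultimately show ?thesis
      using weak_deriv(2)[OF v] unfolding has_weak_derivative_def by (metis minus_minus)
  qed
  moreover have cm: "cutoff lo hi n \<in> borel_measurable (lebesgue_on I)"
      "deriv (cutoff lo hi n) \<in> borel_measurable (lebesgue_on I)"
      "\<psi> \<in> borel_measurable (lebesgue_on I)" "deriv \<psi> \<in> borel_measurable (lebesgue_on I)" for n
    by (auto intro!: continuous_on_measurable smooth_continuous smooth_deriv smooth_cutoff \<psi>)
  have wm: "?w \<in> borel_measurable (lebesgue_on I)" "v \<in> borel_measurable (lebesgue_on I)"
    using weak_deriv(1)[OF v] vL by (auto simp: L2_iff)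
  have "(\<lambda>n. L2_inner I ?w (?\<phi> n)) \<longlonglongrightarrow> L2_inner I ?w \<psi>"
    unfolding L2_inner_def
  proof (rule integral_dominated_convergence[where w = "\<lambda>x. \<bar>?w x * \<psi> x\<bar>"])
    show "integrable (lebesgue_on I) (\<lambda>x. \<bar>?w x * \<psi> x\<bar>)"
      by (intro integrable_abs L2_mult_integrable weak_deriv v smooth_L2 \<psi>)
    show "AE x in lebesgue_on I. (\<lambda>n. ?w x * (?\<phi> n x)) \<longlonglongrightarrow> ?w x * \<psi> x"
    proof (rule AE_I2)
      fix x assume "x \<in> space (lebesgue_on I)"
      then have "(\<lambda>n. ?w x * (?\<phi> n x)) \<longlonglongrightarrow> ?w x * (indicator I x * \<psi> x)"
        by (intro tendsto_mult tendsto_const cutoff_tendsto_indicator)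
      then show "(\<lambda>n. ?w x * (?\<phi> n x)) \<longlonglongrightarrow> ?w x * \<psi> x"
        using \<open>x \<in> space _\<close> by simp
    qed
    show "AE x in lebesgue_on I. norm (?w x * (?\<phi> n x)) \<le> \<bar>?w x * \<psi> x\<bar>" for n
      using cutoff_bounds[of lo hi n]
      by (intro AE_I2) (simp add: abs_mult mult_left_mono mult_left_le_one_le)
  qed (use cm wm in measurable)
  moreover have "(\<lambda>n. L2_inner I v (?d n)) \<longlonglongrightarrow> L2_inner I v (deriv \<psi>)"
    unfolding L2_inner_def
  proof (rule integral_dominated_convergence[where w = "\<lambda>x. \<bar>v x\<bar> * (K * C + K)"])
    show "integrable (lebesgue_on I) (\<lambda>x. \<bar>v x\<bar> * (K * C + K))"
      using L2_imp_integrable[OF I_lmeasurable vL] by auto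
    show "AE x in lebesgue_on I. (\<lambda>n. v x * ?d n x) \<longlonglongrightarrow> v x * deriv \<psi> x"
    proof (rule AE_I2)
      fix x assume "x \<in> space (lebesgue_on I)"
      then have "x \<in> I" by simp
      from cutoff_eventually_one[OF this]
      have "\<forall>\<^sub>F n in sequentially. v x * ?d n x = v x * deriv \<psi> x" by eventually_elim simp
      then show "(\<lambda>n. v x * ?d n x) \<longlonglongrightarrow> v x * deriv \<psi> x" by (rule tendsto_eventually)
    qed
    show "AE x in lebesgue_on I. norm (v x * ?d n x) \<le> \<bar>v x\<bar> * (K * C + K)" for n
    proof (rule AE_I2)
      fix x assume "x \<in> space (lebesgue_on I)"
      then have x: "x \<in> I" by simp
      have "\<bar>deriv (cutoff lo hi n) x * \<psi> x\<bar> \<le> \<bar>deriv (cutoff lo hi n) x\<bar> * (K * min (x - lo) (hi - x))"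
        unfolding abs_mult by (intro mult_left_mono small x) simp
      also have "\<dots> = K * (\<bar>deriv (cutoff lo hi n) x\<bar> * min (x - lo) (hi - x))" by simp
      also have "\<dots> \<le> K * C" by (intro mult_left_mono C x \<open>0 \<le> K\<close>)
      finally have "\<bar>deriv (cutoff lo hi n) x * \<psi> x\<bar> \<le> K * C" .
      moreover have "\<bar>cutoff lo hi n x * deriv \<psi> x\<bar> \<le> 1 * K"
        unfolding abs_mult using cutoff_bounds[of lo hi n x] K[of x] x by (intro mult_mono) auto
      ultimately have "\<bar>?d n x\<bar> \<le> K * C + K" by linarith
      then show "norm (v x * ?d n x) \<le> \<bar>v x\<bar> * (K * C + K)"
        unfolding real_norm_def abs_mult by (rule mult_left_mono) simp
    qed
  qed (use cm wm in measurable)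
  ultimately have "(\<lambda>n. - L2_inner I v (?d n)) \<longlonglongrightarrow> L2_inner I ?w \<psi>"
    "(\<lambda>n. - L2_inner I v (?d n)) \<longlonglongrightarrow> - L2_inner I v (deriv \<psi>)"
    by (simp, intro tendsto_minus)
  then show ?thesis by (rule LIMSEQ_unique)
qed

end

section \<open>The cosine basis\<close>

context bounded_interval
begin

definition freq :: "nat \<Rightarrow> real" where
  "freq k = real k * pi / (hi - lo)"

definition amplitude :: "nat \<Rightarrow> real" where
  "amplitude k = (if k = 0 then sqrt (1 / (hi - lo)) else sqrt (2 / (hi - lo)))"

text \<open>The eigenfunctions of the Neumann Laplacian, with eigenvalues \<open>-(freq k)\<^sup>2\<close>.\<close>

definition cosine :: "nat \<Rightarrow> real \<Rightarrow> real" where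
  "cosine k x = amplitude k * cos (freq k * (x - lo))"

definition coef :: "(real \<Rightarrow> real) \<Rightarrow> nat \<Rightarrow> real" where
  "coef v k = L2_inner I v (cosine k)"

lemma smooth_cosine: "smooth (cosine k)"
  using smooth_sin_cos(2)[of "amplitude k" "freq k" "- (freq k * lo)"]
  by (simp add: cosine_def[abs_def] algebra_simps)

lemma cosine_deriv: "deriv (cosine k) = (\<lambda>x. - (amplitude k * freq k) * sin (freq k * (x - lo)))"
proof
  fix x
  have "(cosine k has_real_derivative - (amplitude k * freq k) * sin (freq k * (x - lo))) (at x)"
    unfolding cosine_def[abs_def] by (auto intro!: derivative_eq_intros)
  then show "deriv (cosine k) x = - (amplitude k * freq k) * sin (freq k * (x - lo))"
    by (rule DERIV_imp_deriv)
qed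

lemma cosine_deriv_deriv: "deriv (deriv (cosine k)) = (\<lambda>x. - (freq k)\<^sup>2 * cosine k x)"
proof
  fix x
  have "(deriv (cosine k) has_real_derivative - (freq k)\<^sup>2 * cosine k x) (at x)"
    unfolding cosine_deriv cosine_def
    by (auto intro!: derivative_eq_intros simp: power2_eq_square)
  then show "deriv (deriv (cosine k)) x = - (freq k)\<^sup>2 * cosine k x" by (rule DERIV_imp_deriv)
qed

lemma cosine_deriv_boundary: "deriv (cosine k) lo = 0" "deriv (cosine k) hi = 0"
  using lo_less_hi by (auto simp: cosine_deriv freq_def sin_npi)

lemma cosine_L2: "cosine k \<in> L2 I" "deriv (cosine k) \<in> L2 I"
  by (auto intro: smooth_L2 smooth_deriv smooth_cosine)

lemma cosine_H1: "cosine k \<in> H1 I"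
  by (rule H1_smooth[OF smooth_cosine])

text \<open>
  The derivative of a cosine is a sine and vanishes at both end points, so it may be integrated by
  parts against \<open>v\<close> although \<open>v\<close> itself satisfies no boundary condition. This is where the Neumann
  condition enters.
\<close>

lemma weak_deriv_inner_cosine_deriv:
  assumes "v \<in> H1 I"
  shows "L2_inner I (weak_deriv I v) (deriv (cosine k)) = (freq k)\<^sup>2 * coef v k"
  using weak_deriv_by_parts[OF assms smooth_deriv[OF smooth_cosine] cosine_deriv_boundary, of k]
    L2_inner_scale_left[of I "- (freq k)\<^sup>2" "cosine k" v]
  by (simp add: cosine_deriv_deriv coef_def L2_inner_commute[of I v])

lemma weak_deriv_inner_weak_deriv_cosine:
  assumes "v \<in> H1 I"
  shows "L2_inner I (weak_deriv I v) (weak_deriv I (cosine k)) = (freq k)\<^sup>2 * coef v k"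
  using L2_inner_cong_AE[OF H1_smooth(2)[OF smooth_cosine] weak_deriv(1)[OF cosine_H1] cosine_L2(2)
      weak_deriv(1)[OF assms]] weak_deriv_inner_cosine_deriv[OF assms]
  by (simp add: L2_inner_commute[of _ "weak_deriv I v"])

lemma inner_cosine_deriv:
  "L2_inner I (deriv (cosine j)) (deriv (cosine k)) = (freq k)\<^sup>2 * L2_inner I (cosine j) (cosine k)"
  using L2_inner_cong_AE[OF H1_smooth(2)[OF smooth_cosine] weak_deriv(1)[OF cosine_H1] cosine_L2(2) cosine_L2(2)]
    weak_deriv_inner_cosine_deriv[OF cosine_H1, of j k]
  by (simp add: coef_def)

lemma freq_simps: "freq 0 = 0" "freq k = freq j \<longleftrightarrow> k = j" "freq k \<ge> 0"
  using lo_less_hi by (auto simp: freq_def)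

text \<open>
  The Dirichlet form is symmetric and reproduces eigenvalues in either argument, so eigenfunctions
  with different eigenvalues are orthogonal. For the normalisation, \<open>sin\<^sup>2 + cos\<^sup>2 = 1\<close> and both squares
  have the same integral.
\<close>

lemma cosine_orthonormal: "L2_inner I (cosine j) (cosine k) = (if j = k then 1 else 0)"
proof (cases "j = k")
  case False
  have "(freq k)\<^sup>2 * L2_inner I (cosine j) (cosine k) = (freq j)\<^sup>2 * L2_inner I (cosine j) (cosine k)"
    using inner_cosine_deriv[of j k] inner_cosine_deriv[of k j]
    by (simp add: L2_inner_commute[of _ _ "cosine j"] L2_inner_commute[of _ "deriv (cosine k)"])
  moreover have "(freq k)\<^sup>2 \<noteq> (freq j)\<^sup>2"
    using False freq_simps by (simp add: power2_eq_iff_nonneg)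
  ultimately show ?thesis using False by simp
next
  case True
  have len: "measure (lebesgue_on I) I = hi - lo"
    using lo_less_hi by (simp add: measure_restrict_space)
  show ?thesis
  proof (cases "k = 0")
    case True
    with \<open>j = k\<close> show ?thesis
      using lo_less_hi
      by (simp add: len L2_inner_def cosine_def freq_simps amplitude_def)
  next
    case False
    have f: "(freq k)\<^sup>2 \<noteq> 0" using False freq_simps(1) freq_simps(2)[of k 0] by simp
    have "(freq k)\<^sup>2 * L2_inner I (cosine k) (cosine k) + L2_inner I (deriv (cosine k)) (deriv (cosine k))
        = (LINT x|lebesgue_on I. (freq k)\<^sup>2 * (cosine k x * cosine k x) + deriv (cosine k) x * deriv (cosine k) x)"
      using L2_mult_integrable[OF cosine_L2(1) cosine_L2(1)] L2_mult_integrable[OF cosine_L2(2) cosine_L2(2)]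
      by (simp add: L2_inner_def)
    also have "\<dots> = (LINT x|lebesgue_on I. (freq k)\<^sup>2 * (amplitude k)\<^sup>2)"
    proof (rule Bochner_Integration.integral_cong[OF refl])
      fix x
      have "(freq k)\<^sup>2 * (cosine k x * cosine k x) + deriv (cosine k) x * deriv (cosine k) x =
          (freq k)\<^sup>2 * (amplitude k)\<^sup>2 * ((sin (freq k * (x - lo)))\<^sup>2 + (cos (freq k * (x - lo)))\<^sup>2)"
        unfolding cosine_deriv cosine_def by algebra
      then show "(freq k)\<^sup>2 * (cosine k x * cosine k x) + deriv (cosine k) x * deriv (cosine k) x =
          (freq k)\<^sup>2 * (amplitude k)\<^sup>2"
        by simp
    qed
    also have "\<dots> = (freq k)\<^sup>2 * 2"
      using False lo_less_hi by (simp add: len amplitude_def)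
    finally have "(freq k)\<^sup>2 * (2 * L2_inner I (cosine k) (cosine k)) = (freq k)\<^sup>2 * 2"
      by (simp add: inner_cosine_deriv)
    with f \<open>j = k\<close> show ?thesis by simp
  qed
qed

text \<open>
  Every continuous function on the interval is a continuous function of
  \<open>cos (pi (x - lo) / (hi - lo))\<close>, hence a uniform limit of polynomials in it, and the powers of the
  cosine are linear combinations of the \<open>cosine k\<close>.
\<close>

lemma cosine_total:
  assumes v: "v \<in> L2 I" and zero: "\<And>k. L2_inner I v (cosine k) = 0"
  shows "AE x in lebesgue_on I. v x = 0"
proof (rule fundamental_lemma)
  define \<theta> where "\<theta> x = pi / (hi - lo) * (x - lo)" for x
  have \<theta>c: "continuous_on A \<theta>" for A unfolding \<theta>_def[abs_def] by (intro continuous_intros)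
  have vi: "integrable (lebesgue_on I) v" by (rule L2_imp_integrable[OF I_lmeasurable v])
  then show "integrable (lebesgue_on I) v" .
  have L2c: "(\<lambda>x. cos (\<theta> x) ^ m * cos (real k * \<theta> x)) \<in> L2 I" for m k
    by (intro continuous_L2 continuous_intros \<theta>c)
  \<comment> \<open>\<open>2 cos t cos (k t) = cos ((k + 1) t) + cos ((k - 1) t)\<close> reduces the power by one\<close>
  have powers: "(LINT x|lebesgue_on I. v x * (cos (\<theta> x) ^ m * cos (real k * \<theta> x))) = 0" for m k
  proof (induction m arbitrary: k)
    case 0
    have "amplitude k \<noteq> 0" using lo_less_hi by (simp add: amplitude_def)
    moreover have "amplitude k * (LINT x|lebesgue_on I. v x * cos (real k * \<theta> x)) = L2_inner I v (cosine k)"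
      unfolding L2_inner_def integral_mult_right_zero[symmetric] cosine_def freq_def \<theta>_def
      by (intro Bochner_Integration.integral_cong) (auto simp: mult_ac)
    ultimately show ?case using zero[of k] by simp
  next
    case (Suc m)
    show ?case
    proof (cases k)
      case 0
      then show ?thesis using Suc[of 1] by (simp add: mult.commute[of "cos _"])
    next
      case (Suc j)
      have c: "cos t * cos (real k * t) = (1/2) * cos (real (Suc k) * t) + (1/2) * cos (real j * t)" for t :: real
      proof -
        have "cos (real k * t + t) + cos (real k * t - t) = 2 * (cos t * cos (real k * t))"
          by (simp add: cos_add cos_diff)
        moreover have "real k * t + t = real (Suc k) * t" "real k * t - t = real j * t"
          by (simp_all add: Suc algebra_simps)
        ultimately show ?thesis by simp
      qed
      have "(LINT x|lebesgue_on I. v x * (cos (\<theta> x) ^ Suc m * cos (real k * \<theta> x))) =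
          (LINT x|lebesgue_on I. (1/2) * (v x * (cos (\<theta> x) ^ m * cos (real (Suc k) * \<theta> x))) +
             (1/2) * (v x * (cos (\<theta> x) ^ m * cos (real j * \<theta> x))))"
      proof (rule Bochner_Integration.integral_cong[OF refl])
        fix x
        have "v x * (cos (\<theta> x) ^ Suc m * cos (real k * \<theta> x)) =
            v x * cos (\<theta> x) ^ m * (cos (\<theta> x) * cos (real k * \<theta> x))"
          by simp
        also have "\<dots> = (1/2) * (v x * (cos (\<theta> x) ^ m * cos (real (Suc k) * \<theta> x))) +
             (1/2) * (v x * (cos (\<theta> x) ^ m * cos (real j * \<theta> x)))"
          unfolding c by (simp only: distrib_left mult_ac)
        finally show "v x * (cos (\<theta> x) ^ Suc m * cos (real k * \<theta> x)) =
            (1/2) * (v x * (cos (\<theta> x) ^ m * cos (real (Suc k) * \<theta> x))) +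
             (1/2) * (v x * (cos (\<theta> x) ^ m * cos (real j * \<theta> x)))" .
      qed
      also have "\<dots> = 0"
        using Suc.IH[of "Suc k"] Suc.IH[of j]
        by (subst Bochner_Integration.integral_add)
          (auto simp del: of_nat_Suc intro!: integrable_mult_right L2_mult_integrable[OF v L2c])
      finally show ?thesis .
    qed
  qed
  fix \<phi> assume \<phi>: "test_function I \<phi>"
  define h where "h s = \<phi> (lo + (hi - lo) / pi * arccos s)" for s
  have "continuous_on {-1..1} h"
    unfolding h_def[abs_def]
    by (rule continuous_on_compose2[OF test_functionD(2)[OF \<phi>, of UNIV]])
      (auto intro!: continuous_intros)
  have h\<theta>: "h (cos (\<theta> x)) = \<phi> x" if "x \<in> I" for x
  proof -
    have "0 \<le> \<theta> x" "\<theta> x \<le> pi" using that by (auto simp: \<theta>_def field_simps)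
    then show ?thesis using that by (simp add: h_def arccos_cos \<theta>_def)
  qed
  have "\<bar>L2_inner I v \<phi>\<bar> \<le> \<epsilon> * (LINT x|lebesgue_on I. \<bar>v x\<bar>)" if "\<epsilon> > 0" for \<epsilon>
  proof -
    obtain g where g: "real_polynomial_function g" "\<And>s. s \<in> {-1..1} \<Longrightarrow> \<bar>h s - g s\<bar> < \<epsilon>"
      using Stone_Weierstrass_real_polynomial_function[OF compact_Icc \<open>continuous_on {-1..1} h\<close> \<open>\<epsilon> > 0\<close>] by blast
    then obtain a n where ga: "g = (\<lambda>s. \<Sum>i\<le>n. a i * s ^ i)"
      using real_polynomial_function_iff_sum by auto
    have vg_int: "integrable (lebesgue_on I) (\<lambda>x. v x * g (cos (\<theta> x)))"
      unfolding ga by (intro L2_mult_integrable v continuous_L2 continuous_intros \<theta>c)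
    have "(LINT x|lebesgue_on I. v x * g (cos (\<theta> x))) =
        (\<Sum>i\<le>n. a i * (LINT x|lebesgue_on I. v x * (cos (\<theta> x) ^ i * cos (real 0 * \<theta> x))))"
      unfolding ga sum_distrib_left using L2_mult_integrable[OF v L2c[of _ 0]]
      by (subst Bochner_Integration.integral_sum) (auto simp: mult.left_commute)
    also have "\<dots> = 0" by (simp only: powers mult_zero_right sum.neutral_const)
    finally have "L2_inner I v \<phi> = (LINT x|lebesgue_on I. v x * \<phi> x) - (LINT x|lebesgue_on I. v x * g (cos (\<theta> x)))"
      by (simp add: L2_inner_def)
    also have "\<dots> = (LINT x|lebesgue_on I. v x * \<phi> x - v x * g (cos (\<theta> x)))"
      using L2_mult_integrable[OF v test_functionD(6)[OF \<phi>]] vg_int by simp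
    also have "\<bar>\<dots>\<bar> \<le> (LINT x|lebesgue_on I. \<epsilon> * \<bar>v x\<bar>)"
    proof (rule integral_abs_bound_integral)
      show "integrable (lebesgue_on I) (\<lambda>x. v x * \<phi> x - v x * g (cos (\<theta> x)))"
        using L2_mult_integrable[OF v test_functionD(6)[OF \<phi>]] vg_int by simp
      fix x assume "x \<in> space (lebesgue_on I)"
      then have "\<bar>\<phi> x - g (cos (\<theta> x))\<bar> < \<epsilon>" using g(2)[of "cos (\<theta> x)"] h\<theta>[of x] by simp
      then show "\<bar>v x * \<phi> x - v x * g (cos (\<theta> x))\<bar> \<le> \<epsilon> * \<bar>v x\<bar>"
        unfolding right_diff_distrib[symmetric] abs_mult
        using mult_right_mono[of "\<bar>\<phi> x - g (cos (\<theta> x))\<bar>" \<epsilon> "\<bar>v x\<bar>"] by (simp add: mult.commute)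
    qed (use vi in auto)
    finally show ?thesis by simp
  qed
  note le = this
  have "\<bar>L2_inner I v \<phi>\<bar> \<le> 0"
  proof (rule field_le_epsilon)
    fix \<delta> :: real assume "\<delta> > 0"
    define N where "N = (LINT x|lebesgue_on I. \<bar>v x\<bar>)"
    have N: "N \<ge> 0" unfolding N_def by (rule Bochner_Integration.integral_nonneg) simp
    have "\<bar>L2_inner I v \<phi>\<bar> \<le> \<delta> / (N + 1) * N" unfolding N_def by (rule le) (use N \<open>\<delta> > 0\<close> in \<open>fold N_def, simp\<close>)
    also have "\<dots> \<le> \<delta>" using N \<open>\<delta> > 0\<close> by (simp add: field_simps)
    finally show "\<bar>L2_inner I v \<phi>\<bar> \<le> 0 + \<delta>" by simp
  qed
  then show "L2_inner I v \<phi> = 0" by simp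
qed

lemma cosine_basis: "orthonormal_basis I cosine"
  unfolding orthonormal_basis_def
proof (intro conjI allI ballI impI)
  fix v assume v: "v \<in> L2 I" and "\<forall>k. L2_inner I v (cosine k) = 0"
  then have "AE x in lebesgue_on I. v x = 0" by (intro cosine_total) auto
  then have "L2_norm I v = L2_norm I (\<lambda>_. 0)"
    by (intro L2_norm_cong_AE) (use v in \<open>auto simp: L2_iff\<close>)
  then show "L2_norm I v = 0" by (simp add: Lp_norm_def)
qed (auto simp: cosine_L2 cosine_orthonormal)

lemmas coef_Parseval_norm = Parseval_norm[OF I_lmeasurable cosine_basis, folded coef_def]
lemmas coef_Parseval = Parseval[OF I_lmeasurable cosine_basis, folded coef_def]

lemma coef_eq_imp_AE_eq:
  assumes "v \<in> L2 I" "w \<in> L2 I" "\<And>k. coef v k = coef w k"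
  shows "AE x in lebesgue_on I. v x = w x"
proof -
  have "AE x in lebesgue_on I. v x - w x = 0"
    using assms by (intro cosine_total L2_diff) (auto simp: L2_inner_diff_left cosine_L2 coef_def)
  then show ?thesis by simp
qed

lemma L2_norm_eq_0: "v \<in> L2 I \<Longrightarrow> L2_norm I v = 0 \<Longrightarrow> AE x in lebesgue_on I. v x = 0"
  using integral_nonneg_eq_0_iff_AE[of "lebesgue_on I" "\<lambda>x. (v x)\<^sup>2"] L2_norm_square_integral[of I v]
  by (simp add: L2_iff)

lemma coef_diff: "v \<in> L2 I \<Longrightarrow> w \<in> L2 I \<Longrightarrow> coef (\<lambda>x. v x - w x) k = coef v k - coef w k"
  by (simp add: coef_def L2_inner_diff_left cosine_L2)

lemma coef_add: "v \<in> L2 I \<Longrightarrow> w \<in> L2 I \<Longrightarrow> coef (\<lambda>x. v x + w x) k = coef v k + coef w k"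
  by (simp add: coef_def L2_inner_add_left cosine_L2)

lemma coef_scale: "coef (\<lambda>x. a * v x) k = a * coef v k"
  by (simp add: coef_def L2_inner_scale_left)

lemma cosine_norm: "L2_norm I (cosine k) = 1"
  using L2_norm_square[of I "cosine k"] L2_norm_nonneg[of I "cosine k"]
  by (simp add: cosine_orthonormal power2_eq_1_iff)

lemma coef_le_norm: "v \<in> L2 I \<Longrightarrow> \<bar>coef v k\<bar> \<le> L2_norm I v"
  using L2_Cauchy_Schwarz[OF _ cosine_L2(1), of v k] by (simp add: coef_def cosine_norm)

text \<open>
  The maximum of \<open>\<bar>cosine k\<bar>\<close> for \<open>k > 0\<close>.
\<close>

definition sup_const :: real where
  "sup_const = sqrt (2 / (hi - lo))"

lemma abs_cosine_le: "\<bar>cosine k x\<bar> \<le> sup_const"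
proof -
  have "0 \<le> amplitude k" "amplitude k \<le> sup_const"
    using lo_less_hi by (auto simp: amplitude_def sup_const_def intro!: divide_right_mono)
  then have "amplitude k * \<bar>cos (freq k * (x - lo))\<bar> \<le> sup_const * 1"
    by (intro mult_mono) auto
  with \<open>0 \<le> amplitude k\<close> show ?thesis by (simp add: cosine_def abs_mult)
qed

lemma sup_const_nonneg: "0 \<le> sup_const"
  using lo_less_hi by (simp add: sup_const_def)

text \<open>
  The Sobolev embedding in dimension one, read off the coefficients: by Cauchy--Schwarz against the
  summable weights \<open>1 / (1 + (freq k)\<^sup>2)\<close>.
\<close>

lemma sobolev_weights: "summable (\<lambda>k. 1 / (1 + (freq k)\<^sup>2))"
proof (rule summable_comparison_test_ev)
  define a where "a = (pi / (hi - lo))\<^sup>2"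
  have a: "a > 0" using lo_less_hi by (simp add: a_def)
  show "summable (\<lambda>k. (1 / a) * (1 / real k ^ 2))"
    by (intro summable_mult) (use inverse_power_summable[of 2, where ?'a = real] in \<open>simp add: divide_inverse\<close>)
  show "\<forall>\<^sub>F k in sequentially. norm (1 / (1 + (freq k)\<^sup>2)) \<le> (1 / a) * (1 / real k ^ 2)"
  proof (rule eventually_sequentiallyI[of 1])
    fix k :: nat assume "1 \<le> k"
    have f: "(freq k)\<^sup>2 = a * (real k)\<^sup>2" by (simp add: freq_def a_def power_mult_distrib power_divide)
    have "0 < a * (real k)\<^sup>2" using a \<open>1 \<le> k\<close> by simp
    then have "1 / (1 + a * (real k)\<^sup>2) \<le> 1 / (a * (real k)\<^sup>2)"
      by (intro divide_left_mono) auto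
    then show "norm (1 / (1 + (freq k)\<^sup>2)) \<le> (1 / a) * (1 / real k ^ 2)"
      using \<open>0 < a * (real k)\<^sup>2\<close> by (simp add: f)
  qed
qed

definition sobolev_const :: real where
  "sobolev_const = (\<Sum>k. 1 / (1 + (freq k)\<^sup>2))"

lemma sobolev_const_nonneg: "0 \<le> sobolev_const"
  unfolding sobolev_const_def by (intro suminf_nonneg sobolev_weights) simp

lemma sum_abs_le_energy:
  "(\<Sum>k<n. \<bar>a k\<bar>)\<^sup>2 \<le> sobolev_const * (\<Sum>k<n. (1 + (freq k)\<^sup>2) * (a k)\<^sup>2)"
proof -
  let ?q = "\<lambda>k. sqrt (1 + (freq k)\<^sup>2)"
  have q: "?q k > 0" "(?q k)\<^sup>2 = 1 + (freq k)\<^sup>2" for k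
    by (auto simp: add_pos_nonneg)
  have "(\<Sum>k<n. \<bar>a k\<bar>) = (\<Sum>k<n. (1 / ?q k) * (?q k * \<bar>a k\<bar>))"
    using q(1) by (intro sum.cong) (auto simp: less_imp_neq[symmetric])
  then have "(\<Sum>k<n. \<bar>a k\<bar>)\<^sup>2 \<le> (\<Sum>k<n. (1 / ?q k)\<^sup>2) * (\<Sum>k<n. (?q k * \<bar>a k\<bar>)\<^sup>2)"
    using Cauchy_Schwarz_ineq_sum[of "\<lambda>k. 1 / ?q k" "\<lambda>k. ?q k * \<bar>a k\<bar>" "{..<n}"] by simp
  also have "\<dots> = (\<Sum>k<n. 1 / (1 + (freq k)\<^sup>2)) * (\<Sum>k<n. (1 + (freq k)\<^sup>2) * (a k)\<^sup>2)"
    by (simp only: power_mult_distrib power_divide q(2) power2_abs power_one)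
  also have "\<dots> \<le> sobolev_const * (\<Sum>k<n. (1 + (freq k)\<^sup>2) * (a k)\<^sup>2)"
    unfolding sobolev_const_def
    by (intro mult_right_mono sum_le_suminf sobolev_weights sum_nonneg) auto
  finally show ?thesis .
qed

text \<open>
  Bessel's inequality for the weak derivative and the orthogonal system of the derivatives of the
  cosines, whose squared norms are the eigenvalues.
\<close>

lemma H1_energy_le:
  assumes v: "v \<in> H1 I"
  shows "(\<Sum>k<n. (1 + (freq k)\<^sup>2) * (coef v k)\<^sup>2) \<le> (H1_norm I v)\<^sup>2"
proof -
  let ?w = "weak_deriv I v"
  let ?s = "\<lambda>x. \<Sum>k<n. coef v k * deriv (cosine k) x"
  have vL: "v \<in> L2 I" using v by (simp add: H1_def)
  note w = weak_deriv(1)[OF v]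
  have sL: "?s \<in> L2 I" by (intro L2_sum L2_scale cosine_L2)
  have ws: "L2_inner I ?w ?s = (\<Sum>k<n. (freq k)\<^sup>2 * (coef v k)\<^sup>2)"
    unfolding L2_inner_commute[of I ?w] using w
    by (subst L2_inner_sum_left) (auto intro!: L2_scale cosine_L2 sum.cong
        simp: L2_inner_scale_left L2_inner_commute[of _ _ ?w] weak_deriv_inner_cosine_deriv[OF v] power2_eq_square)
  have "L2_inner I ?s (deriv (cosine j)) = (if j < n then (freq j)\<^sup>2 * coef v j else 0)" for j
    by (subst L2_inner_sum_left) (auto intro!: L2_scale cosine_L2
        simp: L2_inner_scale_left inner_cosine_deriv cosine_orthonormal if_distrib[of "(*) _"] sum.delta cong: if_cong)
  then have ss: "L2_inner I ?s ?s = (\<Sum>k<n. (freq k)\<^sup>2 * (coef v k)\<^sup>2)"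
    using sL by (subst L2_inner_sum_left) (auto intro!: L2_scale cosine_L2 sum.cong
        simp: L2_inner_scale_left L2_inner_commute[of _ _ ?s] power2_eq_square)
  have "0 \<le> (L2_norm I (\<lambda>x. ?w x - ?s x))\<^sup>2" by simp
  also have "\<dots> = (L2_norm I ?w)\<^sup>2 - (\<Sum>k<n. (freq k)\<^sup>2 * (coef v k)\<^sup>2)"
    using ss by (simp add: L2_norm_square_diff w sL ws L2_norm_square[of I ?s])
  finally have "(\<Sum>k<n. (freq k)\<^sup>2 * (coef v k)\<^sup>2) \<le> (L2_norm I ?w)\<^sup>2" by simp
  moreover have "(\<Sum>k<n. (coef v k)\<^sup>2) \<le> (L2_norm I v)\<^sup>2"
    using coef_Parseval_norm(1)[OF vL] sum_le_suminf[of "\<lambda>k. (coef v k)\<^sup>2" "{..<n}"]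
    by (auto simp: sums_iff)
  ultimately show ?thesis
    by (simp add: H1_norm_def distrib_right sum.distrib)
qed

lemma summable_coef_bound:
  assumes "\<And>n. (\<Sum>k<n. (1 + (freq k)\<^sup>2) * (a k)\<^sup>2) \<le> E"
  shows "summable (\<lambda>k. \<bar>a k\<bar>)" "(\<Sum>k. \<bar>a k\<bar>)\<^sup>2 \<le> sobolev_const * E"
proof -
  have E: "(\<Sum>k<n. \<bar>a k\<bar>)\<^sup>2 \<le> sobolev_const * E" for n
    using sum_abs_le_energy[of a n] mult_left_mono[OF assms sobolev_const_nonneg, of n] by linarith
  then have le: "(\<Sum>k<n. \<bar>a k\<bar>) \<le> sqrt (sobolev_const * E)" for n by (rule real_le_rsqrt)
  show s: "summable (\<lambda>k. \<bar>a k\<bar>)" by (rule summableI_nonneg_bounded[OF _ le]) simp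
  have "(\<lambda>n. (\<Sum>k<n. \<bar>a k\<bar>)\<^sup>2) \<longlonglongrightarrow> (\<Sum>k. \<bar>a k\<bar>)\<^sup>2"
    by (intro tendsto_power summable_LIMSEQ s)
  then show "(\<Sum>k. \<bar>a k\<bar>)\<^sup>2 \<le> sobolev_const * E" by (rule LIMSEQ_le_const2) (use E in blast)
qed

lemma H1_summable_coef:
  assumes "v \<in> H1 I"
  shows "summable (\<lambda>k. \<bar>coef v k\<bar>)" "(\<Sum>k. \<bar>coef v k\<bar>)\<^sup>2 \<le> sobolev_const * (H1_norm I v)\<^sup>2"
  using summable_coef_bound[OF H1_energy_le[OF assms]] by blast+

text \<open>
  The series converges uniformly, so its sum is also the \<open>L\<^sup>2\<close>-limit of the partial sums, which is \<open>v\<close>.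
\<close>

lemma cosine_series:
  assumes v: "v \<in> L2 I" and s: "summable (\<lambda>k. \<bar>coef v k\<bar>)"
  shows "AE x in lebesgue_on I. v x = (\<Sum>k. coef v k * cosine k x)"
    and "\<bar>\<Sum>k. coef v k * cosine k x\<bar> \<le> sup_const * (\<Sum>k. \<bar>coef v k\<bar>)"
proof -
  define S where "S x = (\<Sum>k. coef v k * cosine k x)" for x
  define T where "T n x = (\<Sum>k<n. coef v k * cosine k x)" for n x
  have le: "\<bar>coef v k * cosine k x\<bar> \<le> sup_const * \<bar>coef v k\<bar>" for k x
    using mult_right_mono[OF abs_cosine_le, of "\<bar>coef v k\<bar>" k x] by (simp add: abs_mult mult.commute)
  have sm: "summable (\<lambda>k. \<bar>coef v k * cosine k x\<bar>)" for x
    by (rule summable_comparison_test'[OF summable_mult[OF s, of sup_const]]) (use le in simp)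
  show "\<bar>\<Sum>k. coef v k * cosine k x\<bar> \<le> sup_const * (\<Sum>k. \<bar>coef v k\<bar>)"
    using order_trans[OF summable_rabs[OF sm] suminf_le[OF le sm summable_mult[OF s]]]
    by (simp add: suminf_mult[OF s])
  define r where "r n = (\<Sum>k. \<bar>coef v (k + n)\<bar>)" for n
  have ST: "\<bar>S x - T n x\<bar> \<le> sup_const * r n" for x n
  proof -
    have "S x - T n x = (\<Sum>k. coef v (k + n) * cosine (k + n) x)"
      unfolding S_def T_def using suminf_split_initial_segment[OF summable_rabs_cancel[OF sm], of x n] by simp
    also have "\<bar>\<dots>\<bar> \<le> (\<Sum>k. \<bar>coef v (k + n) * cosine (k + n) x\<bar>)"
      by (intro summable_rabs summable_ignore_initial_segment[OF sm])
    also have "\<dots> \<le> (\<Sum>k. sup_const * \<bar>coef v (k + n)\<bar>)"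
      by (intro suminf_le le summable_mult summable_ignore_initial_segment[OF sm] summable_ignore_initial_segment[OF s])
    also have "\<dots> = sup_const * r n"
      unfolding r_def by (rule suminf_mult) (rule summable_ignore_initial_segment[OF s])
    finally show ?thesis .
  qed
  have r0: "r \<longlonglongrightarrow> 0" unfolding r_def by (rule suminf_exist_split2[OF s])
  have TL: "T n \<in> L2 I" for n unfolding T_def[abs_def] by (intro L2_sum L2_scale cosine_L2)
  have Sm: "S \<in> borel_measurable (lebesgue_on I)"
  proof (rule borel_measurable_LIMSEQ_real)
    show "T n \<in> borel_measurable (lebesgue_on I)" for n using TL by (simp add: L2_iff)
    show "(\<lambda>n. T n x) \<longlonglongrightarrow> S x" for x
      unfolding T_def S_def by (rule summable_LIMSEQ[OF summable_rabs_cancel[OF sm]])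
  qed
  have STL: "(\<lambda>x. S x - T n x) \<in> L2 I" for n
  proof (rule L2_bounded[OF I_lmeasurable])
    show "(\<lambda>x. S x - T n x) \<in> borel_measurable (lebesgue_on I)"
      using TL[of n] by (intro borel_measurable_diff Sm) (simp add: L2_iff)
  qed (use ST in blast)
  from this[of 0] have SL: "S \<in> L2 I" by (simp add: T_def)
  have ST_norm: "L2_norm I (\<lambda>x. S x - T n x) \<le> sup_const * r n * sqrt (hi - lo)" for n
  proof (rule power2_le_imp_le)
    have rn: "r n \<ge> 0" unfolding r_def by (intro suminf_nonneg summable_ignore_initial_segment[OF s]) simp
    have "(S x - T n x)\<^sup>2 \<le> (sup_const * r n)\<^sup>2" for x
      using ST[of x n] by (simp add: abs_le_square_iff[symmetric])
    then have "(L2_norm I (\<lambda>x. S x - T n x))\<^sup>2 \<le> (LINT x|lebesgue_on I. (sup_const * r n)\<^sup>2)"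
      unfolding L2_norm_square_integral using STL[of n]
      by (intro integral_mono) (auto simp: L2_iff intro: finite_measure.integrable_const[OF finite_measure_lebesgue_on])
    also have "\<dots> = (sup_const * r n * sqrt (hi - lo))\<^sup>2"
      using lo_less_hi by (simp add: measure_restrict_space power_mult_distrib)
    finally show "(L2_norm I (\<lambda>x. S x - T n x))\<^sup>2 \<le> (sup_const * r n * sqrt (hi - lo))\<^sup>2" .
    show "0 \<le> sup_const * r n * sqrt (hi - lo)" using rn sup_const_nonneg lo_less_hi by simp
  qed
  have "L2_norm I (\<lambda>x. v x - S x) \<le> 0"
  proof (rule LIMSEQ_le_const)
    have "(\<lambda>n. sup_const * r n * sqrt (hi - lo) + L2_norm I (\<lambda>x. v x - T n x)) \<longlonglongrightarrow>
        sup_const * 0 * sqrt (hi - lo) + 0"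
      unfolding T_def by (intro tendsto_add tendsto_mult tendsto_const r0 coef_Parseval_norm(2)[OF v])
    then show "(\<lambda>n. sup_const * r n * sqrt (hi - lo) + L2_norm I (\<lambda>x. v x - T n x)) \<longlonglongrightarrow> 0" by simp
    have "L2_norm I (\<lambda>x. v x - S x) \<le> L2_norm I (\<lambda>x. v x - T n x) + L2_norm I (\<lambda>x. S x - T n x)" for n
      using L2_triangle[OF L2_diff[OF v TL] L2_diff[OF TL SL], of n n] L2_norm_minus_commute[of I S "T n"]
      by simp
    then show "\<exists>N. \<forall>n\<ge>N. L2_norm I (\<lambda>x. v x - S x) \<le>
        sup_const * r n * sqrt (hi - lo) + L2_norm I (\<lambda>x. v x - T n x)"
      using ST_norm by (intro exI[of _ 0] allI impI) (smt (verit, best))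
  qed
  with L2_norm_nonneg[of I "\<lambda>x. v x - S x"] have "L2_norm I (\<lambda>x. v x - S x) = 0" by linarith
  from L2_norm_eq_0[OF L2_diff[OF v SL] this]
  show "AE x in lebesgue_on I. v x = (\<Sum>k. coef v k * cosine k x)" by (simp add: S_def)
qed

end

section \<open>Measurability up to null sets\<close>

lemma (in complete_measure) borel_measurable_AE_cong:
  fixes f g :: "'a \<Rightarrow> real"
  assumes f: "f \<in> borel_measurable M" and eq: "AE x in M. f x = g x"
  shows "g \<in> borel_measurable M"
proof (rule measurableI)
  fix A :: "real set" assume "A \<in> sets borel"
  then have m: "f -` A \<inter> space M \<in> sets M" using f by (rule measurable_sets[rotated])
  have "AE x in M. x \<in> f -` A \<inter> space M \<longleftrightarrow> x \<in> g -` A \<inter> space M"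
    using eq by eventually_elim simp
  from in_sets_AE[OF this m] show "g -` A \<inter> space M \<in> sets M" by auto
qed simp

lemma (in complete_measure) borel_measurable_AE_LIMSEQ:
  fixes f :: "nat \<Rightarrow> 'a \<Rightarrow> real"
  assumes f: "\<And>n. f n \<in> borel_measurable M" and lim: "AE x in M. (\<lambda>n. f n x) \<longlonglongrightarrow> g x"
  shows "g \<in> borel_measurable M"
proof (rule borel_measurable_AE_cong)
  show "(\<lambda>x. lim (\<lambda>n. f n x)) \<in> borel_measurable M" by (rule borel_measurable_lim_metric[OF f])
  show "AE x in M. lim (\<lambda>n. f n x) = g x" using lim by eventually_elim (rule limI)
qed

lemma complete_measure_lebesgue_on:
  assumes "S \<in> sets lebesgue" shows "complete_measure (lebesgue_on S)"
proof
  fix A B assume AB: "B \<subseteq> A" "A \<in> null_sets (lebesgue_on S)"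
  then have "A \<in> null_sets lebesgue" "A \<subseteq> S" using assms by (auto simp: null_sets_restrict_space)
  then have "B \<in> null_sets lebesgue" using AB(1) by (metis completion.complete2)
  with \<open>A \<subseteq> S\<close> AB(1) assms show "B \<in> sets (lebesgue_on S)"
    by (auto simp: sets_restrict_space_iff)
qed

text \<open>
  Monotone convergence: the sum has a finite integral, hence is finite almost everywhere.
\<close>

lemma AE_summable_of_integrals:
  fixes D :: "nat \<Rightarrow> 'a \<Rightarrow> real"
  assumes D: "\<And>n. integrable M (D n)" "\<And>n x. 0 \<le> D n x"
    and le: "\<And>n. (LINT x|M. D n x) \<le> b n" and b: "summable b"
  shows "AE x in M. summable (\<lambda>n. D n x)" "integrable M (\<lambda>x. \<Sum>n. D n x)"
proof -
  have m: "D n \<in> borel_measurable M" for n using D(1) by auto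
  have b0: "0 \<le> b n" for n
    using le[of n] Bochner_Integration.integral_nonneg[of M "D n"] D(2) by (meson order_trans)
  have "(\<integral>\<^sup>+x. (\<Sum>n. ennreal (D n x)) \<partial>M) = (\<Sum>n. \<integral>\<^sup>+x. ennreal (D n x) \<partial>M)"
    by (rule nn_integral_suminf) (use m in auto)
  also have "\<dots> \<le> (\<Sum>n. ennreal (b n))"
    using le D by (intro suminf_le) (auto simp: nn_integral_eq_integral intro: ennreal_leI)
  also have "\<dots> = ennreal (\<Sum>n. b n)" by (rule suminf_ennreal2[OF b0 b])
  finally have fin: "(\<integral>\<^sup>+x. (\<Sum>n. ennreal (D n x)) \<partial>M) < \<infinity>"
    by (rule le_less_trans) simp
  have "AE x in M. (\<Sum>n. ennreal (D n x)) \<noteq> \<infinity>"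
    by (rule nn_integral_PInf_AE) (use m fin in auto)
  then show s: "AE x in M. summable (\<lambda>n. D n x)"
    by eventually_elim (use D(2) in \<open>auto intro: summable_suminf_not_top\<close>)
  show "integrable M (\<lambda>x. \<Sum>n. D n x)"
  proof (rule integrableI_bounded)
    show "(\<lambda>x. \<Sum>n. D n x) \<in> borel_measurable M" using m by (intro borel_measurable_suminf)
    have "(\<integral>\<^sup>+x. ennreal (norm (\<Sum>n. D n x)) \<partial>M) = (\<integral>\<^sup>+x. (\<Sum>n. ennreal (D n x)) \<partial>M)"
    proof (rule nn_integral_cong_AE)
      show "AE x in M. ennreal (norm (\<Sum>n. D n x)) = (\<Sum>n. ennreal (D n x))"
        using s by eventually_elim (use D(2) in \<open>simp add: suminf_ennreal2 suminf_nonneg\<close>)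
    qed
    with fin show "(\<integral>\<^sup>+x. ennreal (norm (\<Sum>n. D n x)) \<partial>M) < \<infinity>" by simp
  qed
qed

lemma integrable_lebesgue_on:
  fixes g :: "real \<Rightarrow> real"
  assumes "integrable lebesgue g" "S \<in> sets lebesgue" shows "integrable (lebesgue_on S) g"
  using integrable_mult_indicator[OF assms(2,1)] assms(2) by (simp add: integrable_restrict_space)

lemma (in pair_sigma_finite) AE_pair_swapped:
  assumes "AE p in M1 \<Otimes>\<^sub>M M2. P p" shows "AE y in M2. AE x in M1. P (x, y)"
proof -
  interpret Q: pair_sigma_finite M2 M1 ..
  have "AE p in distr (M2 \<Otimes>\<^sub>M M1) (M1 \<Otimes>\<^sub>M M2) (\<lambda>(x, y). (y, x)). P p"
    using assms by (subst (asm) distr_pair_swap)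
  then have "AE p in M2 \<Otimes>\<^sub>M M1. P ((\<lambda>(x, y). (y, x)) p)"
    by (rule AE_distrD[rotated]) simp
  then show ?thesis using Q.AE_pair[of "\<lambda>p. P (snd p, fst p)"] by (simp add: split_def)
qed

text \<open>
  Fubini for a function that is measurable only for the completed product: it has a version for the
  product itself, and almost all sections of the two agree almost everywhere.
\<close>

lemma (in pair_sigma_finite) AE_integrable_completion:
  fixes h :: "'a \<times> 'b \<Rightarrow> real"
  assumes h: "integrable (completion (M1 \<Otimes>\<^sub>M M2)) h" and M1: "complete_measure M1"
  shows "AE y in M2. integrable M1 (\<lambda>x. h (x, y))"
proof -
  obtain k where k: "k \<in> borel_measurable (M1 \<Otimes>\<^sub>M M2)" and eq: "AE p in M1 \<Otimes>\<^sub>M M2. h p = k p"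
    using completion_ex_borel_measurable_real[OF borel_measurable_integrable[OF h]] by blast
  have "integrable (completion (M1 \<Otimes>\<^sub>M M2)) k"
    by (rule integrable_cong_AE_imp[OF h])
      (use k AE_completion[OF eq] in \<open>auto intro: measurable_completion elim: eventually_mono\<close>)
  then have "integrable (M1 \<Otimes>\<^sub>M M2) k" using k by (simp add: integrable_completion)
  interpret Q: pair_sigma_finite M2 M1 ..
  have "AE y in M2. integrable M1 (\<lambda>x. k (x, y))"
    using Q.AE_integrable_fst'[OF integrable_product_swap[OF \<open>integrable (M1 \<Otimes>\<^sub>M M2) k\<close>]] by (simp add: split_def)
  with AE_pair_swapped[OF eq] show ?thesis
  proof eventually_elim
    case (elim y)
    have eq': "AE x in M1. k (x, y) = h (x, y)" using elim(1) by eventually_elim simp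
    have "(\<lambda>x. h (x, y)) \<in> borel_measurable M1"
      by (rule complete_measure.borel_measurable_AE_cong[OF M1 borel_measurable_integrable[OF elim(2)] eq'])
    from integrable_cong_AE_imp[OF elim(2) this eq'] show ?case .
  qed
qed

section \<open>Functions of time\<close>

abbreviation time :: "real \<Rightarrow> real measure" where "time T \<equiv> lebesgue_on {0..T}"

lemma complete_time: "complete_measure (time T)"
  by (rule complete_measure_lebesgue_on) simp

lemmas time_measurable_AE_cong = complete_measure.borel_measurable_AE_cong[OF complete_time]
lemmas time_measurable_AE_LIMSEQ = complete_measure.borel_measurable_AE_LIMSEQ[OF complete_time]

lemma finite_measure_time: "finite_measure (time T)"
  by (rule finite_measure_lebesgue_on) simp

lemma integrable_time_mono:
  fixes f :: "real \<Rightarrow> real"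
  shows "integrable (time T) f \<Longrightarrow> t \<le> T \<Longrightarrow> integrable (time t) f"
  by (rule Equivalence_Lebesgue_Henstock_Integration.integrable_subinterval) auto

lemma AE_time_mono: "AE s in time T. P s \<Longrightarrow> t \<le> T \<Longrightarrow> AE s in time t. P s"
  by (auto simp: AE_restrict_space_iff elim: eventually_mono)

lemma measurable_time_mono:
  "f \<in> borel_measurable (time T) \<Longrightarrow> t \<le> T \<Longrightarrow> f \<in> borel_measurable (time t)"
  by (rule measurable_restrict_mono) auto

lemma integral_time_eq:
  fixes f :: "real \<Rightarrow> real"
  assumes "t \<le> T" shows "(LINT s|time t. f s) = (LINT s|time T. indicator {..t} s * f s)"
proof -
  have "(LINT s|time t. f s) = (LINT s|lebesgue. indicator {0..t} s *\<^sub>R f s)"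
    by (rule integral_restrict_space) simp
  also have "\<dots> = (LINT s|lebesgue. indicator {0..T} s *\<^sub>R (indicator {..t} s * f s))"
    using assms by (intro Bochner_Integration.integral_cong) (auto simp: indicator_def)
  also have "\<dots> = (LINT s|time T. indicator {..t} s * f s)"
    by (rule integral_restrict_space[symmetric]) simp
  finally show ?thesis .
qed

lemma integral_time_split:
  fixes f :: "real \<Rightarrow> real"
  assumes f: "integrable (time T) f" and t: "0 \<le> t" "t \<le> T"
  shows "(LINT s|lebesgue_on {t..T}. f s) = (LINT s|time T. f s) - (LINT s|time t. f s)"
proof -
  have i: "integrable (lebesgue_on {a..b}) f" if "{a..b} \<subseteq> {0..T}" for a b
    using f that by (rule Equivalence_Lebesgue_Henstock_Integration.integrable_subinterval)
  have "integral {0..t} f + integral {t..T} f = integral {0..T} f"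
    using t f by (intro Henstock_Kurzweil_Integration.integral_combine integrable_on_lebesgue_on) auto
  then show ?thesis
    using t by (simp add: lebesgue_integral_eq_integral i f)
qed

lemma integral_time_mono:
  fixes f :: "real \<Rightarrow> real"
  assumes f: "integrable (time T) f" and t: "0 \<le> t" "t \<le> T" and nn: "\<And>s. 0 \<le> f s"
  shows "(LINT s|time t. f s) \<le> (LINT s|time T. f s)"
  using integral_time_split[OF f t] Bochner_Integration.integral_nonneg[of "lebesgue_on {t..T}" f] nn by simp

lemma integral_cong_AE_time:
  fixes F G :: "real \<Rightarrow> real"
  assumes G: "G \<in> borel_measurable (time T)" and eq: "AE s in time T. F s = G s" and ab: "{a..b} \<subseteq> {0..T}"
  shows "(LINT s|lebesgue_on {a..b}. F s) = (LINT s|lebesgue_on {a..b}. G s)"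
proof (rule integral_cong_AE)
  have "AE s in time T. G s = F s" using eq by eventually_elim simp
  then have F: "F \<in> borel_measurable (time T)" by (rule time_measurable_AE_cong[OF G])
  show "F \<in> borel_measurable (lebesgue_on {a..b})" "G \<in> borel_measurable (lebesgue_on {a..b})"
    by (rule measurable_restrict_mono[OF F ab], rule measurable_restrict_mono[OF G ab])
  show "AE s in lebesgue_on {a..b}. F s = G s"
    using eq ab by (auto simp: AE_restrict_space_iff elim!: eventually_mono)
qed

lemma integrable_time_continuous:
  "continuous_on {0..T} f \<Longrightarrow> integrable (time T) (f :: real \<Rightarrow> real)"
  by (rule continuous_imp_integrable_real)

text \<open>
  Split the square \<open>[0,T]\<^sup>2\<close> along the diagonal and apply Fubini to \<open>\<alpha>(s) \<gamma>(r)\<close>. With merely integrable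
  \<open>\<alpha>\<close> and \<open>\<gamma>\<close> the functions \<open>w\<close> and \<open>q\<close> need not be differentiable at every point.
\<close>

lemma product_rule_integrals:
  fixes \<alpha> \<gamma> w q :: "real \<Rightarrow> real"
  assumes T: "0 \<le> T" and \<alpha>: "integrable (time T) \<alpha>" and \<gamma>: "integrable (time T) \<gamma>"
    and w: "\<And>t. t \<in> {0..T} \<Longrightarrow> w t = (LINT s|time t. \<alpha> s)"
    and q: "\<And>t. t \<in> {0..T} \<Longrightarrow> q t = q0 + (LINT s|time t. \<gamma> s)"
  shows "integrable (time T) (\<lambda>t. \<alpha> t * q t)" "integrable (time T) (\<lambda>t. w t * \<gamma> t)"
    "w T * q T = (LINT t|time T. \<alpha> t * q t + w t * \<gamma> t)"
proof -
  interpret finite_measure "time T" by (rule finite_measure_time)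
  interpret pair_sigma_finite "time T" "time T" ..
  let ?C = "\<lambda>t. LINT s|time t. \<gamma> s"
  have m[measurable]: "\<alpha> \<in> borel_measurable (time T)" "\<gamma> \<in> borel_measurable (time T)"
    using \<alpha> \<gamma> by auto
  have idm: "(\<lambda>x. x) \<in> borel_measurable (time T)"
    using id_borel_measurable_lebesgue_on[of "{0..T}"] by (simp add: id_def)
  have le[measurable]: "{p \<in> space (time T \<Otimes>\<^sub>M time T). snd p \<le> fst p} \<in> sets (time T \<Otimes>\<^sub>M time T)"
    using measurable_compose[OF measurable_fst idm] measurable_compose[OF measurable_snd idm]
    by (rule borel_measurable_le[rotated])
  have prod: "integrable (time T \<Otimes>\<^sub>M time T) (\<lambda>(s, r). \<alpha> s * \<gamma> r)"
  proof (rule Fubini_integrable)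
    show "(\<lambda>(s, r). \<alpha> s * \<gamma> r) \<in> borel_measurable (time T \<Otimes>\<^sub>M time T)" by measurable
    show "integrable (time T) (\<lambda>s. LINT r|time T. norm (case (s, r) of (s, r) \<Rightarrow> \<alpha> s * \<gamma> r))"
      using \<alpha> by (simp add: abs_mult)
  qed (use \<gamma> in simp)
  \<comment> \<open>the parts of the integrand below and above the diagonal\<close>
  define L where "L = (\<lambda>(s, r). indicator {p. snd p \<le> fst p} (s, r) * (\<alpha> s * \<gamma> r) :: real)"
  define U where "U = (\<lambda>(s, r). \<alpha> s * \<gamma> r - L (s, r))"
  have L: "integrable (time T \<Otimes>\<^sub>M time T) L"
  proof (rule Bochner_Integration.integrable_bound[OF prod])
    have "L = (\<lambda>p. if snd p \<le> fst p then (case p of (s, r) \<Rightarrow> \<alpha> s * \<gamma> r) else 0)"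
      by (auto simp: L_def indicator_def)
    also have "\<dots> \<in> borel_measurable (time T \<Otimes>\<^sub>M time T)"
      using prod le by (intro measurable_If) auto
    finally show "L \<in> borel_measurable (time T \<Otimes>\<^sub>M time T)" .
  qed (auto simp: L_def indicator_def)
  then have U: "integrable (time T \<Otimes>\<^sub>M time T) U"
    unfolding U_def using Bochner_Integration.integrable_diff[OF prod L] by (simp add: split_def)
  have Lin: "(LINT r|time T. L (s, r)) = \<alpha> s * ?C s" if "s \<in> {0..T}" for s
  proof -
    have "(LINT r|time T. L (s, r)) = (LINT r|time T. \<alpha> s * (indicator {..s} r * \<gamma> r))"
      by (intro Bochner_Integration.integral_cong) (auto simp: L_def indicator_def)
    also have "\<dots> = \<alpha> s * ?C s" using that by (simp add: integral_time_eq[of s T])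
    finally show ?thesis .
  qed
  have Uin: "(LINT s|time T. U (s, r)) = w r * \<gamma> r" if "r \<in> {0..T}" for r
  proof -
    have "(LINT s|time T. U (s, r)) = (LINT s|time T. (indicator {..r} s * \<alpha> s) * \<gamma> r)"
    proof (rule integral_cong_AE)
      show "(\<lambda>s. U (s, r)) \<in> borel_measurable (time T)"
        using measurable_compose[OF measurable_Pair2'[of r "time T" "time T"] borel_measurable_integrable[OF U]] that
        by simp
      show "(\<lambda>s. indicator {..r} s * \<alpha> s * \<gamma> r) \<in> borel_measurable (time T)"
        by (intro borel_measurable_times m borel_measurable_const measurable_restrict_space1
            borel_measurable_indicator) simp
      have "AE s in lebesgue. s \<noteq> r"
        by (rule AE_completion) (rule AE_lborel_singleton)
      then have "AE s in time T. s \<noteq> r" by (auto simp: AE_restrict_space_iff elim: eventually_mono)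
      then show "AE s in time T. U (s, r) = indicator {..r} s * \<alpha> s * \<gamma> r"
        by eventually_elim (auto simp: U_def L_def indicator_def)
    qed
    also have "\<dots> = w r * \<gamma> r"
      using that w[OF that] by (simp add: integral_time_eq[of r T])
    finally show ?thesis .
  qed
  have i1: "integrable (time T) (\<lambda>s. \<alpha> s * ?C s)"
    using integrable_fst'[OF L] by (rule Bochner_Integration.integrable_cong[THEN iffD1, rotated 2]) (simp_all add: Lin)
  have "integrable (time T) (\<lambda>s. \<alpha> s * q0 + \<alpha> s * ?C s)" using i1 \<alpha> by simp
  then show aq: "integrable (time T) (\<lambda>t. \<alpha> t * q t)"
    by (rule Bochner_Integration.integrable_cong[THEN iffD1, rotated 2]) (simp_all add: q distrib_left)
  have "integrable (time T) (\<lambda>y. LINT x|time T. U (x, y))"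
    using integrable_fst'[OF integrable_product_swap[OF U]] by simp
  then show wg: "integrable (time T) (\<lambda>t. w t * \<gamma> t)"
    by (rule Bochner_Integration.integrable_cong[THEN iffD1, rotated 2]) (simp_all add: Uin)
  have "w T * ?C T = (LINT s|time T. LINT r|time T. \<alpha> s * \<gamma> r)"
    using w[of T] T by simp
  also have "\<dots> = integral\<^sup>L (time T \<Otimes>\<^sub>M time T) (\<lambda>(s, r). \<alpha> s * \<gamma> r)"
    using integral_fst'[OF prod] by simp
  also have "\<dots> = integral\<^sup>L (time T \<Otimes>\<^sub>M time T) (\<lambda>p. L p + U p)"
    by (intro Bochner_Integration.integral_cong) (auto simp: U_def)
  also have "\<dots> = integral\<^sup>L (time T \<Otimes>\<^sub>M time T) L + integral\<^sup>L (time T \<Otimes>\<^sub>M time T) U"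
    by (rule Bochner_Integration.integral_add[OF L U])
  also have "integral\<^sup>L (time T \<Otimes>\<^sub>M time T) L = (LINT s|time T. \<alpha> s * ?C s)"
    unfolding integral_fst'[OF L, symmetric] by (intro Bochner_Integration.integral_cong) (simp_all add: Lin)
  also have "integral\<^sup>L (time T \<Otimes>\<^sub>M time T) U = (LINT r|time T. w r * \<gamma> r)"
  proof -
    have "(LINT r|time T. LINT s|time T. U (s, r)) = (LINT r|time T. w r * \<gamma> r)"
      by (intro Bochner_Integration.integral_cong) (simp_all add: Uin)
    then show ?thesis using integral_snd[of "curry U"] U by (simp add: curry_def)
  qed
  finally have 1: "w T * ?C T = (LINT s|time T. \<alpha> s * ?C s) + (LINT r|time T. w r * \<gamma> r)" .
  have "(LINT t|time T. \<alpha> t * q t) = (LINT s|time T. \<alpha> s * q0 + \<alpha> s * ?C s)"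
    by (intro Bochner_Integration.integral_cong) (simp_all add: q distrib_left)
  also have "\<dots> = w T * q0 + (LINT s|time T. \<alpha> s * ?C s)"
    using \<alpha> i1 w[of T] T by simp
  finally have "(LINT t|time T. \<alpha> t * q t + w t * \<gamma> t) = w T * q0 + w T * ?C T"
    using 1 by (simp add: Bochner_Integration.integral_add[OF aq wg])
  then show "w T * q T = (LINT t|time T. \<alpha> t * q t + w t * \<gamma> t)"
    using q[of T] T by (simp add: distrib_left)
qed

text \<open>
  \<open>exp (- B t) (A + B \<integral>\<^sub>0\<^sup>t \<phi>)\<close> is nonincreasing.
\<close>

lemma Gronwall_integral:
  fixes \<phi> :: "real \<Rightarrow> real"
  assumes c: "continuous_on {0..T} \<phi>" and B: "B \<ge> 0"
    and le: "\<And>t. t \<in> {0..T} \<Longrightarrow> \<phi> t \<le> A + B * (LINT s|time t. \<phi> s)" and t: "t \<in> {0..T}"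
  shows "\<phi> t \<le> A * exp (B * t)"
proof -
  define \<Phi> where "\<Phi> s = integral {0..s} \<phi>" for s
  have \<Phi>: "(LINT s|time t. \<phi> s) = \<Phi> t" if "t \<in> {0..T}" for t
    unfolding \<Phi>_def using that
    by (intro lebesgue_integral_eq_integral integrable_time_continuous continuous_on_subset[OF c]) auto
  have d: "(\<Phi> has_real_derivative \<phi> s) (at s within {0..T})" if "s \<in> {0..T}" for s
    unfolding \<Phi>_def[abs_def] by (rule integral_has_real_derivative[OF c that])
  define \<psi> where "\<psi> s = exp (- B * s) * (A + B * \<Phi> s)" for s
  have "\<psi> 0 \<ge> \<psi> t"
  proof (rule DERIV_nonpos_imp_decreasing_open[where f = \<psi>])
    show "0 \<le> t" using t by simp
    have "continuous_on {0..T} \<Phi>" using d by (blast intro: DERIV_continuous_on)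
    then show "continuous_on {0..t} \<psi>"
      unfolding \<psi>_def[abs_def] using t by (intro continuous_intros) (auto intro: continuous_on_subset)
    fix s assume s: "0 < s" "s < t"
    then have "(\<Phi> has_real_derivative \<phi> s) (at s)"
      using d[of s] t at_within_interior[of s "{0..T}"] by simp
    then have "(\<psi> has_real_derivative exp (- B * s) * (B * \<phi> s) - B * exp (- B * s) * (A + B * \<Phi> s)) (at s)"
      unfolding \<psi>_def[abs_def] by (auto intro!: derivative_eq_intros)
    moreover have "exp (- B * s) * (B * \<phi> s) - B * exp (- B * s) * (A + B * \<Phi> s) =
        exp (- B * s) * (B * (\<phi> s - (A + B * \<Phi> s)))"
      by (simp add: algebra_simps)
    moreover have "\<dots> \<le> 0"
      using le[of s] s t B \<Phi>[of s] by (intro mult_nonneg_nonpos mult_nonneg_nonpos) auto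
    ultimately show "\<exists>y. (\<psi> has_real_derivative y) (at s) \<and> y \<le> 0" by metis
  qed
  then have "exp (- B * t) * (A + B * \<Phi> t) \<le> A" by (simp add: \<psi>_def \<Phi>_def)
  then have "exp (B * t) * (exp (- B * t) * (A + B * \<Phi> t)) \<le> exp (B * t) * A"
    by (intro mult_left_mono) auto
  then have "A + B * \<Phi> t \<le> A * exp (B * t)"
    by (simp add: mult.assoc[symmetric] exp_add[symmetric] mult.commute)
  then show ?thesis using le[OF t] \<Phi>[OF t] by simp
qed

lemma path_norm_continuous:
  assumes "L2_continuous_path T \<Lambda> y"
  shows "continuous_on {0..T} (\<lambda>t. L2_norm \<Lambda> (y t))"
  unfolding continuous_on_def
proof
  fix t assume t: "t \<in> {0..T}"
  have lim: "((\<lambda>s. L2_norm \<Lambda> (\<lambda>x. y s x - y t x)) \<longlongrightarrow> 0) (at t within {0..T})"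
    using assms t by (auto simp: L2_continuous_path_def)
  have yL: "y s \<in> L2 \<Lambda>" if "s \<in> {0..T}" for s using assms that by (auto simp: L2_continuous_path_def)
  have "((\<lambda>s. L2_norm \<Lambda> (y s) - L2_norm \<Lambda> (y t)) \<longlongrightarrow> 0) (at t within {0..T})"
  proof (rule Lim_null_comparison[OF _ lim])
    have "norm (L2_norm \<Lambda> (y s) - L2_norm \<Lambda> (y t)) \<le> L2_norm \<Lambda> (\<lambda>x. y s x - y t x)" if s: "s \<in> {0..T}" for s
      using L2_triangle_diff[OF yL[OF s] yL[OF t]] L2_triangle_diff[OF yL[OF t] yL[OF s]]
        L2_norm_minus_commute[of \<Lambda> "y s" "y t"] by simp
    then show "\<forall>\<^sub>F s in at t within {0..T}. norm (L2_norm \<Lambda> (y s) - L2_norm \<Lambda> (y t)) \<le> L2_norm \<Lambda> (\<lambda>x. y s x - y t x)"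
      by (auto simp: eventually_at_filter)
  qed
  then show "((\<lambda>t. L2_norm \<Lambda> (y t)) \<longlongrightarrow> L2_norm \<Lambda> (y t)) (at t within {0..T})"
    by (simp add: LIM_zero_iff)
qed

lemma path_inner_continuous:
  assumes "L2_continuous_path T \<Lambda> y" "v \<in> L2 \<Lambda>"
  shows "continuous_on {0..T} (\<lambda>t. L2_inner \<Lambda> (y t) v)"
  unfolding continuous_on_def
proof
  fix t assume t: "t \<in> {0..T}"
  have lim: "((\<lambda>s. L2_norm \<Lambda> (\<lambda>x. y s x - y t x) * L2_norm \<Lambda> v) \<longlongrightarrow> 0) (at t within {0..T})"
    using assms t by (intro tendsto_mult_left_zero) (auto simp: L2_continuous_path_def)
  have yL: "y s \<in> L2 \<Lambda>" if "s \<in> {0..T}" for s using assms that by (auto simp: L2_continuous_path_def)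
  have "((\<lambda>s. L2_inner \<Lambda> (y s) v - L2_inner \<Lambda> (y t) v) \<longlongrightarrow> 0) (at t within {0..T})"
  proof (rule Lim_null_comparison[OF _ lim])
    have "norm (L2_inner \<Lambda> (y s) v - L2_inner \<Lambda> (y t) v) \<le> L2_norm \<Lambda> (\<lambda>x. y s x - y t x) * L2_norm \<Lambda> v"
      if s: "s \<in> {0..T}" for s
      using L2_Cauchy_Schwarz[OF L2_diff[OF yL[OF s] yL[OF t]] assms(2)]
      by (simp add: L2_inner_diff_left yL[OF s] yL[OF t] assms(2))
    then show "\<forall>\<^sub>F s in at t within {0..T}. norm (L2_inner \<Lambda> (y s) v - L2_inner \<Lambda> (y t) v)
        \<le> L2_norm \<Lambda> (\<lambda>x. y s x - y t x) * L2_norm \<Lambda> v"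
      by (auto simp: eventually_at_filter)
  qed
  then show "((\<lambda>t. L2_inner \<Lambda> (y t) v) \<longlongrightarrow> L2_inner \<Lambda> (y t) v) (at t within {0..T})"
    by (simp add: LIM_zero_iff)
qed

lemma path_diff:
  assumes "L2_continuous_path T \<Lambda> y" "L2_continuous_path T \<Lambda> z"
  shows "L2_continuous_path T \<Lambda> (\<lambda>t x. y t x - z t x)"
  unfolding L2_continuous_path_def
proof (intro conjI ballI)
  have L: "y s \<in> L2 \<Lambda>" "z s \<in> L2 \<Lambda>" if "s \<in> {0..T}" for s
    using assms that by (auto simp: L2_continuous_path_def)
  then show "(\<lambda>x. y t x - z t x) \<in> L2 \<Lambda>" if "t \<in> {0..T}" for t using that by (intro L2_diff)
  fix t assume t: "t \<in> {0..T}"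
  have lim: "((\<lambda>s. L2_norm \<Lambda> (\<lambda>x. y s x - y t x) + L2_norm \<Lambda> (\<lambda>x. z s x - z t x)) \<longlongrightarrow> 0 + 0) (at t within {0..T})"
    using assms t by (intro tendsto_add) (auto simp: L2_continuous_path_def)
  have le: "L2_norm \<Lambda> (\<lambda>x. y s x - z s x - (y t x - z t x))
      \<le> L2_norm \<Lambda> (\<lambda>x. y s x - y t x) + L2_norm \<Lambda> (\<lambda>x. z s x - z t x)" if s: "s \<in> {0..T}" for s
    using L2_triangle[OF L2_diff[OF L(1)[OF s] L(1)[OF t]] L2_diff[OF L(2)[OF t] L(2)[OF s]]]
      L2_norm_minus_commute[of \<Lambda> "z s" "z t"]
    by (simp add: algebra_simps)
  show "((\<lambda>s. L2_norm \<Lambda> (\<lambda>x. y s x - z s x - (y t x - z t x))) \<longlongrightarrow> 0) (at t within {0..T})"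
    by (rule Lim_null_comparison[OF _ lim[simplified]])
      (use le in \<open>auto simp: eventually_at_filter L2_norm_nonneg\<close>)
qed

lemma path_norm_bounded:
  assumes "L2_continuous_path T \<Lambda> y"
  obtains K where "K \<ge> 0" "\<And>t. t \<in> {0..T} \<Longrightarrow> L2_norm \<Lambda> (y t) \<le> K"
proof -
  have "bounded ((\<lambda>t. L2_norm \<Lambda> (y t)) ` {0..T})"
    by (intro compact_imp_bounded compact_continuous_image path_norm_continuous assms) simp
  then obtain K where "\<And>t. t \<in> {0..T} \<Longrightarrow> \<bar>L2_norm \<Lambda> (y t)\<bar> \<le> K"
    unfolding bounded_iff by (metis imageI real_norm_def)
  then have "L2_norm \<Lambda> (y t) \<le> \<bar>K\<bar>" if "t \<in> {0..T}" for t using that by force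
  then show thesis by (intro that[of "\<bar>K\<bar>"]) auto
qed

section \<open>The heat equation in cosine coefficients\<close>

context bounded_interval
begin

text \<open>
  Measurability of an \<open>L\<^sup>2\<close>-valued function of time is tested on the cosine coefficients. A path only
  determines an element of \<open>L\<^sup>2\<close> for each time, and its representatives at different times are
  unrelated, so that it need not be jointly measurable in \<open>(t, x)\<close>.
\<close>

definition L2_field :: "real \<Rightarrow> (real \<Rightarrow> real \<Rightarrow> real) \<Rightarrow> bool" where
  "L2_field T F \<longleftrightarrow> (AE t in time T. F t \<in> L2 I) \<and> (\<forall>k. (\<lambda>t. coef (F t) k) \<in> borel_measurable (time T))"

lemma L2_field_inner_measurable:
  assumes "L2_field T F" "L2_field T G"
  shows "(\<lambda>t. L2_inner I (F t) (G t)) \<in> borel_measurable (time T)"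
proof (rule time_measurable_AE_LIMSEQ)
  show "(\<lambda>t. \<Sum>k<n. coef (F t) k * coef (G t) k) \<in> borel_measurable (time T)" for n
    using assms unfolding L2_field_def by (intro borel_measurable_sum borel_measurable_times) auto
  have "AE t in time T. F t \<in> L2 I" "AE t in time T. G t \<in> L2 I" using assms by (auto simp: L2_field_def)
  then show "AE t in time T. (\<lambda>n. \<Sum>k<n. coef (F t) k * coef (G t) k) \<longlonglongrightarrow> L2_inner I (F t) (G t)"
    by eventually_elim (use coef_Parseval in \<open>simp add: sums_def\<close>)
qed

lemma L2_norm_eq_sqrt: "L2_norm I v = sqrt (L2_inner I v v)"
  using L2_norm_square[of I v] L2_norm_nonneg[of I v] by (metis real_sqrt_unique)

lemma L2_field_norm_measurable:
  "L2_field T F \<Longrightarrow> (\<lambda>t. L2_norm I (F t)) \<in> borel_measurable (time T)"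
  unfolding L2_norm_eq_sqrt using L2_field_inner_measurable by auto

lemma path_L2: "L2_continuous_path T I y \<Longrightarrow> t \<in> {0..T} \<Longrightarrow> y t \<in> L2 I"
  by (auto simp: L2_continuous_path_def)

lemma path_coef_continuous:
  "L2_continuous_path T I y \<Longrightarrow> continuous_on {0..T} (\<lambda>t. coef (y t) k)"
  unfolding coef_def by (intro path_inner_continuous cosine_L2)

lemma path_coef_integrable:
  "L2_continuous_path T I y \<Longrightarrow> integrable (time T) (\<lambda>t. coef (y t) k)"
  by (intro integrable_time_continuous path_coef_continuous)

lemma path_L2_field: "L2_continuous_path T I y \<Longrightarrow> L2_field T y"
  unfolding L2_field_def using path_coef_integrable[of T y] by (auto intro!: AE_I2 path_L2)

lemma L2_field_mono: "L2_field T F \<Longrightarrow> t \<le> T \<Longrightarrow> L2_field t F"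
  unfolding L2_field_def by (blast intro: AE_time_mono measurable_time_mono)

lemma path_mono:
  assumes "L2_continuous_path T I y" "t \<le> T" shows "L2_continuous_path t I y"
  unfolding L2_continuous_path_def
proof (intro conjI ballI)
  fix s assume s: "s \<in> {0..t}"
  show "y s \<in> L2 I" using assms s by (intro path_L2) auto
  show "((\<lambda>r. L2_norm I (\<lambda>x. y r x - y s x)) \<longlongrightarrow> 0) (at s within {0..t})"
    by (rule tendsto_within_subset[where S = "{0..T}"])
      (use assms s in \<open>auto simp: L2_continuous_path_def\<close>)
qed

lemma coef_partial_sum_le:
  assumes "v \<in> L2 I" "w \<in> L2 I"
  shows "\<bar>\<Sum>k<n. coef v k * coef w k\<bar> \<le> L2_norm I v * L2_norm I w"
proof (rule power2_le_imp_le)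
  have bessel: "(\<Sum>k<n. (coef z k)\<^sup>2) \<le> (L2_norm I z)\<^sup>2" if "z \<in> L2 I" for z
    using coef_Parseval_norm(1)[OF that] sum_le_suminf[of "\<lambda>k. (coef z k)\<^sup>2" "{..<n}"]
    by (auto simp: sums_iff)
  have "(\<Sum>k<n. coef v k * coef w k)\<^sup>2 \<le> (\<Sum>k<n. (coef v k)\<^sup>2) * (\<Sum>k<n. (coef w k)\<^sup>2)"
    by (rule Cauchy_Schwarz_ineq_sum)
  also have "\<dots> \<le> (L2_norm I v)\<^sup>2 * (L2_norm I w)\<^sup>2"
    by (intro mult_mono bessel assms sum_nonneg) auto
  finally show "\<bar>\<Sum>k<n. coef v k * coef w k\<bar>\<^sup>2 \<le> (L2_norm I v * L2_norm I w)\<^sup>2"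
    by (simp add: power_mult_distrib)
qed (simp add: L2_norm_nonneg)

text \<open>
  Partial sums of Parseval's series are bounded by the product of the norms, which makes termwise
  integration in time a case of dominated convergence.
\<close>

lemma field_path_integrable:
  assumes F: "L2_field T F" "integrable (time T) (\<lambda>t. L2_norm I (F t))" and q: "L2_continuous_path T I q"
  shows "integrable (time T) (\<lambda>t. coef (F t) k)"
    and "integrable (time T) (\<lambda>t. coef (F t) k * coef (q t) k)"
    and "integrable (time T) (\<lambda>t. L2_inner I (F t) (q t))"
    and "(\<lambda>n. LINT t|time T. (\<Sum>k<n. coef (F t) k * coef (q t) k)) \<longlonglongrightarrow> (LINT t|time T. L2_inner I (F t) (q t))"
proof -
  obtain K where K: "K \<ge> 0" "\<And>t. t \<in> {0..T} \<Longrightarrow> L2_norm I (q t) \<le> K"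
    using path_norm_bounded[OF q] by blast
  have FK: "integrable (time T) (\<lambda>t. L2_norm I (F t) * K)" using F(2) by simp
  have FL: "AE t in time T. F t \<in> L2 I" using F(1) by (simp add: L2_field_def)
  have qL: "AE t in time T. q t \<in> L2 I \<and> L2_norm I (q t) \<le> K"
    by (intro AE_I2 conjI K path_L2[OF q]) auto
  have cm: "(\<lambda>t. coef (F t) k) \<in> borel_measurable (time T)" "(\<lambda>t. coef (q t) k) \<in> borel_measurable (time T)" for k
    using F(1) path_L2_field[OF q] by (auto simp: L2_field_def)
  show "integrable (time T) (\<lambda>t. coef (F t) k)"
  proof (rule Bochner_Integration.integrable_bound[OF F(2) cm(1)])
    show "AE t in time T. norm (coef (F t) k) \<le> norm (L2_norm I (F t))"
      using FL by eventually_elim (simp add: coef_le_norm L2_norm_nonneg)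
  qed
  have le: "\<bar>L2_inner I v w\<bar> \<le> L2_norm I v * K" "\<bar>\<Sum>k<n. coef v k * coef w k\<bar> \<le> L2_norm I v * K"
    "\<bar>coef v k * coef w k\<bar> \<le> L2_norm I v * K"
    if "v \<in> L2 I" "w \<in> L2 I" "L2_norm I w \<le> K" for v w n k
  proof -
    have "L2_norm I v * L2_norm I w \<le> L2_norm I v * K" by (intro mult_left_mono that L2_norm_nonneg)
    moreover have "\<bar>coef v k * coef w k\<bar> \<le> L2_norm I v * L2_norm I w"
      unfolding abs_mult by (intro mult_mono coef_le_norm that L2_norm_nonneg) simp
    ultimately show "\<bar>L2_inner I v w\<bar> \<le> L2_norm I v * K" "\<bar>\<Sum>k<n. coef v k * coef w k\<bar> \<le> L2_norm I v * K"
      "\<bar>coef v k * coef w k\<bar> \<le> L2_norm I v * K"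
      using coef_partial_sum_le[OF that(1,2), of n] L2_Cauchy_Schwarz[OF that(1,2)] by linarith+
  qed
  show "integrable (time T) (\<lambda>t. coef (F t) k * coef (q t) k)"
  proof (rule Bochner_Integration.integrable_bound[OF FK])
    show "AE t in time T. norm (coef (F t) k * coef (q t) k) \<le> norm (L2_norm I (F t) * K)"
      using FL qL by eventually_elim (use le(3) K(1) in \<open>auto simp: L2_norm_nonneg\<close>)
  qed (use cm in auto)
  show "integrable (time T) (\<lambda>t. L2_inner I (F t) (q t))"
  proof (rule Bochner_Integration.integrable_bound[OF FK L2_field_inner_measurable[OF F(1) path_L2_field[OF q]]])
    show "AE t in time T. norm (L2_inner I (F t) (q t)) \<le> norm (L2_norm I (F t) * K)"
      using FL qL by eventually_elim (use le(1) K(1) in \<open>auto simp: L2_norm_nonneg\<close>)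
  qed
  show "(\<lambda>n. LINT t|time T. (\<Sum>k<n. coef (F t) k * coef (q t) k)) \<longlonglongrightarrow> (LINT t|time T. L2_inner I (F t) (q t))"
  proof (rule integral_dominated_convergence[OF L2_field_inner_measurable[OF F(1) path_L2_field[OF q]] _ FK])
    show "(\<lambda>t. \<Sum>k<n. coef (F t) k * coef (q t) k) \<in> borel_measurable (time T)" for n
      by (intro borel_measurable_sum borel_measurable_times cm)
    show "AE t in time T. (\<lambda>n. \<Sum>k<n. coef (F t) k * coef (q t) k) \<longlonglongrightarrow> L2_inner I (F t) (q t)"
      using FL qL by eventually_elim (use coef_Parseval in \<open>simp add: sums_def\<close>)
    show "AE t in time T. norm (\<Sum>k<n. coef (F t) k * coef (q t) k) \<le> L2_norm I (F t) * K" for n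
      using FL qL by eventually_elim (use le(2) in auto)
  qed
qed

text \<open>
  The weak form of \<open>\<partial>\<^sub>t w = \<Delta> w + F\<close> with Neumann boundary condition and \<open>w(0) = 0\<close>, tested with the
  cosines only; below, the corresponding equation backward in time with free terminal value.
\<close>

definition heat_equation :: "real \<Rightarrow> (real \<Rightarrow> real \<Rightarrow> real) \<Rightarrow> (real \<Rightarrow> real \<Rightarrow> real) \<Rightarrow> bool" where
  "heat_equation T w F \<longleftrightarrow>
     L2_continuous_path T I w \<and> L2_field T F \<and> integrable (time T) (\<lambda>t. L2_norm I (F t)) \<and>
     (\<forall>t\<in>{0..T}. \<forall>k. coef (w t) k = (LINT s|time t. - (freq k)\<^sup>2 * coef (w s) k + coef (F s) k))"

definition backward_heat_equation :: "real \<Rightarrow> (real \<Rightarrow> real \<Rightarrow> real) \<Rightarrow> (real \<Rightarrow> real \<Rightarrow> real) \<Rightarrow> bool" where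
  "backward_heat_equation T q G \<longleftrightarrow>
     L2_continuous_path T I q \<and> L2_field T G \<and> integrable (time T) (\<lambda>t. L2_norm I (G t)) \<and>
     (\<forall>t\<in>{0..T}. \<forall>k. coef (q t) k = coef (q T) k +
        (LINT s|lebesgue_on {t..T}. - (freq k)\<^sup>2 * coef (q s) k + coef (G s) k))"

text \<open>
  In each mode the eigenvalue contributes with opposite signs to the forward and the backward
  equation and cancels in the product rule; only the square-integrable sources have to be summed.
\<close>

lemma heat_duality:
  assumes T: "0 \<le> T" and w: "heat_equation T w F" and q: "backward_heat_equation T q G"
  shows "L2_inner I (w T) (q T) = (LINT t|time T. L2_inner I (F t) (q t) - L2_inner I (w t) (G t))"
proof -
  have wp: "L2_continuous_path T I w" and F: "L2_field T F" "integrable (time T) (\<lambda>t. L2_norm I (F t))"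
    and we: "\<And>t k. t \<in> {0..T} \<Longrightarrow> coef (w t) k = (LINT s|time t. - (freq k)\<^sup>2 * coef (w s) k + coef (F s) k)"
    using w unfolding heat_equation_def by blast+
  have qp: "L2_continuous_path T I q" and G: "L2_field T G" "integrable (time T) (\<lambda>t. L2_norm I (G t))"
    and qe: "\<And>t k. t \<in> {0..T} \<Longrightarrow> coef (q t) k = coef (q T) k +
        (LINT s|lebesgue_on {t..T}. - (freq k)\<^sup>2 * coef (q s) k + coef (G s) k)"
    using q unfolding backward_heat_equation_def by blast+
  note Fq = field_path_integrable[OF F qp] and Gw = field_path_integrable[OF G wp]
  have mode: "coef (w T) k * coef (q T) k =
      (LINT t|time T. coef (F t) k * coef (q t) k - coef (G t) k * coef (w t) k)" for k
  proof -
    let ?\<alpha> = "\<lambda>s. - (freq k)\<^sup>2 * coef (w s) k + coef (F s) k"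
    let ?\<beta> = "\<lambda>s. - (freq k)\<^sup>2 * coef (q s) k + coef (G s) k"
    have i: "integrable (time T) ?\<alpha>" "integrable (time T) ?\<beta>"
      using Fq(1) Gw(1) path_coef_integrable[OF wp] path_coef_integrable[OF qp] by auto
    have "coef (w T) k * coef (q T) k = (LINT t|time T. ?\<alpha> t * coef (q t) k + coef (w t) k * (- ?\<beta> t))"
    proof (rule product_rule_integrals(3)[OF T i(1)])
      show "integrable (time T) (\<lambda>t. - ?\<beta> t)" using i(2) by (rule Bochner_Integration.integrable_minus)
      fix t assume t: "t \<in> {0..T}"
      show "coef (w t) k = (LINT s|time t. ?\<alpha> s)" by (rule we[OF t])
      show "coef (q t) k = (coef (q T) k + (LINT s|time T. ?\<beta> s)) + (LINT s|time t. - ?\<beta> s)"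
        using qe[OF t, of k] integral_time_split[OF i(2), of t] t
        by (simp only: integral_minus atLeastAtMost_iff)
    qed
    also have "\<dots> = (LINT t|time T. coef (F t) k * coef (q t) k - coef (G t) k * coef (w t) k)"
      by (intro Bochner_Integration.integral_cong) (auto simp: algebra_simps)
    finally show ?thesis .
  qed
  have lim: "(\<lambda>n. \<Sum>k<n. coef (w T) k * coef (q T) k) \<longlonglongrightarrow> L2_inner I (w T) (q T)"
    using coef_Parseval[OF path_L2[OF wp, of T] path_L2[OF qp, of T]] T by (simp add: sums_def)
  have eq: "(\<Sum>k<n. coef (w T) k * coef (q T) k) =
      (LINT t|time T. (\<Sum>k<n. coef (F t) k * coef (q t) k)) - (LINT t|time T. (\<Sum>k<n. coef (G t) k * coef (w t) k))" for n
    unfolding mode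
    by (simp add: Bochner_Integration.integral_sum Bochner_Integration.integral_diff Fq(2) Gw(2) sum_subtractf)
  have "L2_inner I (w T) (q T) =
      (LINT t|time T. L2_inner I (F t) (q t)) - (LINT t|time T. L2_inner I (G t) (w t))"
    by (rule LIMSEQ_unique[OF lim[unfolded eq] tendsto_diff[OF Fq(4) Gw(4)]])
  then show ?thesis
    using Fq(3) Gw(3) by (simp add: L2_inner_commute[of I "G _"])
qed

text \<open>
  The product rule of \<open>w\<close> with itself in each mode. The eigenvalues have a sign, so those of the first
  \<open>m\<close> modes may be kept while the number of modes on the right tends to infinity.
\<close>

lemma heat_energy:
  assumes w: "heat_equation T w F" and t: "t \<in> {0..T}"
  shows "(L2_norm I (w t))\<^sup>2 + 2 * (LINT s|time t. (\<Sum>k<m. (freq k)\<^sup>2 * (coef (w s) k)\<^sup>2))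
    \<le> 2 * (LINT s|time t. L2_inner I (F s) (w s))"
proof -
  have t0: "0 \<le> t" "t \<le> T" using t by auto
  have wp: "L2_continuous_path t I w" and F: "L2_field t F" "integrable (time t) (\<lambda>t. L2_norm I (F t))"
    using w unfolding heat_equation_def
    by (blast intro: path_mono[OF _ t0(2)] L2_field_mono[OF _ t0(2)] integrable_time_mono[OF _ t0(2)])+
  have we: "coef (w s) k = (LINT s|time s. - (freq k)\<^sup>2 * coef (w s) k + coef (F s) k)" if "s \<in> {0..t}" for s k
    using w that t0 unfolding heat_equation_def by (meson atLeastAtMost_iff order_trans)
  note Fw = field_path_integrable[OF F wp]
  have w2: "integrable (time t) (\<lambda>s. (freq k)\<^sup>2 * (coef (w s) k)\<^sup>2)" for k
    by (intro integrable_mult_right integrable_time_continuous continuous_intros path_coef_continuous[OF wp])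
  have mode: "(coef (w t) k)\<^sup>2 + 2 * (LINT s|time t. (freq k)\<^sup>2 * (coef (w s) k)\<^sup>2) =
      2 * (LINT s|time t. coef (F s) k * coef (w s) k)" for k
  proof -
    let ?\<alpha> = "\<lambda>s. - (freq k)\<^sup>2 * coef (w s) k + coef (F s) k"
    have i: "integrable (time t) ?\<alpha>"
      using Fw(1) path_coef_integrable[OF wp] by auto
    have "coef (w t) k * coef (w t) k = (LINT s|time t. ?\<alpha> s * coef (w s) k + coef (w s) k * ?\<alpha> s)"
    proof (rule product_rule_integrals(3)[OF t0(1) i i, where ?q0.0 = 0])
      fix s assume "s \<in> {0..t}"
      from we[OF this] show "coef (w s) k = (LINT r|time s. ?\<alpha> r)" "coef (w s) k = 0 + (LINT r|time s. ?\<alpha> r)"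
        unfolding add_0 by blast+
    qed
    also have "\<dots> = (LINT s|time t. 2 * (coef (F s) k * coef (w s) k) - 2 * ((freq k)\<^sup>2 * (coef (w s) k)\<^sup>2))"
      by (intro Bochner_Integration.integral_cong) (auto simp: algebra_simps power2_eq_square)
    also have "\<dots> = 2 * (LINT s|time t. coef (F s) k * coef (w s) k) - 2 * (LINT s|time t. (freq k)\<^sup>2 * (coef (w s) k)\<^sup>2)"
      using Fw(2)[of k] w2[of k] by (subst Bochner_Integration.integral_diff) auto
    finally show ?thesis by (simp add: power2_eq_square[of "coef (w t) k"])
  qed
  \<comment> \<open>\<open>m\<close> stays fixed in the limit \<open>n \<rightarrow> \<infinity>\<close>\<close>
  have "(\<Sum>k<n. (coef (w t) k)\<^sup>2) + 2 * (LINT s|time t. (\<Sum>k<m. (freq k)\<^sup>2 * (coef (w s) k)\<^sup>2))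
      \<le> 2 * (LINT s|time t. (\<Sum>k<n. coef (F s) k * coef (w s) k))" if "m \<le> n" for n
  proof -
    have "(LINT s|time t. (\<Sum>k<m. (freq k)\<^sup>2 * (coef (w s) k)\<^sup>2)) = (\<Sum>k<m. LINT s|time t. (freq k)\<^sup>2 * (coef (w s) k)\<^sup>2)"
      using w2 by (rule Bochner_Integration.integral_sum)
    also have "\<dots> \<le> (\<Sum>k<n. LINT s|time t. (freq k)\<^sup>2 * (coef (w s) k)\<^sup>2)"
      using that by (intro sum_mono2) (auto intro!: Bochner_Integration.integral_nonneg)
    finally have "(\<Sum>k<n. (coef (w t) k)\<^sup>2) + 2 * (LINT s|time t. (\<Sum>k<m. (freq k)\<^sup>2 * (coef (w s) k)\<^sup>2))
        \<le> (\<Sum>k<n. (coef (w t) k)\<^sup>2 + 2 * (LINT s|time t. (freq k)\<^sup>2 * (coef (w s) k)\<^sup>2))"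
      by (simp add: sum.distrib sum_distrib_left[symmetric])
    also have "\<dots> = 2 * (LINT s|time t. (\<Sum>k<n. coef (F s) k * coef (w s) k))"
      unfolding mode using Fw(2) by (subst Bochner_Integration.integral_sum) (auto simp: sum_distrib_left)
    finally show ?thesis .
  qed
  note le = this
  have lim1: "(\<lambda>n. (\<Sum>k<n. (coef (w t) k)\<^sup>2) + 2 * (LINT s|time t. (\<Sum>k<m. (freq k)\<^sup>2 * (coef (w s) k)\<^sup>2))) \<longlonglongrightarrow>
      (L2_norm I (w t))\<^sup>2 + 2 * (LINT s|time t. (\<Sum>k<m. (freq k)\<^sup>2 * (coef (w s) k)\<^sup>2))"
    using coef_Parseval_norm(1)[OF path_L2[OF wp, of t]] t0(1)
    by (intro tendsto_add tendsto_const) (simp add: sums_def)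
  have lim2: "(\<lambda>n. 2 * (LINT s|time t. (\<Sum>k<n. coef (F s) k * coef (w s) k))) \<longlonglongrightarrow>
      2 * (LINT s|time t. L2_inner I (F s) (w s))"
    by (intro tendsto_mult tendsto_const Fw(4))
  show ?thesis by (rule LIMSEQ_le[OF lim1 lim2]) (use le in blast)
qed

text \<open>
  A common bound for the supremum and for the energy integral: Gronwall's factor is the exponential,
  the other factors come from inserting its bound once more into the energy inequality.
\<close>

definition stability_const :: "real \<Rightarrow> real \<Rightarrow> real" where
  "stability_const K T = (1 + T) * (1 + (2 * K + 1) * T) * exp ((2 * K + 1) * T)"

text \<open>
  One-sided bounds of the source suffice for Gronwall's lemma. The estimate does not see the size of
  the source itself, which for the cubic nonlinearity is not controlled uniformly.
\<close>

lemma heat_stability: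
  assumes w: "heat_equation T w F" and T: "0 \<le> T" and K: "K \<ge> 0"
    and n: "integrable (time T) (\<lambda>t. (n t)\<^sup>2)"
    and dissip: "AE s in time T. L2_inner I (F s) (w s) \<le> K * (L2_norm I (w s))\<^sup>2 + n s * L2_norm I (w s)"
  shows "t \<in> {0..T} \<Longrightarrow> (L2_norm I (w t))\<^sup>2 \<le> stability_const K T * (LINT s|time T. (n s)\<^sup>2)"
    and "(LINT s|time T. (\<Sum>k<m. (1 + (freq k)\<^sup>2) * (coef (w s) k)\<^sup>2))
      \<le> stability_const K T * (LINT s|time T. (n s)\<^sup>2)"
proof -
  let ?N = "LINT s|time T. (n s)\<^sup>2" and ?B = "2 * K + 1"
  let ?g = "\<lambda>m s. \<Sum>k<m. (freq k)\<^sup>2 * (coef (w s) k)\<^sup>2"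
  have wp: "L2_continuous_path T I w" and F: "L2_field T F" "integrable (time T) (\<lambda>t. L2_norm I (F t))"
    using w unfolding heat_equation_def by blast+
  have N: "0 \<le> ?N" by (rule Bochner_Integration.integral_nonneg) simp
  have nc: "continuous_on {0..T} (\<lambda>t. (L2_norm I (w t))\<^sup>2)"
    by (intro continuous_intros path_norm_continuous[OF wp])
  have g: "integrable (time T) (?g m)" "0 \<le> ?g m s" for m s
    by (intro Bochner_Integration.integrable_sum integrable_mult_right integrable_time_continuous
        continuous_intros path_coef_continuous[OF wp]) (auto intro: sum_nonneg)
  \<comment> \<open>\<open>2 n \<parallel>w\<parallel> \<le> n\<^sup>2 + \<parallel>w\<parallel>\<^sup>2\<close> turns the bound of the source into a linear one for \<open>\<parallel>w\<parallel>\<^sup>2\<close>\<close>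
  have main: "(L2_norm I (w t))\<^sup>2 + 2 * (LINT s|time t. ?g m s) \<le> ?N + ?B * (LINT s|time t. (L2_norm I (w s))\<^sup>2)"
    if t: "t \<in> {0..T}" for t m
  proof -
    have tT: "t \<le> T" using t by simp
    have iw: "integrable (time t) (\<lambda>s. (L2_norm I (w s))\<^sup>2)" "integrable (time t) (\<lambda>s. (n s)\<^sup>2)"
      using integrable_time_mono[OF integrable_time_continuous[OF nc] tT] integrable_time_mono[OF n tT] by auto
    have "2 * (LINT s|time t. L2_inner I (F s) (w s)) = (LINT s|time t. 2 * L2_inner I (F s) (w s))" by simp
    also have "\<dots> \<le> (LINT s|time t. (n s)\<^sup>2 + ?B * (L2_norm I (w s))\<^sup>2)"
    proof (rule integral_mono_AE)
      show "integrable (time t) (\<lambda>s. 2 * L2_inner I (F s) (w s))"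
        using integrable_time_mono[OF field_path_integrable(3)[OF F wp] tT] by simp
      show "AE s in time t. 2 * L2_inner I (F s) (w s) \<le> (n s)\<^sup>2 + ?B * (L2_norm I (w s))\<^sup>2"
        using AE_time_mono[OF dissip tT]
      proof eventually_elim
        case (elim s)
        have "2 * (n s * L2_norm I (w s)) \<le> (n s)\<^sup>2 + (L2_norm I (w s))\<^sup>2"
          using sum_squares_bound[of "n s" "L2_norm I (w s)"] by simp
        with elim show ?case by (simp add: distrib_right)
      qed
    qed (use iw in auto)
    also have "\<dots> = (LINT s|time t. (n s)\<^sup>2) + ?B * (LINT s|time t. (L2_norm I (w s))\<^sup>2)"
      using iw by simp
    also have "(LINT s|time t. (n s)\<^sup>2) \<le> ?N"
      using t by (intro integral_time_mono[OF n]) auto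
    finally show ?thesis using heat_energy[OF w t, of m] by simp
  qed
  have G: "(L2_norm I (w t))\<^sup>2 \<le> ?N * exp (?B * T)" if t: "t \<in> {0..T}" for t
  proof -
    have "(L2_norm I (w t))\<^sup>2 \<le> ?N * exp (?B * t)"
      by (rule Gronwall_integral[OF nc _ _ t]) (use main[where m = 0] K in auto)
    also have "\<dots> \<le> ?N * exp (?B * T)" using t K N by (intro mult_left_mono) (auto intro: mult_left_mono)
    finally show ?thesis .
  qed
  have e1: "1 \<le> exp (?B * T)" using T K by simp
  have stab: "stability_const K T * ?N = ?N * exp (?B * T) * ((1 + T) * (1 + ?B * T))"
    unfolding stability_const_def by (simp only: mult_ac)
  have GT: "(LINT s|time T. (L2_norm I (w s))\<^sup>2) \<le> T * (?N * exp (?B * T))"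
  proof -
    have "(LINT s|time T. (L2_norm I (w s))\<^sup>2) \<le> (LINT s|time T. ?N * exp (?B * T))"
      using G integrable_time_continuous[OF nc]
      by (intro integral_mono_AE AE_I2) (auto intro: finite_measure.integrable_const[OF finite_measure_time])
    then show ?thesis using T by (simp add: measure_restrict_space mult_ac)
  qed
  show "(L2_norm I (w t))\<^sup>2 \<le> stability_const K T * ?N" if "t \<in> {0..T}"
  proof -
    have "?N * exp (?B * T) * 1 \<le> ?N * exp (?B * T) * ((1 + T) * (1 + ?B * T))"
      using N T K by (intro mult_left_mono) (auto simp: algebra_simps intro!: add_nonneg_nonneg)
    then show ?thesis using G[OF that] unfolding stab by linarith
  qed
  have parts: "(LINT s|time T. (\<Sum>k<m. (1 + (freq k)\<^sup>2) * (coef (w s) k)\<^sup>2)) \<le>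
      (LINT s|time T. (L2_norm I (w s))\<^sup>2 + ?g m s)"
  proof (rule integral_mono_AE)
    show "integrable (time T) (\<lambda>s. \<Sum>k<m. (1 + (freq k)\<^sup>2) * (coef (w s) k)\<^sup>2)"
      by (intro Bochner_Integration.integrable_sum integrable_mult_right integrable_time_continuous
        continuous_intros path_coef_continuous[OF wp])
    show "AE s in time T. (\<Sum>k<m. (1 + (freq k)\<^sup>2) * (coef (w s) k)\<^sup>2) \<le> (L2_norm I (w s))\<^sup>2 + ?g m s"
    proof (rule AE_I2)
      fix s assume "s \<in> space (time T)"
      then have "w s \<in> L2 I" using path_L2[OF wp, of s] by simp
      from coef_partial_sum_le[OF this this, of m]
      show "(\<Sum>k<m. (1 + (freq k)\<^sup>2) * (coef (w s) k)\<^sup>2) \<le> (L2_norm I (w s))\<^sup>2 + ?g m s"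
        by (simp add: distrib_right sum.distrib power2_eq_square)
    qed
  qed (use integrable_time_continuous[OF nc] g in auto)
  also have "\<dots> = (LINT s|time T. (L2_norm I (w s))\<^sup>2) + (LINT s|time T. ?g m s)"
    using integrable_time_continuous[OF nc] g by simp
  also have "\<dots> \<le> T * (?N * exp (?B * T)) + (?N * exp (?B * T) + ?B * (T * (?N * exp (?B * T))))"
  proof -
    have "(LINT s|time T. ?g m s) \<ge> 0" using g by (intro Bochner_Integration.integral_nonneg) auto
    moreover have "T \<in> {0..T}" using T by simp
    ultimately have "(LINT s|time T. ?g m s) \<le> ?N + ?B * (LINT s|time T. (L2_norm I (w s))\<^sup>2)"
      using main[of T m] zero_le_power2[of "L2_norm I (w T)"] by linarith
    also have "\<dots> \<le> ?N * exp (?B * T) + ?B * (T * (?N * exp (?B * T)))"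
      using GT K mult_left_mono[OF e1 N] by (intro add_mono mult_left_mono) auto
    finally show ?thesis using GT by simp
  qed
  also have "\<dots> \<le> stability_const K T * ?N"
  proof -
    have "0 \<le> ?N * exp (?B * T) * (T * (?B * T))" using N T K by (intro mult_nonneg_nonneg) auto
    moreover have "T * X + (X + b * (T * X)) + X * (T * (b * T)) = X * ((1 + T) * (1 + b * T))" for X b :: real
      by (simp add: algebra_simps)
    ultimately show ?thesis unfolding stab by (metis add_le_cancel_left add.right_neutral)
  qed
  finally show "(LINT s|time T. (\<Sum>k<m. (1 + (freq k)\<^sup>2) * (coef (w s) k)\<^sup>2)) \<le> stability_const K T * ?N" .
qed

end

section \<open>Nonlinear paths\<close>

context bounded_interval
begin

definition sup_bound :: "(real \<Rightarrow> real) \<Rightarrow> real" where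
  "sup_bound v = sup_const * (\<Sum>k. \<bar>coef v k\<bar>)"

text \<open>
  Paths with absolutely summable cosine coefficients, as supplied by square integrability in time of
  the \<open>H\<^sup>1\<close>-norm. Such a path has a jointly measurable version, namely its cosine series.
\<close>

definition bounded_path :: "real \<Rightarrow> (real \<Rightarrow> real \<Rightarrow> real) \<Rightarrow> bool" where
  "bounded_path T y \<longleftrightarrow> L2_continuous_path T I y \<and>
     (AE t in time T. summable (\<lambda>k. \<bar>coef (y t) k\<bar>)) \<and>
     integrable (time T) (\<lambda>t. (sup_bound (y t))\<^sup>2)"

lemma sup_bound_nonneg: "summable (\<lambda>k. \<bar>coef v k\<bar>) \<Longrightarrow> 0 \<le> sup_bound v"
  unfolding sup_bound_def by (intro mult_nonneg_nonneg sup_const_nonneg suminf_nonneg) auto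

lemma sup_bound_measurable:
  assumes y: "L2_continuous_path T I y" and s: "AE t in time T. summable (\<lambda>k. \<bar>coef (y t) k\<bar>)"
  shows "(\<lambda>t. sup_bound (y t)) \<in> borel_measurable (time T)"
proof (rule time_measurable_AE_LIMSEQ)
  show "(\<lambda>t. sup_const * (\<Sum>k<n. \<bar>coef (y t) k\<bar>)) \<in> borel_measurable (time T)" for n
    by (intro borel_measurable_integrable integrable_time_continuous continuous_intros path_coef_continuous[OF y])
  show "AE t in time T. (\<lambda>n. sup_const * (\<Sum>k<n. \<bar>coef (y t) k\<bar>)) \<longlonglongrightarrow> sup_bound (y t)"
    using s unfolding sup_bound_def by eventually_elim (intro tendsto_mult tendsto_const summable_LIMSEQ)
qed

lemma sup_bound:
  assumes "v \<in> L2 I" "summable (\<lambda>k. \<bar>coef v k\<bar>)"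
  shows "AE x in lebesgue_on I. \<bar>v x\<bar> \<le> sup_bound v"
  using cosine_series(1)[OF assms]
  by eventually_elim (simp add: cosine_series(2)[OF assms] sup_bound_def)

lemma H1_path_bounded:
  assumes y: "L2_continuous_path T I y" and H: "AE t in time T. y t \<in> H1 I"
    and i: "integrable (time T) (\<lambda>t. (H1_norm I (y t))\<^sup>2)"
  shows "bounded_path T y"
  unfolding bounded_path_def
proof (intro conjI y)
  show s: "AE t in time T. summable (\<lambda>k. \<bar>coef (y t) k\<bar>)"
    using H by eventually_elim (rule H1_summable_coef)
  show "integrable (time T) (\<lambda>t. (sup_bound (y t))\<^sup>2)"
  proof (rule Bochner_Integration.integrable_bound[OF integrable_mult_right[OF i]])
    show "(\<lambda>t. (sup_bound (y t))\<^sup>2) \<in> borel_measurable (time T)"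
      using sup_bound_measurable[OF y s] by (rule borel_measurable_power)
    show "AE t in time T. norm ((sup_bound (y t))\<^sup>2) \<le> norm ((sup_const\<^sup>2 * sobolev_const) * (H1_norm I (y t))\<^sup>2)"
      using H
    proof eventually_elim
      case (elim t)
      have "(sup_bound (y t))\<^sup>2 \<le> sup_const\<^sup>2 * (sobolev_const * (H1_norm I (y t))\<^sup>2)"
        unfolding sup_bound_def power_mult_distrib by (intro mult_left_mono H1_summable_coef(2)[OF elim]) simp
      then show ?case by simp
    qed
  qed
qed

definition series :: "(real \<Rightarrow> real \<Rightarrow> real) \<Rightarrow> real \<times> real \<Rightarrow> real" where
  "series y = (\<lambda>(t, x). \<Sum>k. coef (y t) k * cosine k x)"

lemma series_measurable:
  assumes "L2_continuous_path T I y"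
  shows "series y \<in> borel_measurable (time T \<Otimes>\<^sub>M lebesgue_on I)"
proof -
  have 1: "(\<lambda>t. coef (y t) k) \<in> borel_measurable (time T)" for k
    using path_coef_integrable[OF assms] by (rule borel_measurable_integrable)
  have 2: "cosine k \<in> borel_measurable (lebesgue_on I)" for k
    using cosine_L2(1) by (simp add: L2_iff)
  show ?thesis
    unfolding series_def split_def
    by (intro borel_measurable_suminf borel_measurable_times measurable_compose[OF measurable_fst 1]
        measurable_compose[OF measurable_snd 2])
qed

text \<open>
  With a jointly measurable version the coefficients are parameter integrals.
\<close>

lemma L2_field_joint:
  assumes m: "\<Phi> \<in> borel_measurable (time T \<Otimes>\<^sub>M lebesgue_on I)"
    and eq: "AE t in time T. AE x in lebesgue_on I. F t x = \<Phi> (t, x)"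
    and L: "AE t in time T. F t \<in> L2 I"
  shows "L2_field T F"
  unfolding L2_field_def
proof (intro conjI L allI)
  fix k
  interpret finite_measure "lebesgue_on I" by (rule finite_measure_lebesgue_on[OF I_lmeasurable])
  have c: "cosine k \<in> borel_measurable (lebesgue_on I)"
    using cosine_L2(1) by (simp add: L2_iff)
  show "(\<lambda>t. coef (F t) k) \<in> borel_measurable (time T)"
  proof (rule time_measurable_AE_cong)
    show "(\<lambda>t. LINT x|lebesgue_on I. \<Phi> (t, x) * cosine k x) \<in> borel_measurable (time T)"
    proof (rule borel_measurable_lebesgue_integral)
      show "(\<lambda>(t, x). \<Phi> (t, x) * cosine k x) \<in> borel_measurable (time T \<Otimes>\<^sub>M lebesgue_on I)"
        unfolding split_def using m by (intro borel_measurable_times measurable_compose[OF measurable_snd c]) simp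
    qed
    have ms: "AE t in time T. (\<lambda>x. \<Phi> (t, x)) \<in> borel_measurable (lebesgue_on I)"
      using measurable_Pair2[OF m] by (intro AE_I2) simp
    show "AE t in time T. (LINT x|lebesgue_on I. \<Phi> (t, x) * cosine k x) = coef (F t) k"
      using eq L ms
    proof eventually_elim
      case (elim t)
      then show ?case
        unfolding coef_def L2_inner_def
        by (intro integral_cong_AE borel_measurable_times c)
          (auto simp: L2_iff elim: eventually_mono)
    qed
  qed
qed

lemma bounded_pathD:
  assumes "bounded_path T y"
  shows "L2_continuous_path T I y" "integrable (time T) (\<lambda>t. (sup_bound (y t))\<^sup>2)"
    "AE t in time T. y t \<in> L2 I \<and> summable (\<lambda>k. \<bar>coef (y t) k\<bar>) \<and> 0 \<le> sup_bound (y t) \<and>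
      (AE x in lebesgue_on I. \<bar>y t x\<bar> \<le> sup_bound (y t)) \<and>
      (AE x in lebesgue_on I. y t x = series y (t, x))"
proof -
  show y: "L2_continuous_path T I y" and "integrable (time T) (\<lambda>t. (sup_bound (y t))\<^sup>2)"
    using assms by (auto simp: bounded_path_def)
  have "AE t in time T. y t \<in> L2 I" using path_L2_field[OF y] by (simp add: L2_field_def)
  moreover have "AE t in time T. summable (\<lambda>k. \<bar>coef (y t) k\<bar>)" using assms by (auto simp: bounded_path_def)
  ultimately show "AE t in time T. y t \<in> L2 I \<and> summable (\<lambda>k. \<bar>coef (y t) k\<bar>) \<and> 0 \<le> sup_bound (y t) \<and>
      (AE x in lebesgue_on I. \<bar>y t x\<bar> \<le> sup_bound (y t)) \<and>
      (AE x in lebesgue_on I. y t x = series y (t, x))"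
    by eventually_elim (use sup_bound sup_bound_nonneg cosine_series(1) in \<open>auto simp: series_def\<close>)
qed

lemma superposition_field:
  assumes y: "bounded_path T y" and q: "bounded_path T q"
    and \<phi>: "(\<lambda>p. \<phi> (fst p) (snd p)) \<in> borel_measurable (borel :: (real \<times> real) measure)"
    and L: "AE t in time T. (\<lambda>x. \<phi> (y t x) (q t x)) \<in> L2 I"
  shows "L2_field T (\<lambda>t x. \<phi> (y t x) (q t x))"
proof (rule L2_field_joint[OF _ _ L])
  have "(\<lambda>p. (series y p, series q p)) \<in> borel_measurable (time T \<Otimes>\<^sub>M lebesgue_on I)"
    by (intro borel_measurable_Pair series_measurable bounded_pathD(1) y q)
  from measurable_compose[OF this \<phi>]
  show "(\<lambda>p. \<phi> (series y p) (series q p)) \<in> borel_measurable (time T \<Otimes>\<^sub>M lebesgue_on I)" by simp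
  show "AE t in time T. AE x in lebesgue_on I. \<phi> (y t x) (q t x) = \<phi> (series y (t, x)) (series q (t, x))"
    using bounded_pathD(3)[OF y] bounded_pathD(3)[OF q]
  proof eventually_elim
    case (elim t)
    then have "AE x in lebesgue_on I. y t x = series y (t, x)" "AE x in lebesgue_on I. q t x = series q (t, x)" by auto
    then show ?case by eventually_elim simp
  qed
qed

lemma L2_field_add:
  assumes "L2_field T F" "L2_field T G" shows "L2_field T (\<lambda>t x. F t x + G t x)"
proof -
  have L: "AE t in time T. F t \<in> L2 I" "AE t in time T. G t \<in> L2 I" using assms by (auto simp: L2_field_def)
  have "(\<lambda>t. coef (\<lambda>x. F t x + G t x) k) \<in> borel_measurable (time T)" for k
  proof (rule time_measurable_AE_cong)
    show "(\<lambda>t. coef (F t) k + coef (G t) k) \<in> borel_measurable (time T)"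
      using assms by (intro borel_measurable_add) (auto simp: L2_field_def)
    show "AE t in time T. coef (F t) k + coef (G t) k = coef (\<lambda>x. F t x + G t x) k"
      using L by eventually_elim (simp add: coef_add)
  qed
  moreover have "AE t in time T. (\<lambda>x. F t x + G t x) \<in> L2 I"
    using L by eventually_elim (rule L2_add)
  ultimately show ?thesis by (simp add: L2_field_def)
qed

lemma L2_field_scale:
  assumes "L2_field T F" shows "L2_field T (\<lambda>t x. a * F t x)"
  using assms unfolding L2_field_def coef_scale
  by (auto intro: L2_scale borel_measurable_times elim: eventually_mono)

lemma L2_field_diff:
  assumes "L2_field T F" "L2_field T G" shows "L2_field T (\<lambda>t x. F t x - G t x)"
  using L2_field_add[OF assms(1) L2_field_scale[OF assms(2), of "- 1"]] by simp

text \<open>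
  The class of the reaction terms: by \<open>\<parallel>f(y t)\<parallel> \<le> C (1 + sup \<bar>y t\<bar>\<^sup>2) \<parallel>y t\<parallel>\<close>, where the supremum is only square
  integrable in \<open>t\<close>, their norm is integrable in time, but in general not square integrable.
\<close>

definition L1_L2_field :: "real \<Rightarrow> (real \<Rightarrow> real \<Rightarrow> real) \<Rightarrow> bool" where
  "L1_L2_field T F \<longleftrightarrow> L2_field T F \<and> integrable (time T) (\<lambda>t. L2_norm I (F t))"

lemma L1_L2_field_dominated:
  assumes F: "L2_field T F" and n: "integrable (time T) n" and le: "AE t in time T. L2_norm I (F t) \<le> n t"
  shows "L1_L2_field T F"
  unfolding L1_L2_field_def
proof (intro conjI F)
  show "integrable (time T) (\<lambda>t. L2_norm I (F t))"
  proof (rule Bochner_Integration.integrable_bound[OF n L2_field_norm_measurable[OF F]])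
    show "AE t in time T. norm (L2_norm I (F t)) \<le> norm (n t)"
      using le by eventually_elim (use L2_norm_nonneg in \<open>auto intro: order_trans\<close>)
  qed
qed

lemma L1_L2_field_add:
  assumes "L1_L2_field T F" "L1_L2_field T G" shows "L1_L2_field T (\<lambda>t x. F t x + G t x)"
proof (rule L1_L2_field_dominated)
  show "L2_field T (\<lambda>t x. F t x + G t x)" using assms by (intro L2_field_add) (auto simp: L1_L2_field_def)
  show "integrable (time T) (\<lambda>t. L2_norm I (F t) + L2_norm I (G t))" using assms by (auto simp: L1_L2_field_def)
  have "AE t in time T. F t \<in> L2 I" "AE t in time T. G t \<in> L2 I"
    using assms by (auto simp: L2_field_def L1_L2_field_def)
  then show "AE t in time T. L2_norm I (\<lambda>x. F t x + G t x) \<le> L2_norm I (F t) + L2_norm I (G t)"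
    by eventually_elim (rule L2_triangle)
qed

lemma L1_L2_field_scale: "L1_L2_field T F \<Longrightarrow> L1_L2_field T (\<lambda>t x. a * F t x)"
  by (simp add: L1_L2_field_def L2_field_scale L2_norm_scale)

lemma L1_L2_field_diff:
  assumes "L1_L2_field T F" "L1_L2_field T G" shows "L1_L2_field T (\<lambda>t x. F t x - G t x)"
  using L1_L2_field_add[OF assms(1) L1_L2_field_scale[OF assms(2), of "- 1"]] by simp

lemma path_L1_L2_field: "L2_continuous_path T I y \<Longrightarrow> L1_L2_field T y"
  by (simp add: L1_L2_field_def path_L2_field integrable_time_continuous path_norm_continuous)

lemma L1_L2_field_L2: "L1_L2_field T F \<Longrightarrow> AE t in time T. F t \<in> L2 I"
  by (simp add: L1_L2_field_def L2_field_def)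

lemma L1_L2_field_coef_integrable:
  assumes "L1_L2_field T F" shows "integrable (time T) (\<lambda>t. coef (F t) k)"
proof (rule Bochner_Integration.integrable_bound)
  show "integrable (time T) (\<lambda>t. L2_norm I (F t))" "(\<lambda>t. coef (F t) k) \<in> borel_measurable (time T)"
    using assms by (auto simp: L1_L2_field_def L2_field_def)
  show "AE t in time T. norm (coef (F t) k) \<le> norm (L2_norm I (F t))"
    using L1_L2_field_L2[OF assms] by eventually_elim (simp add: coef_le_norm L2_norm_nonneg)
qed

end

text \<open>
  Only the one-sided bound \<open>K\<close> of \<open>f'\<close> enters the stability estimate; the growth constant \<open>C\<close> serves
  for integrability and for dominating the linearisation error.
\<close>

locale reaction_diffusion = bounded_interval +
  fixes f f' :: "real \<Rightarrow> real" and C K :: real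
  assumes f_deriv: "(f has_real_derivative f' x) (at x)"
    and f'_continuous: "continuous_on UNIV f'"
    and f_0: "f 0 = 0"
    and f'_growth: "\<bar>f' x\<bar> \<le> C * (1 + x\<^sup>2)"
    and f'_le: "f' x \<le> K"
    and K_nonneg: "0 \<le> K"
begin

lemma C_nonneg: "0 \<le> C"
  using f'_growth[of 0] by simp

lemma f_mean_value:
  obtains \<xi> where "f a - f b = f' \<xi> * (a - b)" "\<bar>\<xi> - b\<bar> \<le> \<bar>a - b\<bar>" "\<xi> \<in> {min a b..max a b}"
proof (cases a b rule: linorder_cases)
  case less
  obtain z where "z > a" "z < b" "f b - f a = (b - a) * f' z"
    using MVT2[OF less, of f f'] f_deriv by blast
  then show thesis by (intro that[of z]) (auto simp: algebra_simps)
next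
  case equal
  then show thesis by (intro that[of a]) auto
next
  case greater
  obtain z where "z > b" "z < a" "f a - f b = (a - b) * f' z"
    using MVT2[OF greater, of f f'] f_deriv by blast
  then show thesis by (intro that[of z]) (auto simp: algebra_simps)
qed

lemma f'_bound: "\<bar>x\<bar> \<le> A \<Longrightarrow> \<bar>f' x\<bar> \<le> C * (1 + A\<^sup>2)"
  using f'_growth[of x] mult_left_mono[OF _ C_nonneg, of "1 + x\<^sup>2" "1 + A\<^sup>2"] abs_le_square_iff[of x A]
  by fastforce

lemma f_lipschitz:
  assumes "\<bar>a\<bar> \<le> A" "\<bar>b\<bar> \<le> A" shows "\<bar>f a - f b\<bar> \<le> C * (1 + A\<^sup>2) * \<bar>a - b\<bar>"
proof -
  obtain \<xi> where \<xi>: "f a - f b = f' \<xi> * (a - b)" "\<xi> \<in> {min a b..max a b}"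
    using f_mean_value[of a b] by metis
  then have "\<bar>\<xi>\<bar> \<le> A" using assms by auto
  then show ?thesis unfolding \<xi>(1) abs_mult by (intro mult_right_mono f'_bound) auto
qed

lemma f_dissipative: "(f a - f b) * (a - b) \<le> K * (a - b)\<^sup>2"
proof -
  obtain \<xi> where "f a - f b = f' \<xi> * (a - b)" using f_mean_value[of a b] by metis
  then have "(f a - f b) * (a - b) = f' \<xi> * (a - b)\<^sup>2" by (simp add: power2_eq_square)
  also have "\<dots> \<le> K * (a - b)\<^sup>2" by (intro mult_right_mono f'_le) simp
  finally show ?thesis .
qed

lemma f_remainder_bound:
  assumes "\<bar>a\<bar> \<le> A" "\<bar>b\<bar> \<le> A"
  shows "\<bar>f a - f b - f' b * (a - b)\<bar> \<le> 2 * C * (1 + A\<^sup>2) * \<bar>a - b\<bar>"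
proof -
  have "\<bar>f' b * (a - b)\<bar> \<le> C * (1 + A\<^sup>2) * \<bar>a - b\<bar>"
    unfolding abs_mult by (intro mult_right_mono f'_bound assms) auto
  then show ?thesis using f_lipschitz[OF assms] by linarith
qed

text \<open>
  Uniform continuity of \<open>f'\<close> on a compact neighbourhood of \<open>[-A, A]\<close>.
\<close>

lemma f_remainder_small:
  assumes "\<eta> > 0"
  obtains \<delta> where "\<delta> > 0" "\<And>a b. \<bar>b\<bar> \<le> A \<Longrightarrow> \<bar>a - b\<bar> \<le> \<delta> \<Longrightarrow> \<bar>f a - f b - f' b * (a - b)\<bar> \<le> \<eta> * \<bar>a - b\<bar>"
proof -
  have "uniformly_continuous_on {- A - 1..A + 1} f'"
    by (intro compact_uniformly_continuous continuous_on_subset[OF f'_continuous]) auto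
  then obtain \<delta> where \<delta>: "\<delta> > 0"
    "\<And>x y. x \<in> {- A - 1..A + 1} \<Longrightarrow> y \<in> {- A - 1..A + 1} \<Longrightarrow> dist y x < \<delta> \<Longrightarrow> dist (f' y) (f' x) < \<eta>"
    unfolding uniformly_continuous_on_def using assms by metis
  show thesis
  proof (rule that[of "min 1 (\<delta> / 2)"])
    fix a b assume b: "\<bar>b\<bar> \<le> A" and ab: "\<bar>a - b\<bar> \<le> min 1 (\<delta> / 2)"
    obtain \<xi> where \<xi>: "f a - f b = f' \<xi> * (a - b)" "\<bar>\<xi> - b\<bar> \<le> \<bar>a - b\<bar>"
      using f_mean_value[of a b] by metis
    have "dist (f' \<xi>) (f' b) < \<eta>" using \<xi>(2) b ab \<delta>(1) by (intro \<delta>(2)) (auto simp: dist_real_def)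
    then have "\<bar>f' \<xi> - f' b\<bar> * \<bar>a - b\<bar> \<le> \<eta> * \<bar>a - b\<bar>"
      by (intro mult_right_mono) (auto simp: dist_real_def)
    then show "\<bar>f a - f b - f' b * (a - b)\<bar> \<le> \<eta> * \<bar>a - b\<bar>"
      unfolding \<xi>(1) abs_mult[symmetric] by (simp add: left_diff_distrib)
  qed (use \<delta> in simp)
qed

lemma f_continuous: "continuous_on A f"
  using f_deriv by (blast intro: DERIV_isCont continuous_at_imp_continuous_on)

lemma f_superposition_measurable:
  "(\<lambda>p::real \<times> real. f (fst p)) \<in> borel_measurable borel"
  "(\<lambda>p::real \<times> real. f' (fst p) * snd p) \<in> borel_measurable borel"
  by (intro borel_measurable_continuous_onI continuous_intros continuous_on_compose2[OF f_continuous[of UNIV]]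
      continuous_on_compose2[OF f'_continuous]; simp)+

lemma superposition_L1_L2_field:
  assumes y: "bounded_path T y" and q: "bounded_path T q"
    and \<phi>: "(\<lambda>p. \<phi> (fst p) (snd p)) \<in> borel_measurable (borel :: (real \<times> real) measure)"
    and le: "\<And>a b A. \<bar>a\<bar> \<le> A \<Longrightarrow> \<bar>\<phi> a b\<bar> \<le> C * (1 + A\<^sup>2) * \<bar>b\<bar>"
  shows "L1_L2_field T (\<lambda>t x. \<phi> (y t x) (q t x))"
proof -
  have b: "AE t in time T. (\<lambda>x. \<phi> (y t x) (q t x)) \<in> L2 I \<and>
      L2_norm I (\<lambda>x. \<phi> (y t x) (q t x)) \<le> C * (1 + (sup_bound (y t))\<^sup>2) * L2_norm I (q t)"
    using bounded_pathD(3)[OF y] bounded_pathD(3)[OF q]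
  proof eventually_elim
    case (elim t)
    then have "(\<lambda>x. (y t x, q t x)) \<in> borel_measurable (lebesgue_on I)"
      by (intro borel_measurable_Pair) (auto simp: L2_iff)
    from measurable_compose[OF this \<phi>]
    have m: "(\<lambda>x. \<phi> (y t x) (q t x)) \<in> borel_measurable (lebesgue_on I)" by simp
    have "AE x in lebesgue_on I. \<bar>\<phi> (y t x) (q t x)\<bar> \<le> C * (1 + (sup_bound (y t))\<^sup>2) * \<bar>q t x\<bar>"
      using elim le by (auto elim!: eventually_mono)
    moreover have "0 \<le> C * (1 + (sup_bound (y t))\<^sup>2)" using C_nonneg by simp
    ultimately show ?case using L2_dominated[OF _ m] elim by blast
  qed
  obtain N where N: "N \<ge> 0" "\<And>t. t \<in> {0..T} \<Longrightarrow> L2_norm I (q t) \<le> N"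
    using path_norm_bounded[OF bounded_pathD(1)[OF q]] by blast
  show ?thesis
  proof (rule L1_L2_field_dominated)
    show "L2_field T (\<lambda>t x. \<phi> (y t x) (q t x))"
      by (rule superposition_field[OF y q \<phi>]) (use b in \<open>auto elim: eventually_mono\<close>)
    show "integrable (time T) (\<lambda>t. C * (1 + (sup_bound (y t))\<^sup>2) * N)"
      using bounded_pathD(2)[OF y] finite_measure.integrable_const[OF finite_measure_time, of 1 T] by auto
    have "AE t in time T. L2_norm I (q t) \<le> N" using N by (intro AE_I2) auto
    with b show "AE t in time T. L2_norm I (\<lambda>x. \<phi> (y t x) (q t x)) \<le> C * (1 + (sup_bound (y t))\<^sup>2) * N"
    proof eventually_elim
      case (elim t)
      then have "C * (1 + (sup_bound (y t))\<^sup>2) * L2_norm I (q t) \<le> C * (1 + (sup_bound (y t))\<^sup>2) * N"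
        using C_nonneg by (intro mult_left_mono) auto
      with elim show ?case by linarith
    qed
  qed
qed

lemma linearized_reaction_field:
  assumes "bounded_path T y" "bounded_path T q"
  shows "L1_L2_field T (\<lambda>t x. f' (y t x) * q t x)"
  by (rule superposition_L1_L2_field[OF assms f_superposition_measurable(2)])
    (auto simp: abs_mult intro: mult_right_mono f'_bound)

lemma reaction_field:
  assumes "bounded_path T y" shows "L1_L2_field T (\<lambda>t x. f (y t x))"
proof -
  \<comment> \<open>\<open>f a = (f a / a) a\<close> with \<open>\<bar>f a / a\<bar> \<le> C (1 + a\<^sup>2)\<close>, as \<open>f 0 = 0\<close>\<close>
  have m: "(\<lambda>p::real \<times> real. f (fst p) / fst p * snd p) \<in> borel_measurable borel"
    by (intro borel_measurable_times borel_measurable_divide f_superposition_measurable(1))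
      (intro borel_measurable_continuous_onI continuous_intros)+
  have "\<bar>f a / a * b\<bar> \<le> C * (1 + A\<^sup>2) * \<bar>b\<bar>" if "\<bar>a\<bar> \<le> A" for a b A
  proof -
    have "\<bar>f a / a\<bar> \<le> C * (1 + A\<^sup>2)"
      using f_lipschitz[of a A 0] that C_nonneg by (cases "a = 0") (auto simp: f_0 divide_simps)
    then show ?thesis unfolding abs_mult by (rule mult_right_mono) simp
  qed
  from superposition_L1_L2_field[OF assms assms m this]
  have "L1_L2_field T (\<lambda>t x. f (y t x) / y t x * y t x)" .
  moreover have "f a / a * a = f a" for a using f_0 by (cases "a = 0") auto
  ultimately show ?thesis by simp
qed

end

section \<open>The derivative of the cost along a path\<close>

context bounded_interval
begin

lemma bounded_path_diff:
  assumes z: "bounded_path T z" and y: "bounded_path T y"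
  shows "bounded_path T (\<lambda>t x. z t x - y t x)"
  unfolding bounded_path_def
proof (intro conjI)
  let ?w = "\<lambda>t x. z t x - y t x"
  show w: "L2_continuous_path T I ?w" by (intro path_diff bounded_pathD(1) z y)
  have le: "AE t in time T. summable (\<lambda>k. \<bar>coef (?w t) k\<bar>) \<and> 0 \<le> sup_bound (?w t) \<and>
      sup_bound (?w t) \<le> sup_bound (z t) + sup_bound (y t)"
    using bounded_pathD(3)[OF z] bounded_pathD(3)[OF y]
  proof eventually_elim
    case (elim t)
    then have sm: "summable (\<lambda>k. \<bar>coef (z t) k\<bar> + \<bar>coef (y t) k\<bar>)" by (intro summable_add) auto
    have c: "\<bar>coef (?w t) k\<bar> \<le> \<bar>coef (z t) k\<bar> + \<bar>coef (y t) k\<bar>" for k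
      using elim by (simp add: coef_diff abs_triangle_ineq4)
    have s: "summable (\<lambda>k. \<bar>coef (?w t) k\<bar>)"
      by (rule summable_comparison_test'[OF sm]) (use c in simp)
    have "sup_bound (?w t) \<le> sup_const * (\<Sum>k. \<bar>coef (z t) k\<bar> + \<bar>coef (y t) k\<bar>)"
      unfolding sup_bound_def by (intro mult_left_mono sup_const_nonneg suminf_le c s sm)
    then show ?case
      using s elim sup_bound_nonneg[OF s] by (simp add: sup_bound_def suminf_add[symmetric] distrib_left)
  qed
  then show s: "AE t in time T. summable (\<lambda>k. \<bar>coef (?w t) k\<bar>)" by eventually_elim simp
  show "integrable (time T) (\<lambda>t. (sup_bound (?w t))\<^sup>2)"
  proof (rule Bochner_Integration.integrable_bound)
    show "integrable (time T) (\<lambda>t. 2 * (sup_bound (z t))\<^sup>2 + 2 * (sup_bound (y t))\<^sup>2)"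
      using bounded_pathD(2)[OF z] bounded_pathD(2)[OF y] by auto
    show "(\<lambda>t. (sup_bound (?w t))\<^sup>2) \<in> borel_measurable (time T)"
      using sup_bound_measurable[OF w s] by (rule borel_measurable_power)
    show "AE t in time T. norm ((sup_bound (?w t))\<^sup>2) \<le> norm (2 * (sup_bound (z t))\<^sup>2 + 2 * (sup_bound (y t))\<^sup>2)"
      using le
    proof eventually_elim
      case (elim t)
      then have "(sup_bound (?w t))\<^sup>2 \<le> (sup_bound (z t) + sup_bound (y t))\<^sup>2" by (intro power_mono) auto
      also have "\<dots> \<le> 2 * (sup_bound (z t))\<^sup>2 + 2 * (sup_bound (y t))\<^sup>2"
        using sum_squares_bound[of "sup_bound (z t)" "sup_bound (y t)"] by (simp add: power2_sum)
      finally show ?case by simp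
    qed
  qed
qed

text \<open>
  Monotone limit of the corresponding bound for the first \<open>m\<close> modes.
\<close>

lemma bounded_path_square_integral_le:
  assumes w: "bounded_path T w"
    and B: "\<And>m. (LINT s|time T. (\<Sum>k<m. (1 + (freq k)\<^sup>2) * (coef (w s) k)\<^sup>2)) \<le> B"
  shows "(LINT s|time T. (sup_bound (w s))\<^sup>2) \<le> sup_const\<^sup>2 * sobolev_const * B"
proof (rule LIMSEQ_le_const2)
  note wp = bounded_pathD(1)[OF w]
  let ?a = "\<lambda>m s. (sup_const * (\<Sum>k<m. \<bar>coef (w s) k\<bar>))\<^sup>2"
  have i: "integrable (time T) (?a m)" for m
    by (intro integrable_time_continuous continuous_intros path_coef_continuous[OF wp])
  show "(\<lambda>m. LINT s|time T. ?a m s) \<longlonglongrightarrow> (LINT s|time T. (sup_bound (w s))\<^sup>2)"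
  proof (rule integral_dominated_convergence[OF _ _ bounded_pathD(2)[OF w]])
    show "(\<lambda>s. (sup_bound (w s))\<^sup>2) \<in> borel_measurable (time T)" using bounded_pathD(2)[OF w] by auto
    show "?a m \<in> borel_measurable (time T)" for m using i by auto
    show "AE s in time T. (\<lambda>m. ?a m s) \<longlonglongrightarrow> (sup_bound (w s))\<^sup>2"
      using bounded_pathD(3)[OF w]
      by eventually_elim (auto simp: sup_bound_def intro!: tendsto_intros summable_LIMSEQ)
    show "AE s in time T. norm (?a m s) \<le> (sup_bound (w s))\<^sup>2" for m
      using bounded_pathD(3)[OF w]
    proof eventually_elim
      case (elim s)
      then have "sup_const * (\<Sum>k<m. \<bar>coef (w s) k\<bar>) \<le> sup_bound (w s)"
        unfolding sup_bound_def by (intro mult_left_mono sup_const_nonneg sum_le_suminf) auto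
      then have "?a m s \<le> (sup_bound (w s))\<^sup>2"
        by (intro power_mono mult_nonneg_nonneg sup_const_nonneg sum_nonneg) auto
      then show ?case by simp
    qed
  qed
  have "(LINT s|time T. ?a m s) \<le> sup_const\<^sup>2 * sobolev_const * B" for m
  proof -
    have ie: "integrable (time T) (\<lambda>s. \<Sum>k<m. (1 + (freq k)\<^sup>2) * (coef (w s) k)\<^sup>2)"
      by (intro integrable_time_continuous continuous_intros path_coef_continuous[OF wp])
    have "(LINT s|time T. ?a m s) \<le>
        (LINT s|time T. sup_const\<^sup>2 * sobolev_const * (\<Sum>k<m. (1 + (freq k)\<^sup>2) * (coef (w s) k)\<^sup>2))"
    proof (rule integral_mono_AE[OF i integrable_mult_right[OF ie]], rule AE_I2)
      fix s
      show "?a m s \<le> sup_const\<^sup>2 * sobolev_const * (\<Sum>k<m. (1 + (freq k)\<^sup>2) * (coef (w s) k)\<^sup>2)"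
        unfolding power_mult_distrib mult.assoc
        by (intro mult_left_mono sum_abs_le_energy[unfolded mult.assoc]) simp
    qed
    also have "\<dots> = sup_const\<^sup>2 * sobolev_const * (LINT s|time T. (\<Sum>k<m. (1 + (freq k)\<^sup>2) * (coef (w s) k)\<^sup>2))"
      by (rule integral_mult_right_zero)
    also have "\<dots> \<le> sup_const\<^sup>2 * sobolev_const * B"
      by (intro mult_left_mono B mult_nonneg_nonneg sobolev_const_nonneg) simp
    finally show ?thesis .
  qed
  then show "\<exists>N. \<forall>m\<ge>N. (LINT s|time T. ?a m s) \<le> sup_const\<^sup>2 * sobolev_const * B" by blast
qed

end

context reaction_diffusion
begin

lemma state_coef:
  assumes y: "bounded_path T y" and H: "AE t in time T. y t \<in> H1 I" and a: "L1_L2_field T a"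
    and eq: "\<And>t v. t \<in> {0..T} \<Longrightarrow> v \<in> H1 I \<Longrightarrow> L2_inner I (y t) v = N t v +
      (LINT s|time t. - L2_inner I (weak_deriv I (y s)) (weak_deriv I v) +
        (LINT x|lebesgue_on I. (f (y s x) + a s x) * v x))"
    and t: "t \<in> {0..T}"
  shows "coef (y t) k = N t (cosine k) +
      (LINT s|time t. - (freq k)\<^sup>2 * coef (y s) k + coef (\<lambda>x. f (y s x) + a s x) k)"
proof -
  have fa: "L1_L2_field T (\<lambda>s x. f (y s x) + a s x)" by (intro L1_L2_field_add reaction_field y a)
  have "(LINT s|time t. - L2_inner I (weak_deriv I (y s)) (weak_deriv I (cosine k)) +
        (LINT x|lebesgue_on I. (f (y s x) + a s x) * cosine k x)) =
      (LINT s|time t. - (freq k)\<^sup>2 * coef (y s) k + coef (\<lambda>x. f (y s x) + a s x) k)"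
  proof (rule integral_cong_AE_time)
    show "(\<lambda>s. - (freq k)\<^sup>2 * coef (y s) k + coef (\<lambda>x. f (y s x) + a s x) k) \<in> borel_measurable (time T)"
      using L1_L2_field_coef_integrable[OF fa] path_coef_integrable[OF bounded_pathD(1)[OF y]]
      by (intro borel_measurable_add borel_measurable_times borel_measurable_const) auto
    show "AE s in time T. - L2_inner I (weak_deriv I (y s)) (weak_deriv I (cosine k)) +
        (LINT x|lebesgue_on I. (f (y s x) + a s x) * cosine k x) =
        - (freq k)\<^sup>2 * coef (y s) k + coef (\<lambda>x. f (y s x) + a s x) k"
      using H by eventually_elim
        (simp add: weak_deriv_inner_weak_deriv_cosine, simp add: coef_def L2_inner_def)
  qed (use t in auto)
  then show ?thesis using eq[OF t cosine_H1] by (simp only: coef_def)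
qed

text \<open>
  The term \<open>N\<close> collects the initial value and the noise. It is common to both equations and cancels.
\<close>

lemma state_difference:
  assumes y: "bounded_path T y" "AE t in time T. y t \<in> H1 I" "L1_L2_field T a"
    "\<And>t v. t \<in> {0..T} \<Longrightarrow> v \<in> H1 I \<Longrightarrow> L2_inner I (y t) v = N t v +
      (LINT s|time t. - L2_inner I (weak_deriv I (y s)) (weak_deriv I v) +
        (LINT x|lebesgue_on I. (f (y s x) + a s x) * v x))"
    and z: "bounded_path T z" "AE t in time T. z t \<in> H1 I" "L1_L2_field T a'"
    "\<And>t v. t \<in> {0..T} \<Longrightarrow> v \<in> H1 I \<Longrightarrow> L2_inner I (z t) v = N t v +
      (LINT s|time t. - L2_inner I (weak_deriv I (z s)) (weak_deriv I v) +
        (LINT x|lebesgue_on I. (f (z s x) + a' s x) * v x))"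
  shows "heat_equation T (\<lambda>t x. z t x - y t x) (\<lambda>s x. (f (z s x) - f (y s x)) + (a' s x - a s x))"
proof -
  let ?F = "\<lambda>s x. (f (z s x) - f (y s x)) + (a' s x - a s x)"
  let ?Fz = "\<lambda>s x. f (z s x) + a' s x" and ?Fy = "\<lambda>s x. f (y s x) + a s x"
  have F: "L1_L2_field T ?F" "L1_L2_field T ?Fz" "L1_L2_field T ?Fy"
    by (intro L1_L2_field_add L1_L2_field_diff reaction_field y z)+
  have wp: "L2_continuous_path T I (\<lambda>t x. z t x - y t x)" by (intro path_diff bounded_pathD(1) y z)
  have "coef (\<lambda>x. z t x - y t x) k =
      (LINT s|time t. - (freq k)\<^sup>2 * coef (\<lambda>x. z s x - y s x) k + coef (?F s) k)"
    if t: "t \<in> {0..T}" for t k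
  proof -
    have tT: "t \<le> T" using t by simp
    let ?\<alpha> = "\<lambda>z F s. - (freq k)\<^sup>2 * coef (z s) k + coef (F s) k"
    have i: "integrable (time T) (?\<alpha> z F)" if "L2_continuous_path T I z" "L1_L2_field T F" for z F
      using that by (intro Bochner_Integration.integrable_add integrable_mult_right
          path_coef_integrable L1_L2_field_coef_integrable)
    have "coef (\<lambda>x. z t x - y t x) k = coef (z t) k - coef (y t) k"
      using path_L2[OF bounded_pathD(1)[OF z(1)] t] path_L2[OF bounded_pathD(1)[OF y(1)] t] by (rule coef_diff)
    also have "\<dots> = (LINT s|time t. ?\<alpha> z ?Fz s) - (LINT s|time t. ?\<alpha> y ?Fy s)"
      using state_coef[OF y t, of k] state_coef[OF z t, of k] by simp
    also have "\<dots> = (LINT s|time t. ?\<alpha> z ?Fz s - ?\<alpha> y ?Fy s)"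
      by (rule Bochner_Integration.integral_diff[symmetric, OF
          integrable_time_mono[OF i[OF bounded_pathD(1)[OF z(1)] F(2)] tT]
          integrable_time_mono[OF i[OF bounded_pathD(1)[OF y(1)] F(3)] tT]])
    also have "\<dots> = (LINT s|time t. ?\<alpha> (\<lambda>t x. z t x - y t x) ?F s)"
    proof (rule integral_cong_AE_time)
      show "?\<alpha> (\<lambda>t x. z t x - y t x) ?F \<in> borel_measurable (time T)"
        by (intro borel_measurable_integrable i wp F)
      show "AE s in time T. ?\<alpha> z ?Fz s - ?\<alpha> y ?Fy s = ?\<alpha> (\<lambda>t x. z t x - y t x) ?F s"
        using L1_L2_field_L2[OF F(2)] L1_L2_field_L2[OF F(3)] bounded_pathD(3)[OF y(1)] bounded_pathD(3)[OF z(1)]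
      proof eventually_elim
        case (elim s)
        have "?F s = (\<lambda>x. ?Fz s x - ?Fy s x)" by auto
        then have "coef (?F s) k = coef (?Fz s) k - coef (?Fy s) k"
          using coef_diff[OF elim(1,2)] by simp
        moreover have "coef (\<lambda>x. z s x - y s x) k = coef (z s) k - coef (y s) k"
          using elim by (intro coef_diff) auto
        ultimately show ?case by algebra
      qed
    qed (use t in auto)
    finally show ?thesis .
  qed
  with wp F(1) show ?thesis unfolding heat_equation_def L1_L2_field_def by blast
qed

text \<open>
  Here \<open>N\<close> is the pairing with the terminal value; the integral over \<open>[t, T]\<close> vanishes at \<open>t = T\<close>.
\<close>

lemma adjoint_backward:
  assumes y: "bounded_path T y" and q: "bounded_path T q" "AE t in time T. q t \<in> H1 I"
    and u: "L1_L2_field T u" and T: "0 \<le> T"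
    and eq: "\<And>t v. t \<in> {0..T} \<Longrightarrow> v \<in> H1 I \<Longrightarrow> L2_inner I (q t) v = N v +
      (LINT s|lebesgue_on {t..T}. - L2_inner I (weak_deriv I (q s)) (weak_deriv I v) +
        (LINT x|lebesgue_on I. (f' (y s x) * q s x + c * (y s x - u s x)) * v x))"
  shows "backward_heat_equation T q (\<lambda>s x. f' (y s x) * q s x + c * (y s x - u s x))"
    and "coef (q T) k = N (cosine k)"
proof -
  let ?G = "\<lambda>s x. f' (y s x) * q s x + c * (y s x - u s x)"
  have G: "L1_L2_field T ?G"
    by (intro L1_L2_field_add L1_L2_field_scale L1_L2_field_diff linearized_reaction_field y q u
        path_L1_L2_field bounded_pathD(1))
  have 1: "coef (q t) k = N (cosine k) + (LINT s|lebesgue_on {t..T}. - (freq k)\<^sup>2 * coef (q s) k + coef (?G s) k)"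
    if t: "t \<in> {0..T}" for t k
  proof -
    have "(LINT s|lebesgue_on {t..T}. - L2_inner I (weak_deriv I (q s)) (weak_deriv I (cosine k)) +
          (LINT x|lebesgue_on I. ?G s x * cosine k x)) =
        (LINT s|lebesgue_on {t..T}. - (freq k)\<^sup>2 * coef (q s) k + coef (?G s) k)"
    proof (rule integral_cong_AE_time)
      show "(\<lambda>s. - (freq k)\<^sup>2 * coef (q s) k + coef (?G s) k) \<in> borel_measurable (time T)"
        using L1_L2_field_coef_integrable[OF G] path_coef_integrable[OF bounded_pathD(1)[OF q(1)]]
        by (intro borel_measurable_add borel_measurable_times borel_measurable_const) auto
      show "AE s in time T. - L2_inner I (weak_deriv I (q s)) (weak_deriv I (cosine k)) +
          (LINT x|lebesgue_on I. ?G s x * cosine k x) = - (freq k)\<^sup>2 * coef (q s) k + coef (?G s) k"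
        using q(2) by eventually_elim
          (simp add: weak_deriv_inner_weak_deriv_cosine, simp add: coef_def L2_inner_def)
    qed (use t in auto)
    then show ?thesis using eq[OF t cosine_H1] by (simp only: coef_def)
  qed
  have T0: "(LINT s|lebesgue_on {T..T}. h s) = 0" for h :: "real \<Rightarrow> real"
    by (rule integral_eq_zero_null_sets) (simp add: null_sets_restrict_space)
  show 2: "coef (q T) k = N (cosine k)" for k using 1[of T k] T T0 by simp
  show "backward_heat_equation T q ?G"
    unfolding backward_heat_equation_def
    using bounded_pathD(1)[OF q(1)] G 1 by (simp add: L1_L2_field_def 2)
qed

text \<open>
  The control enters linearly, so \<open>w\<close> is of the order of the perturbation, uniformly in everything
  but the one-sided bound of \<open>f'\<close>. In particular the constant is the same for all paths.
\<close>

lemma state_lipschitz: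
  assumes w: "heat_equation T (\<lambda>t x. z t x - y t x) (\<lambda>s x. (f (z s x) - f (y s x)) + \<epsilon> * \<beta> s x)"
    and y: "bounded_path T y" and z: "bounded_path T z" and T: "0 \<le> T"
    and \<beta>: "L2_field T \<beta>" "integrable (time T) (\<lambda>t. (L2_norm I (\<beta> t))\<^sup>2)"
  defines "B \<equiv> stability_const K T * (LINT s|time T. (L2_norm I (\<beta> s))\<^sup>2)"
  shows "t \<in> {0..T} \<Longrightarrow> (L2_norm I (\<lambda>x. z t x - y t x))\<^sup>2 \<le> \<epsilon>\<^sup>2 * B"
    and "(LINT s|time T. (sup_bound (\<lambda>x. z s x - y s x))\<^sup>2) \<le> \<epsilon>\<^sup>2 * (sup_const\<^sup>2 * sobolev_const * B)"
proof -
  let ?w = "\<lambda>t x. z t x - y t x"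
  have dissip: "AE s in time T. L2_inner I (\<lambda>x. (f (z s x) - f (y s x)) + \<epsilon> * \<beta> s x) (?w s)
      \<le> K * (L2_norm I (?w s))\<^sup>2 + \<bar>\<epsilon>\<bar> * L2_norm I (\<beta> s) * L2_norm I (?w s)"
    using L1_L2_field_L2[OF reaction_field[OF y]] L1_L2_field_L2[OF reaction_field[OF z]]
      bounded_pathD(3)[OF y] bounded_pathD(3)[OF z] \<beta>(1)[unfolded L2_field_def, THEN conjunct1]
  proof eventually_elim
    case (elim s)
    then have L: "(\<lambda>x. f (z s x) - f (y s x)) \<in> L2 I" "\<beta> s \<in> L2 I" "?w s \<in> L2 I"
      by (auto intro: L2_diff)
    have "L2_inner I (\<lambda>x. f (z s x) - f (y s x)) (?w s) \<le> K * (L2_norm I (?w s))\<^sup>2"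
      by (rule L2_inner_le[OF L(1,3,3)]) (use f_dissipative in simp)
    moreover have "L2_inner I (\<lambda>x. \<epsilon> * \<beta> s x) (?w s) \<le> \<bar>\<epsilon>\<bar> * L2_norm I (\<beta> s) * L2_norm I (?w s)"
      using L2_Cauchy_Schwarz[OF L2_scale[OF L(2), of \<epsilon>] L(3)] by (simp add: L2_norm_scale)
    ultimately show ?case
      using L2_inner_add_left[OF L(1) L2_scale[OF L(2)] L(3), of \<epsilon>] by linarith
  qed
  have n: "integrable (time T) (\<lambda>t. (\<bar>\<epsilon>\<bar> * L2_norm I (\<beta> t))\<^sup>2)"
    using \<beta>(2) by (simp add: power_mult_distrib)
  have eq: "stability_const K T * (LINT s|time T. (\<bar>\<epsilon>\<bar> * L2_norm I (\<beta> s))\<^sup>2) = \<epsilon>\<^sup>2 * B"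
    by (simp add: power_mult_distrib B_def)
  note stab = heat_stability[OF w T K_nonneg n dissip, unfolded eq]
  show "t \<in> {0..T} \<Longrightarrow> (L2_norm I (?w t))\<^sup>2 \<le> \<epsilon>\<^sup>2 * B" by (rule stab(1))
  have "(LINT s|time T. (sup_bound (?w s))\<^sup>2) \<le> sup_const\<^sup>2 * sobolev_const * (\<epsilon>\<^sup>2 * B)"
    by (rule bounded_path_square_integral_le[OF bounded_path_diff[OF z y] stab(2)])
  then show "(LINT s|time T. (sup_bound (?w s))\<^sup>2) \<le> \<epsilon>\<^sup>2 * (sup_const\<^sup>2 * sobolev_const * B)"
    by (simp add: mult_ac)
qed

text \<open>
  The linearisation error. Along \<open>\<epsilon> = 2 ^ -n\<close> the squares of \<open>sup \<bar>w\<bar>\<close> have summable time integrals, so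
  for almost every \<open>t\<close> the perturbation tends to zero uniformly in \<open>x\<close>, with a square integrable
  majorant in \<open>t\<close>; then \<open>f'\<close> is compared on a compact set only.
\<close>

lemma remainder_tendsto_0:
  fixes z :: "nat \<Rightarrow> real \<Rightarrow> real \<Rightarrow> real"
  assumes w: "\<And>n. heat_equation T (\<lambda>t x. z n t x - y t x)
      (\<lambda>s x. (f (z n s x) - f (y s x)) + (1 / 2) ^ n * \<beta> s x)"
    and y: "bounded_path T y" and z: "\<And>n. bounded_path T (z n)" and T: "0 \<le> T"
    and \<beta>: "L2_field T \<beta>" "integrable (time T) (\<lambda>t. (L2_norm I (\<beta> t))\<^sup>2)"
    and q: "L2_continuous_path T I q"
  shows "(\<lambda>n. 2 ^ n * (LINT t|time T. L2_inner I
      (\<lambda>x. (f (z n t x) - f (y t x)) - f' (y t x) * (z n t x - y t x)) (q t))) \<longlonglongrightarrow> 0"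
proof -
  let ?w = "\<lambda>n t x. z n t x - y t x"
  define R where "R n t x = (f (z n t x) - f (y t x)) - f' (y t x) * (z n t x - y t x)" for n t x
  define B where "B = stability_const K T * (LINT s|time T. (L2_norm I (\<beta> s))\<^sup>2)"
  note lip = state_lipschitz[OF w y z T \<beta>, folded B_def]
  have wb: "bounded_path T (?w n)" for n by (intro bounded_path_diff z y)
  have R: "L1_L2_field T (R n)" for n
    unfolding R_def[abs_def] by (intro L1_L2_field_diff reaction_field linearized_reaction_field y z wb)
  define D where "D n t = (sup_bound (?w n t))\<^sup>2" for n t
  define G where "G t = (\<Sum>n. D n t)" for t
  have "summable (\<lambda>n. ((1 / 2 :: real) ^ n)\<^sup>2)"
  proof -
    have "((1 / 2 :: real) ^ n)\<^sup>2 = (1 / 4) ^ n" for n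
      unfolding power2_eq_square power_mult_distrib[symmetric] by simp
    then show ?thesis by (simp add: summable_geometric)
  qed
  then have sm: "summable (\<lambda>n. ((1 / 2 :: real) ^ n)\<^sup>2 * (sup_const\<^sup>2 * sobolev_const * B))"
    by (rule summable_mult2)
  have Di: "integrable (time T) (D n)" for n
    unfolding D_def[abs_def] by (rule bounded_pathD(2)[OF wb])
  have Ds: "AE t in time T. summable (\<lambda>n. D n t)" and Gi: "integrable (time T) G"
    unfolding G_def[abs_def]
    by (rule AE_summable_of_integrals[OF Di _ lip(2)[folded D_def] sm]; simp add: D_def)+
  have B0: "0 \<le> B" using order_trans[OF zero_le_power2 lip(1)[of 0 0]] T by simp
  obtain N where N: "N \<ge> 0" "\<And>t. t \<in> {0..T} \<Longrightarrow> L2_norm I (q t) \<le> N"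
    using path_norm_bounded[OF q] by blast
  \<comment> \<open>the times at which all pointwise bounds hold for all \<open>n\<close> simultaneously\<close>
  have good: "AE t in time T. y t \<in> L2 I \<and> 0 \<le> sup_bound (y t) \<and> (AE x in lebesgue_on I. \<bar>y t x\<bar> \<le> sup_bound (y t)) \<and>
      q t \<in> L2 I \<and> L2_norm I (q t) \<le> N \<and> summable (\<lambda>n. D n t) \<and>
      (\<forall>n. R n t \<in> L2 I \<and> ?w n t \<in> L2 I \<and> 0 \<le> sup_bound (?w n t) \<and>
         (AE x in lebesgue_on I. \<bar>?w n t x\<bar> \<le> sup_bound (?w n t)) \<and> L2_norm I (?w n t) \<le> (1 / 2) ^ n * sqrt B)"
  proof -
    have "AE t in time T. q t \<in> L2 I \<and> L2_norm I (q t) \<le> N"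
      using N(2) path_L2[OF q] by (intro AE_I2) auto
    moreover have "AE t in time T. \<forall>n. ?w n t \<in> L2 I \<and> 0 \<le> sup_bound (?w n t) \<and>
         (AE x in lebesgue_on I. \<bar>?w n t x\<bar> \<le> sup_bound (?w n t))"
      unfolding AE_all_countable using bounded_pathD(3)[OF wb] by (auto elim: eventually_mono)
    moreover have "AE t in time T. \<forall>n. R n t \<in> L2 I"
      unfolding AE_all_countable using L1_L2_field_L2[OF R] by blast
    moreover have "AE t in time T. \<forall>n. L2_norm I (?w n t) \<le> (1 / 2) ^ n * sqrt B"
    proof (intro AE_I2 allI)
      fix t n assume "t \<in> space (time T)"
      then have "(L2_norm I (?w n t))\<^sup>2 \<le> ((1 / 2) ^ n * sqrt B)\<^sup>2"
        using lip(1)[of t n] B0 by (simp add: power_mult_distrib)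
      then show "L2_norm I (?w n t) \<le> (1 / 2) ^ n * sqrt B"
        by (rule power2_le_imp_le) (use B0 in simp)
    qed
    ultimately show ?thesis using bounded_pathD(3)[OF y] Ds by eventually_elim auto
  qed
  \<comment> \<open>a bound \<open>\<bar>R\<bar> \<le> m \<bar>w\<bar>\<close> gains the factor \<open>2 ^ -n\<close> through the norm of \<open>w\<close>\<close>
  have R_norm: "\<bar>2 ^ n * L2_inner I (R n t) (q t)\<bar> \<le> m * (sqrt B * N)"
    if m: "0 \<le> m" and le: "AE x in lebesgue_on I. \<bar>R n t x\<bar> \<le> m * \<bar>?w n t x\<bar>"
      and L: "R n t \<in> L2 I" "?w n t \<in> L2 I" "q t \<in> L2 I"
      and b: "L2_norm I (?w n t) \<le> (1 / 2) ^ n * sqrt B" "L2_norm I (q t) \<le> N" for n t m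
  proof -
    have "L2_norm I (R n t) \<le> m * L2_norm I (?w n t)"
      by (rule L2_dominated(2)[OF L(2) _ m le]) (use L(1) in \<open>simp add: L2_iff\<close>)
    also have "\<dots> \<le> m * ((1 / 2) ^ n * sqrt B)" by (intro mult_left_mono b m)
    finally have "L2_norm I (R n t) * L2_norm I (q t) \<le> m * ((1 / 2) ^ n * sqrt B) * N"
      using b(2) m B0 by (intro mult_mono) (auto simp: L2_norm_nonneg)
    then have "\<bar>L2_inner I (R n t) (q t)\<bar> \<le> m * ((1 / 2) ^ n * sqrt B) * N"
      using L2_Cauchy_Schwarz[OF L(1,3)] by linarith
    then have "2 ^ n * \<bar>L2_inner I (R n t) (q t)\<bar> \<le> 2 ^ n * (m * ((1 / 2) ^ n * sqrt B) * N)"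
      by (intro mult_left_mono) auto
    then show ?thesis by (simp add: abs_mult power_one_over)
  qed
  have "(\<lambda>n. LINT t|time T. 2 ^ n * L2_inner I (R n t) (q t)) \<longlonglongrightarrow> (LINT t|time T. 0)"
  proof (rule integral_dominated_convergence)
    show "(\<lambda>t. 2 ^ n * L2_inner I (R n t) (q t)) \<in> borel_measurable (time T)" for n
      using L2_field_inner_measurable[OF _ path_L2_field[OF q]] R[of n] unfolding L1_L2_field_def
      by (intro borel_measurable_times borel_measurable_const) blast
    show "integrable (time T) (\<lambda>t. (2 * C * (1 + (2 * (sup_bound (y t))\<^sup>2 + 2 * G t))) * (sqrt B * N))"
      using bounded_pathD(2)[OF y] Gi finite_measure.integrable_const[OF finite_measure_time, of 1 T] by auto
    show "AE t in time T. norm (2 ^ n * L2_inner I (R n t) (q t))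
        \<le> (2 * C * (1 + (2 * (sup_bound (y t))\<^sup>2 + 2 * G t))) * (sqrt B * N)" for n
      using good
    proof eventually_elim
      case (elim t)
      have G: "(sup_bound (?w n t))\<^sup>2 \<le> G t"
        using sum_le_suminf[of "\<lambda>n. D n t" "{n}"] elim by (auto simp: D_def G_def)
      then have G0: "0 \<le> G t" by (meson order_trans zero_le_power2)
      let ?A = "sup_bound (y t) + sup_bound (?w n t)"
      have A: "?A\<^sup>2 \<le> 2 * (sup_bound (y t))\<^sup>2 + 2 * G t"
        using sum_squares_bound[of "sup_bound (y t)" "sup_bound (?w n t)"] G by (simp add: power2_sum)
      have w0: "0 \<le> sup_bound (?w n t)" and w1: "AE x in lebesgue_on I. \<bar>?w n t x\<bar> \<le> sup_bound (?w n t)"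
        and y1: "AE x in lebesgue_on I. \<bar>y t x\<bar> \<le> sup_bound (y t)" using elim by auto
      have "AE x in lebesgue_on I. \<bar>R n t x\<bar> \<le> (2 * C * (1 + (2 * (sup_bound (y t))\<^sup>2 + 2 * G t))) * \<bar>?w n t x\<bar>"
        using w1 y1
      proof eventually_elim
        case (elim x)
        then have "\<bar>R n t x\<bar> \<le> 2 * C * (1 + ?A\<^sup>2) * \<bar>?w n t x\<bar>"
          unfolding R_def using w0 by (intro f_remainder_bound) auto
        also have "\<dots> \<le> (2 * C * (1 + (2 * (sup_bound (y t))\<^sup>2 + 2 * G t))) * \<bar>?w n t x\<bar>"
          using A C_nonneg by (intro mult_right_mono mult_left_mono) auto
        finally show ?case .
      qed
      then show ?case
        unfolding real_norm_def using elim C_nonneg G0 by (intro R_norm) auto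
    qed
    show "AE t in time T. (\<lambda>n. 2 ^ n * L2_inner I (R n t) (q t)) \<longlonglongrightarrow> 0"
      using good
    proof eventually_elim
      case (elim t)
      have "(\<lambda>n. D n t) \<longlonglongrightarrow> 0" using elim by (intro summable_LIMSEQ_zero) auto
      show ?case
      proof (rule LIMSEQ_I)
        fix r :: real assume "r > 0"
        define \<eta> where "\<eta> = r / (2 * (sqrt B * N + 1))"
        have BN: "0 \<le> sqrt B * N" using B0 N by simp
        then have \<eta>: "\<eta> > 0" using \<open>r > 0\<close> by (simp add: \<eta>_def)
        have "\<eta> * (sqrt B * N) = r / 2 * (sqrt B * N / (sqrt B * N + 1))" by (simp add: \<eta>_def)
        also have "\<dots> \<le> r / 2 * 1" using BN \<open>r > 0\<close> by (intro mult_left_mono) auto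
        finally have \<eta>r: "\<eta> * (sqrt B * N) < r" using \<open>r > 0\<close> by simp
        obtain \<delta> where \<delta>: "\<delta> > 0"
          "\<And>a b. \<bar>b\<bar> \<le> sup_bound (y t) \<Longrightarrow> \<bar>a - b\<bar> \<le> \<delta> \<Longrightarrow> \<bar>f a - f b - f' b * (a - b)\<bar> \<le> \<eta> * \<bar>a - b\<bar>"
          using f_remainder_small[OF \<eta>, of "sup_bound (y t)"] by metis
        have "\<forall>\<^sub>F n in sequentially. D n t < \<delta>\<^sup>2"
          using \<open>(\<lambda>n. D n t) \<longlonglongrightarrow> 0\<close> \<delta>(1) by (intro order_tendstoD) auto
        then obtain n0 where n0: "\<And>n. n \<ge> n0 \<Longrightarrow> D n t < \<delta>\<^sup>2" by (auto simp: eventually_sequentially)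
        show "\<exists>n0. \<forall>n\<ge>n0. norm (2 ^ n * L2_inner I (R n t) (q t) - 0) < r"
        proof (intro exI allI impI)
          fix n assume "n0 \<le> n"
          then have small: "sup_bound (?w n t) < \<delta>"
            using n0[of n] \<delta>(1) unfolding D_def by (intro power2_less_imp_less[of "sup_bound (?w n t)" \<delta>]) auto
          have w1: "AE x in lebesgue_on I. \<bar>?w n t x\<bar> \<le> sup_bound (?w n t)"
            and y1: "AE x in lebesgue_on I. \<bar>y t x\<bar> \<le> sup_bound (y t)" using elim by auto
          have "AE x in lebesgue_on I. \<bar>R n t x\<bar> \<le> \<eta> * \<bar>?w n t x\<bar>"
            using w1 y1 by eventually_elim (use small in \<open>auto simp: R_def intro!: \<delta>(2)\<close>)
          then have "\<bar>2 ^ n * L2_inner I (R n t) (q t)\<bar> \<le> \<eta> * (sqrt B * N)"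
            using elim \<eta> by (intro R_norm) auto
          with \<eta>r show "norm (2 ^ n * L2_inner I (R n t) (q t) - 0) < r" by simp
        qed
      qed
    qed
  qed simp
  then show ?thesis by (simp add: R_def[abs_def])
qed

text \<open>
  Insert the linearised difference into the duality of \<open>w\<close> and the adjoint state: the terms with
  \<open>f'(y)\<close> cancel, the control contributes \<open>2 ^ -n \<integral> \<langle>\<beta>, q\<rangle>\<close>, and what remains is the linearisation error.
\<close>

theorem pathwise_derivative:
  fixes z :: "nat \<Rightarrow> real \<Rightarrow> real \<Rightarrow> real"
  assumes w: "\<And>n. heat_equation T (\<lambda>t x. z n t x - y t x)
      (\<lambda>s x. (f (z n s x) - f (y s x)) + (1 / 2) ^ n * \<beta> s x)"
    and y: "bounded_path T y" and z: "\<And>n. bounded_path T (z n)" and T: "0 \<le> T"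
    and \<beta>: "L1_L2_field T \<beta>" "integrable (time T) (\<lambda>t. (L2_norm I (\<beta> t))\<^sup>2)"
    and q: "bounded_path T q" and u: "L1_L2_field T u" and v: "v \<in> L2 I"
    and adj: "backward_heat_equation T q (\<lambda>s x. f' (y s x) * q s x + c * (y s x - u s x))"
      "\<And>k. coef (q T) k = d * coef (\<lambda>x. y T x - v x) k"
  shows "(\<lambda>n. 2 ^ n * (c * (LINT t|time T. L2_inner I (\<lambda>x. z n t x - y t x) (\<lambda>x. y t x - u t x)) +
      d * L2_inner I (\<lambda>x. z n T x - y T x) (\<lambda>x. y T x - v x))) \<longlonglongrightarrow> (LINT t|time T. L2_inner I (\<beta> t) (q t))"
proof -
  let ?w = "\<lambda>n t x. z n t x - y t x"
  let ?R = "\<lambda>n t x. (f (z n t x) - f (y t x)) - f' (y t x) * (z n t x - y t x)"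
  have TT: "T \<in> {0..T}" using T by simp
  note yp = bounded_pathD(1)[OF y] and qp = bounded_pathD(1)[OF q]
  have wb: "bounded_path T (?w n)" for n by (intro bounded_path_diff z y)
  note wp = bounded_pathD(1)[OF wb]
  have R: "L1_L2_field T (?R n)" for n
    by (intro L1_L2_field_diff reaction_field linearized_reaction_field y z wb)
  have yu: "L1_L2_field T (\<lambda>t x. y t x - u t x)" by (intro L1_L2_field_diff path_L1_L2_field yp u)
  have inner_int: "integrable (time T) (\<lambda>t. L2_inner I (F t) (p t))"
    if "L1_L2_field T F" "L2_continuous_path T I p" for F p
    using field_path_integrable(3)[OF _ _ that(2)] that(1) unfolding L1_L2_field_def by blast
  have identity: "c * (LINT t|time T. L2_inner I (?w n t) (\<lambda>x. y t x - u t x)) +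
      d * L2_inner I (?w n T) (\<lambda>x. y T x - v x) =
      (1 / 2) ^ n * (LINT t|time T. L2_inner I (\<beta> t) (q t)) + (LINT t|time T. L2_inner I (?R n t) (q t))" for n
  proof -
    let ?F = "\<lambda>s x. (f (z n s x) - f (y s x)) + (1 / 2) ^ n * \<beta> s x"
    let ?G = "\<lambda>s x. f' (y s x) * q s x + c * (y s x - u s x)"
    have yv: "(\<lambda>x. y T x - v x) \<in> L2 I" by (intro L2_diff path_L2[OF yp TT] v)
    have "AE x in lebesgue_on I. q T x = d * (y T x - v x)"
      by (rule coef_eq_imp_AE_eq[OF path_L2[OF qp TT] L2_scale[OF yv]]) (simp add: coef_scale adj(2))
    then have "L2_inner I (q T) (?w n T) = L2_inner I (\<lambda>x. d * (y T x - v x)) (?w n T)"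
      by (rule L2_inner_cong_AE[OF _ path_L2[OF qp TT] L2_scale[OF yv] path_L2[OF wp TT]])
    then have end_time: "L2_inner I (?w n T) (q T) = d * L2_inner I (?w n T) (\<lambda>x. y T x - v x)"
      by (simp only: L2_inner_scale_left L2_inner_commute[of I _ "?w n T"])
    have i: "integrable (time T) (\<lambda>t. L2_inner I (\<beta> t) (q t))" "integrable (time T) (\<lambda>t. L2_inner I (?R n t) (q t))"
      "integrable (time T) (\<lambda>t. L2_inner I (?w n t) (\<lambda>x. y t x - u t x))"
      using inner_int[OF \<beta>(1) qp] inner_int[OF R qp] inner_int[OF yu wp]
      by (simp_all add: L2_inner_commute[of I "\<lambda>x. y _ x - u _ x"])
    have "L2_inner I (?w n T) (q T) = (LINT t|time T. L2_inner I (?F t) (q t) - L2_inner I (?w n t) (?G t))"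
      by (rule heat_duality[OF T w adj(1)])
    also have "\<dots> = (LINT t|time T. (1 / 2) ^ n * L2_inner I (\<beta> t) (q t) + L2_inner I (?R n t) (q t)
        - c * L2_inner I (?w n t) (\<lambda>x. y t x - u t x))"
    proof -
      have "AE t in time T. L2_inner I (?F t) (q t) - L2_inner I (?w n t) (?G t) =
          (1 / 2) ^ n * L2_inner I (\<beta> t) (q t) + L2_inner I (?R n t) (q t) - c * L2_inner I (?w n t) (\<lambda>x. y t x - u t x)"
        using L1_L2_field_L2[OF \<beta>(1)] L1_L2_field_L2[OF R[of n]] L1_L2_field_L2[OF yu]
          bounded_pathD(3)[OF wb[of n]] bounded_pathD(3)[OF q]
          L1_L2_field_L2[OF linearized_reaction_field[OF y q]]
          L1_L2_field_L2[OF linearized_reaction_field[OF y wb[of n]]]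
      proof eventually_elim
        case (elim t)
        then have L: "\<beta> t \<in> L2 I" "?R n t \<in> L2 I" "(\<lambda>x. y t x - u t x) \<in> L2 I" "?w n t \<in> L2 I" "q t \<in> L2 I"
          "(\<lambda>x. f' (y t x) * q t x) \<in> L2 I" "(\<lambda>x. f' (y t x) * ?w n t x) \<in> L2 I" by auto
        have "?F t = (\<lambda>x. (?R n t x + f' (y t x) * ?w n t x) + (1 / 2) ^ n * \<beta> t x)" by auto
        then have 1: "L2_inner I (?F t) (q t) = L2_inner I (?R n t) (q t) +
            L2_inner I (\<lambda>x. f' (y t x) * ?w n t x) (q t) + (1 / 2) ^ n * L2_inner I (\<beta> t) (q t)"
          using L by (simp only: L2_inner_add_left L2_add L2_scale L2_inner_scale_left)
        have 2: "L2_inner I (?G t) (?w n t) = L2_inner I (\<lambda>x. f' (y t x) * q t x) (?w n t) +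
            c * L2_inner I (\<lambda>x. y t x - u t x) (?w n t)"
          using L by (simp only: L2_inner_add_left L2_scale L2_inner_scale_left)
        have 3: "L2_inner I (\<lambda>x. f' (y t x) * ?w n t x) (q t) = L2_inner I (\<lambda>x. f' (y t x) * q t x) (?w n t)"
          by (simp add: L2_inner_def mult_ac)
        show ?case unfolding L2_inner_commute[of I "?w n t"] 1 2 3 by simp
      qed
      moreover have "(\<lambda>t. (1 / 2) ^ n * L2_inner I (\<beta> t) (q t) + L2_inner I (?R n t) (q t)
          - c * L2_inner I (?w n t) (\<lambda>x. y t x - u t x)) \<in> borel_measurable (time T)"
        by (intro borel_measurable_diff borel_measurable_add borel_measurable_times borel_measurable_const
            borel_measurable_integrable i)
      ultimately show ?thesis by (intro integral_cong_AE_time) auto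
    qed
    also have "\<dots> = (1 / 2) ^ n * (LINT t|time T. L2_inner I (\<beta> t) (q t)) + (LINT t|time T. L2_inner I (?R n t) (q t))
        - c * (LINT t|time T. L2_inner I (?w n t) (\<lambda>x. y t x - u t x))"
      using i by simp
    finally show ?thesis using end_time by simp
  qed
  have \<beta>2: "L2_field T \<beta>" using \<beta>(1) by (simp add: L1_L2_field_def)
  have "(\<lambda>n. (LINT t|time T. L2_inner I (\<beta> t) (q t)) + 2 ^ n * (LINT t|time T. L2_inner I (?R n t) (q t)))
      \<longlonglongrightarrow> (LINT t|time T. L2_inner I (\<beta> t) (q t)) + 0"
    by (intro tendsto_add tendsto_const remainder_tendsto_0[OF w y z T \<beta>2 \<beta>(2) qp])
  moreover have "2 ^ n * ((1 / 2) ^ n * a + b) = a + 2 ^ n * b" for n and a b :: real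
    by (simp add: distrib_left power_one_over)
  ultimately show ?thesis unfolding identity by simp
qed

end

section \<open>Controls\<close>

lemma abs_power_le_one_plus_power:
  fixes a :: real
  assumes "k \<le> n" shows "\<bar>a\<bar> ^ k \<le> 1 + \<bar>a\<bar> ^ n"
proof (cases "\<bar>a\<bar> \<le> 1")
  case True
  then have "\<bar>a\<bar> ^ k \<le> 1" by (intro power_le_one) auto
  moreover have "0 \<le> \<bar>a\<bar> ^ n" by simp
  ultimately show ?thesis by linarith
next
  case False
  then have "\<bar>a\<bar> ^ k \<le> \<bar>a\<bar> ^ n" using assms by (intro power_increasing) auto
  then show ?thesis by linarith
qed

lemma Lp_exponent_mono:
  assumes "finite_measure M" "v \<in> Lp n M" "k \<le> n" shows "v \<in> Lp k M"
proof -
  interpret finite_measure M by fact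
  have v: "v \<in> borel_measurable M" "integrable M (\<lambda>x. \<bar>v x\<bar> ^ n)" using assms(2) by (auto simp: Lp_def)
  have "integrable M (\<lambda>x. \<bar>v x\<bar> ^ k)"
    by (rule Bochner_Integration.integrable_bound[of M "\<lambda>x. 1 + \<bar>v x\<bar> ^ n"])
      (use v in \<open>auto simp: order_trans[OF abs_power_le_one_plus_power[OF assms(3)]] intro!: AE_I2\<close>)
  with v show ?thesis by (simp add: Lp_def)
qed

lemma Lp_2_diff:
  assumes "v \<in> Lp 2 M" "w \<in> Lp 2 M" shows "(\<lambda>x. v x - w x) \<in> Lp 2 M"
proof -
  have v: "v \<in> borel_measurable M" "integrable M (\<lambda>x. (v x)\<^sup>2)" and w: "w \<in> borel_measurable M" "integrable M (\<lambda>x. (w x)\<^sup>2)"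
    using assms by (auto simp: Lp_def)
  have le: "(a - b)\<^sup>2 \<le> 2 * a\<^sup>2 + 2 * b\<^sup>2" for a b :: real
    using zero_le_power2[of "a + b"] by (simp add: power2_sum power2_diff)
  have "integrable M (\<lambda>x. (v x - w x)\<^sup>2)"
    by (rule Bochner_Integration.integrable_bound[of M "\<lambda>x. 2 * (v x)\<^sup>2 + 2 * (w x)\<^sup>2"])
      (use v w in \<open>auto intro!: AE_I2 order_trans[OF le]\<close>)
  with v w show ?thesis by (auto simp: Lp_def)
qed

lemma Linf_mult_Lp_2:
  assumes b: "b \<in> Linf M" and v: "v \<in> Lp 2 M" shows "(\<lambda>x. b x * v x) \<in> Lp 2 M"
proof -
  obtain B where B: "AE x in M. \<bar>b x\<bar> \<le> B" and bm: "b \<in> borel_measurable M"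
    using b by (auto simp: Linf_def)
  have vm: "v \<in> borel_measurable M" "integrable M (\<lambda>x. \<bar>v x\<bar> ^ 2)" using v by (auto simp: Lp_def)
  have "integrable M (\<lambda>x. \<bar>b x * v x\<bar> ^ 2)"
  proof (rule Bochner_Integration.integrable_bound[OF integrable_mult_right[OF vm(2)]])
    show "AE x in M. norm (\<bar>b x * v x\<bar> ^ 2) \<le> norm (B\<^sup>2 * \<bar>v x\<bar> ^ 2)"
      using B
    proof eventually_elim
      case (elim x)
      then have "\<bar>b x\<bar>\<^sup>2 * \<bar>v x\<bar>\<^sup>2 \<le> B\<^sup>2 * \<bar>v x\<bar>\<^sup>2" by (intro mult_right_mono power_mono) auto
      then show ?case by (simp add: abs_mult power_mult_distrib)
    qed
  qed (use bm vm in auto)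
  then show ?thesis using bm vm by (auto simp: Lp_def)
qed

text \<open>
  For even \<open>q\<close> the power \<open>a \<mapsto> a ^ q\<close> is convex on the whole line; integrate its convexity inequality.
\<close>

lemma Lp_ball_convex:
  assumes g: "g \<in> Lp q M" "Lp_norm q M g \<le> \<kappa>" and h: "h \<in> Lp q M" "Lp_norm q M h \<le> \<kappa>"
    and q: "even q" "0 < q" and e: "0 \<le> e" "e \<le> 1" and \<kappa>: "0 \<le> \<kappa>"
  shows "(\<lambda>x. g x + e * (h x - g x)) \<in> Lp q M" "Lp_norm q M (\<lambda>x. g x + e * (h x - g x)) \<le> \<kappa>"
proof -
  have gm: "g \<in> borel_measurable M" "integrable M (\<lambda>x. (g x) ^ q)"
    and hm: "h \<in> borel_measurable M" "integrable M (\<lambda>x. (h x) ^ q)"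
    using g h q by (auto simp: Lp_def power_even_abs)
  have "convex_on UNIV (\<lambda>a::real. a ^ q)" by (rule convex_power_even) (rule q)
  from convex_onD[OF this e] have conv: "(g x + e * (h x - g x)) ^ q \<le> (1 - e) * g x ^ q + e * h x ^ q" for x
  proof -
    have "g x + e * (h x - g x) = (1 - e) *\<^sub>R g x + e *\<^sub>R h x" by (simp add: algebra_simps)
    with convex_onD[OF \<open>convex_on UNIV _\<close> e, of "g x" "h x"] show ?thesis by simp
  qed
  have i: "integrable M (\<lambda>x. (1 - e) * g x ^ q + e * h x ^ q)" using gm hm by auto
  have i': "integrable M (\<lambda>x. (g x + e * (h x - g x)) ^ q)"
    by (rule Bochner_Integration.integrable_bound[OF i]) (use gm hm q in \<open>auto simp: power_even_abs zero_le_even_power intro!: AE_I2 order_trans[OF conv]\<close>)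
  with gm hm q show "(\<lambda>x. g x + e * (h x - g x)) \<in> Lp q M" by (auto simp: Lp_def power_even_abs)
  have six: "(LINT x|M. (v x) ^ q) \<le> \<kappa> ^ q" if "v \<in> Lp q M" "Lp_norm q M v \<le> \<kappa>" for v
  proof -
    have "0 \<le> (LINT x|M. \<bar>v x\<bar> ^ q)" by (rule Bochner_Integration.integral_nonneg) simp
    then have "(Lp_norm q M v) ^ q = (LINT x|M. \<bar>v x\<bar> ^ q)" unfolding Lp_norm_def by (intro real_root_pow_pos2 q)
    moreover have "(Lp_norm q M v) ^ q \<le> \<kappa> ^ q"
      using that(2) q by (intro power_mono) (simp_all add: Lp_norm_def)
    ultimately show ?thesis using q by (simp add: power_even_abs)
  qed
  have "(LINT x|M. (g x + e * (h x - g x)) ^ q) \<le> (LINT x|M. (1 - e) * g x ^ q + e * h x ^ q)"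
    by (intro integral_mono i i' conv)
  also have "\<dots> = (1 - e) * (LINT x|M. g x ^ q) + e * (LINT x|M. h x ^ q)" using gm hm by simp
  also have "\<dots> \<le> (1 - e) * \<kappa> ^ q + e * \<kappa> ^ q"
    using six[OF g] six[OF h] e by (intro add_mono mult_left_mono) auto
  finally have "(LINT x|M. \<bar>g x + e * (h x - g x)\<bar> ^ q) \<le> \<kappa> ^ q"
    using q by (simp add: power_even_abs algebra_simps)
  then have "Lp_norm q M (\<lambda>x. g x + e * (h x - g x)) \<le> root q (\<kappa> ^ q)"
    unfolding Lp_norm_def by (rule real_root_le_mono[OF q(2)])
  then show "Lp_norm q M (\<lambda>x. g x + e * (h x - g x)) \<le> \<kappa>" using \<kappa> q by (simp add: real_root_power_cancel)
qed

lemma Lp_norm_scale: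
  assumes "0 < q" shows "Lp_norm q M (\<lambda>x. a * v x) = \<bar>a\<bar> * Lp_norm q M v"
proof -
  have "(LINT x|M. \<bar>a * v x\<bar> ^ q) = \<bar>a\<bar> ^ q * (LINT x|M. \<bar>v x\<bar> ^ q)"
    by (simp add: abs_mult power_mult_distrib)
  moreover have "root q (\<bar>a\<bar> ^ q) = \<bar>a\<bar>" by (rule real_root_power_cancel[OF assms]) simp
  ultimately show ?thesis unfolding Lp_norm_def by (simp only: real_root_mult)
qed

context bounded_interval
begin

text \<open>
  Functions of \<open>(t, x)\<close> are measurable for the completed Lebesgue measure on the plane; Fubini applies
  to a Borel version.
\<close>

lemma Lp_2_field:
  assumes \<phi>: "\<phi> \<in> Lp 2 (time_space T I)"
  shows "L1_L2_field T (\<lambda>t x. \<phi> (t, x))" "integrable (time T) (\<lambda>t. (L2_norm I (\<lambda>x. \<phi> (t, x)))\<^sup>2)"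
proof -
  let ?S = "{0..T} \<times> I"
  have S: "?S \<in> sets lebesgue"
    by (rule sets_completionI_sets) (simp add: lborel_prod[symmetric] pair_measureI)
  have \<phi>': "\<phi> \<in> borel_measurable (lebesgue_on ?S)" "integrable (lebesgue_on ?S) (\<lambda>z. (\<phi> z)\<^sup>2)"
    using \<phi> by (auto simp: Lp_def)
  define \<psi> where "\<psi> z = (if z \<in> ?S then \<phi> z else 0)" for z
  have \<psi>m: "\<psi> \<in> borel_measurable lebesgue"
    unfolding \<psi>_def[abs_def] by (rule borel_measurable_if_I[OF \<phi>'(1) S])
  obtain \<phi>0 where \<phi>0: "\<phi>0 \<in> borel_measurable lborel" and eq: "AE z in lborel. \<psi> z = \<phi>0 z"
    using completion_ex_borel_measurable_real[OF \<psi>m] by blast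
  have "integrable lebesgue (\<lambda>z. indicator ?S z *\<^sub>R (\<phi> z)\<^sup>2)"
    using \<phi>'(2) S by (simp add: integrable_restrict_space)
  moreover have "(\<lambda>z. indicator ?S z *\<^sub>R (\<phi> z)\<^sup>2) = (\<lambda>z. (\<psi> z)\<^sup>2)" by (auto simp: \<psi>_def indicator_def)
  ultimately have "integrable lebesgue (\<lambda>z. (\<psi> z)\<^sup>2)" by simp
  then have "integrable lebesgue (\<lambda>z. (\<phi>0 z)\<^sup>2)"
    by (rule integrable_cong_AE_imp)
      (use \<phi>0 AE_completion[OF eq] in \<open>auto intro: measurable_completion elim: eventually_mono\<close>)
  then have \<phi>0i: "integrable (lborel \<Otimes>\<^sub>M lborel) (\<lambda>z. (\<phi>0 z)\<^sup>2)"
    using \<phi>0 by (simp add: integrable_completion lborel_prod)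
  have to_time: "AE t in time T. P t" if "AE t in lborel. P t" for P :: "real \<Rightarrow> bool"
    using AE_completion[OF that] by (auto simp: AE_restrict_space_iff elim: eventually_mono)
  have to_I: "AE x in lebesgue_on I. P x" if "AE x in lborel. P x" for P :: "real \<Rightarrow> bool"
    using AE_completion[OF that] by (auto simp: AE_restrict_space_iff elim: eventually_mono)
  have "AE t in lborel. AE x in lborel. \<psi> (t, x) = \<phi>0 (t, x)"
    by (rule lborel_pair.AE_pair) (use eq in \<open>simp only: lborel_prod\<close>)
  then have sec: "AE t in time T. AE x in lborel. \<psi> (t, x) = \<phi>0 (t, x)" by (rule to_time)
  have in_t: "AE t in time T. t \<in> {0..T}" by (rule AE_I2) simp
  have \<phi>0m: "\<phi>0 \<in> borel_measurable borel" using \<phi>0 by simp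
  have \<phi>0t: "(\<lambda>x. \<phi>0 (t, x)) \<in> borel_measurable borel" for t
    by (rule measurable_compose[OF _ \<phi>0m]) (intro borel_measurable_continuous_onI continuous_intros)
  have int_t: "AE t in time T. integrable lborel (\<lambda>x. (\<phi>0 (t, x))\<^sup>2)"
    by (rule to_time[OF lborel_pair.AE_integrable_fst'[OF \<phi>0i]])
  have norm_eq: "AE t in time T. (\<lambda>x. \<phi> (t, x)) \<in> L2 I \<and> (AE x in lebesgue_on I. \<phi> (t, x) = \<phi>0 (t, x)) \<and>
      (L2_norm I (\<lambda>x. \<phi> (t, x)))\<^sup>2 = (LINT x|lborel. (\<phi>0 (t, x))\<^sup>2)"
    using sec in_t int_t
  proof eventually_elim
    case (elim t)
    have inI: "AE x in lebesgue_on I. x \<in> I" by (rule AE_I2) simp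
    have e: "AE x in lebesgue_on I. \<phi>0 (t, x) = \<phi> (t, x)"
      using to_I[OF elim(1)] inI by eventually_elim (use elim(2) in \<open>simp add: \<psi>_def\<close>)
    have m0: "(\<lambda>x. \<phi>0 (t, x)) \<in> borel_measurable lebesgue" using \<phi>0t by (intro measurable_completion) simp
    then have m1: "(\<lambda>x. \<phi>0 (t, x)) \<in> borel_measurable (lebesgue_on I)" by (rule measurable_restrict_space1)
    have m2: "(\<lambda>x. \<phi> (t, x)) \<in> borel_measurable (lebesgue_on I)"
      by (rule complete_measure.borel_measurable_AE_cong[OF complete_measure_lebesgue_on m1 e]) simp
    have "integrable lebesgue (\<lambda>x. (\<phi>0 (t, x))\<^sup>2)"
      using elim(3) \<phi>0t by (simp add: integrable_completion)
    then have i0: "integrable (lebesgue_on I) (\<lambda>x. (\<phi>0 (t, x))\<^sup>2)"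
      by (rule integrable_lebesgue_on) simp
    have i1: "integrable (lebesgue_on I) (\<lambda>x. (\<phi> (t, x))\<^sup>2)"
      by (rule integrable_cong_AE_imp[OF i0]) (use m2 e in \<open>auto elim: eventually_mono\<close>)
    have "(LINT x|lebesgue_on I. (\<phi> (t, x))\<^sup>2) = (LINT x|lebesgue_on I. (\<phi>0 (t, x))\<^sup>2)"
      by (rule integral_cong_AE) (use m1 m2 e in \<open>auto elim: eventually_mono\<close>)
    also have "\<dots> = (LINT x|lebesgue. indicator I x *\<^sub>R (\<phi>0 (t, x))\<^sup>2)"
      by (rule integral_restrict_space) simp
    also have "\<dots> = (LINT x|lebesgue. (\<phi>0 (t, x))\<^sup>2)"
    proof (rule integral_cong_AE)
      show "(\<lambda>x. indicator I x *\<^sub>R (\<phi>0 (t, x))\<^sup>2) \<in> borel_measurable lebesgue"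
        using m0 by (intro borel_measurable_scaleR borel_measurable_indicator borel_measurable_power) auto
      show "AE x in lebesgue. indicator I x *\<^sub>R (\<phi>0 (t, x))\<^sup>2 = (\<phi>0 (t, x))\<^sup>2"
        using AE_completion[OF elim(1)] by eventually_elim (auto simp: \<psi>_def indicator_def split: if_splits)
    qed (use m0 in auto)
    also have "\<dots> = (LINT x|lborel. (\<phi>0 (t, x))\<^sup>2)"
      using \<phi>0t by (subst integral_completion) auto
    finally have "(L2_norm I (\<lambda>x. \<phi> (t, x)))\<^sup>2 = (LINT x|lborel. (\<phi>0 (t, x))\<^sup>2)"
      by (simp add: L2_norm_square_integral)
    then show ?case using m2 i1 e by (auto simp: L2_iff elim: eventually_mono)
  qed
  have idI: "(\<lambda>x. x) \<in> borel_measurable (lebesgue_on S)" for S :: "real set"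
    using id_borel_measurable_lebesgue_on[of S] by (simp add: id_def)
  have field: "L2_field T (\<lambda>t x. \<phi> (t, x))"
  proof (rule L2_field_joint)
    have "(\<lambda>p. (fst p, snd p)) \<in> borel_measurable (time T \<Otimes>\<^sub>M lebesgue_on I)"
      by (intro borel_measurable_Pair measurable_compose[OF measurable_fst idI] measurable_compose[OF measurable_snd idI])
    from measurable_compose[OF this \<phi>0m] show "\<phi>0 \<in> borel_measurable (time T \<Otimes>\<^sub>M lebesgue_on I)" by simp
  qed (use norm_eq in \<open>auto elim: eventually_mono\<close>)
  have "integrable lborel (\<lambda>t. LINT x|lborel. (\<phi>0 (t, x))\<^sup>2)" by (rule lborel_pair.integrable_fst'[OF \<phi>0i])
  then have "integrable lebesgue (\<lambda>t. LINT x|lborel. (\<phi>0 (t, x))\<^sup>2)"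
    by (subst integrable_completion) auto
  then have it: "integrable (time T) (\<lambda>t. LINT x|lborel. (\<phi>0 (t, x))\<^sup>2)"
    by (rule integrable_lebesgue_on) simp
  show sq: "integrable (time T) (\<lambda>t. (L2_norm I (\<lambda>x. \<phi> (t, x)))\<^sup>2)"
    by (rule integrable_cong_AE_imp[OF it])
      (use L2_field_norm_measurable[OF field] norm_eq in \<open>auto elim: eventually_mono\<close>)
  show "L1_L2_field T (\<lambda>t x. \<phi> (t, x))"
  proof (rule L1_L2_field_dominated[OF field])
    show "integrable (time T) (\<lambda>t. 1 + (L2_norm I (\<lambda>x. \<phi> (t, x)))\<^sup>2)"
      using sq finite_measure.integrable_const[OF finite_measure_time, of 1 T] by auto
    have "a \<le> 1 + a\<^sup>2" for a :: real
    proof -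
      have "2 * a \<le> 1 + a\<^sup>2" using sum_squares_bound[of 1 a] by simp
      then show ?thesis using zero_le_power2[of a] by linarith
    qed
    then show "AE t in time T. L2_norm I (\<lambda>x. \<phi> (t, x)) \<le> 1 + (L2_norm I (\<lambda>x. \<phi> (t, x)))\<^sup>2" by simp
  qed
qed

end

section \<open>Processes\<close>

text \<open>
  The usual conditions put all subsets of null sets into the initial sigma-algebra.
\<close>

lemma complete_measure_usual_filtration:
  assumes "usual_filtration T M F" "0 \<le> T" shows "complete_measure M"
proof
  fix A B assume "B \<subseteq> A" "A \<in> null_sets M"
  then have "B \<in> sets (F 0)" using assms by (auto simp: usual_filtration_def)
  moreover have "sets (F 0) \<subseteq> sets M" using assms by (auto simp: usual_filtration_def subalgebra_def)
  ultimately show "B \<in> sets M" by blast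
qed

context bounded_interval
begin

text \<open>
  A process with continuous paths is the limit of its values at the grid times \<open>\<lfloor>n t\<rfloor> / n\<close>, which makes
  its coefficients jointly measurable in time and chance, up to a null set of paths.
\<close>

lemma process_norm_measurable:
  assumes M: "complete_measure M"
    and u: "\<And>t k. t \<in> {0..T} \<Longrightarrow> (\<lambda>\<omega>. coef (u t \<omega>) k) \<in> borel_measurable M"
    and paths: "AE \<omega> in M. L2_continuous_path T I (\<lambda>t. u t \<omega>)" and v: "L2_field T v"
  shows "(\<lambda>\<omega>. LINT t|time T. (L2_norm I (\<lambda>x. u t \<omega> x - v t x))\<^sup>2) \<in> borel_measurable M"
proof -
  define grid :: "nat \<Rightarrow> real \<Rightarrow> nat" where "grid n t = nat \<lfloor>real (Suc n) * t\<rfloor>" for n t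
  define cn where "cn k n = (\<lambda>(\<omega>, t). coef (u (real (grid n t) / real (Suc n)) \<omega>) k)" for k n
  have grid: "0 \<le> real (grid n t) / real (Suc n)" "real (grid n t) / real (Suc n) \<le> t"
    "t - 1 / real (Suc n) \<le> real (grid n t) / real (Suc n)" if "0 \<le> t" for n t
  proof -
    have fl: "real (grid n t) = of_int \<lfloor>real (Suc n) * t\<rfloor>" using that by (simp add: grid_def)
    show "0 \<le> real (grid n t) / real (Suc n)" by simp
    have "real (grid n t) \<le> real (Suc n) * t" "real (Suc n) * t - 1 \<le> real (grid n t)"
      unfolding fl by linarith+
    from divide_right_mono[OF this(1), of "real (Suc n)"] divide_right_mono[OF this(2), of "real (Suc n)"]
    show "real (grid n t) / real (Suc n) \<le> t" "t - 1 / real (Suc n) \<le> real (grid n t) / real (Suc n)"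
      by (simp_all add: diff_divide_distrib del: of_nat_Suc)
  qed
  have idt: "(\<lambda>x. x) \<in> borel_measurable (time T)"
    using id_borel_measurable_lebesgue_on[of "{0..T}"] by (simp add: id_def)
  \<comment> \<open>at the grid times in \<open>[0,T]\<close>, countably many random variables are glued together\<close>
  have cn_m: "cn k n \<in> borel_measurable (M \<Otimes>\<^sub>M time T)" for k n
  proof -
    let ?J = "{i::nat. real i / real (Suc n) \<le> T}"
    have "(\<lambda>p. (\<lambda>i p. coef (u (real i / real (Suc n)) (fst p)) k) (grid n (snd p)) p) \<in> borel_measurable (M \<Otimes>\<^sub>M time T)"
    proof (rule measurable_compose_countable'[where I = ?J and g = "\<lambda>p. grid n (snd p)"
          and f = "\<lambda>i p. coef (u (real i / real (Suc n)) (fst p)) k"])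
      show "(\<lambda>p. coef (u (real i / real (Suc n)) (fst p)) k) \<in> borel_measurable (M \<Otimes>\<^sub>M time T)" if "i \<in> ?J" for i
        using that by (intro measurable_compose[OF measurable_fst u]) auto
      have "(\<lambda>t. grid n t) \<in> measurable (time T) (count_space UNIV)"
        unfolding grid_def using idt by measurable
      then have "(\<lambda>p. grid n (snd p)) \<in> measurable (M \<Otimes>\<^sub>M time T) (count_space UNIV)"
        by (rule measurable_compose[OF measurable_snd])
      then have "(\<lambda>p. grid n (snd p)) -` {i} \<inter> space (M \<Otimes>\<^sub>M time T) \<in> sets (M \<Otimes>\<^sub>M time T)" for i
        by (rule measurable_sets) simp
      moreover have "(\<lambda>p. grid n (snd p)) \<in> space (M \<Otimes>\<^sub>M time T) \<rightarrow> ?J"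
        using grid(2)[of _ n] by (fastforce simp: space_pair_measure)
      ultimately show "(\<lambda>p. grid n (snd p)) \<in> measurable (M \<Otimes>\<^sub>M time T) (count_space ?J)"
        by (simp add: measurable_count_space_eq2_countable)
    qed auto
    then show ?thesis by (simp add: cn_def split_def)
  qed
  define c where "c k p = lim (\<lambda>n. cn k n p)" for k p
  have c_m: "c k \<in> borel_measurable (M \<Otimes>\<^sub>M time T)" for k
    unfolding c_def[abs_def] by (rule borel_measurable_lim_metric[OF cn_m])
  have c_eq: "c k (\<omega>, t) = coef (u t \<omega>) k" if p: "L2_continuous_path T I (\<lambda>t. u t \<omega>)" and t: "t \<in> {0..T}" for k \<omega> t
  proof -
    have lim: "(\<lambda>n. real (grid n t) / real (Suc n)) \<longlonglongrightarrow> t"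
    proof (rule tendsto_sandwich[where f = "\<lambda>n. t - 1 / real (Suc n)" and h = "\<lambda>_. t"])
      show "(\<lambda>n. t - 1 / real (Suc n)) \<longlonglongrightarrow> t"
        using tendsto_diff[OF tendsto_const[of t] LIMSEQ_Suc[OF lim_1_over_n]] by simp
    qed (use grid t in auto)
    have "continuous_on {0..T} (\<lambda>t. coef (u t \<omega>) k)" by (rule path_coef_continuous[OF p])
    moreover have "real (grid n t) / real (Suc n) \<in> {0..T}" for n
      using grid(1,2)[of t n] t unfolding atLeastAtMost_iff by linarith
    ultimately have "(\<lambda>n. coef (u (real (grid n t) / real (Suc n)) \<omega>) k) \<longlonglongrightarrow> coef (u t \<omega>) k"
      by (intro continuous_on_tendsto_compose[OF _ lim t] eventuallyI)
    then show ?thesis unfolding c_def cn_def by (simp add: limI)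
  qed
  have v_m: "(\<lambda>t. coef (v t) k) \<in> borel_measurable (time T)" for k using v by (simp add: L2_field_def)
  define S where "S p = (\<Sum>k. (c k p - coef (v (snd p)) k)\<^sup>2)" for p
  have S_m: "S \<in> borel_measurable (M \<Otimes>\<^sub>M time T)"
    unfolding S_def[abs_def]
    by (intro borel_measurable_suminf borel_measurable_power borel_measurable_diff c_m
        measurable_compose[OF measurable_snd v_m])
  interpret finite_measure "time T" by (rule finite_measure_time)
  show ?thesis
  proof (rule complete_measure.borel_measurable_AE_cong[OF M])
    show "(\<lambda>\<omega>. LINT t|time T. S (\<omega>, t)) \<in> borel_measurable M"
      by (rule borel_measurable_lebesgue_integral) (use S_m in simp)
    show "AE \<omega> in M. (LINT t|time T. S (\<omega>, t)) = (LINT t|time T. (L2_norm I (\<lambda>x. u t \<omega> x - v t x))\<^sup>2)"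
      using paths
    proof eventually_elim
      case (elim \<omega>)
      have "AE t in time T. v t \<in> L2 I" "AE t in time T. t \<in> {0..T}"
        using v by (auto simp: L2_field_def intro: AE_I2)
      then have eq: "AE t in time T. S (\<omega>, t) = (L2_norm I (\<lambda>x. u t \<omega> x - v t x))\<^sup>2"
      proof eventually_elim
        case (elim t)
        have uL: "u t \<omega> \<in> L2 I" by (rule path_L2[OF \<open>L2_continuous_path T I (\<lambda>t. u t \<omega>)\<close> elim(2)])
        show ?case
          using coef_Parseval_norm(1)[OF L2_diff[OF uL elim(1)]]
          by (simp add: S_def c_eq[OF \<open>L2_continuous_path T I (\<lambda>t. u t \<omega>)\<close> elim(2)] coef_diff[OF uL elim(1)] sums_iff)
      qed
      have "(\<lambda>t. (L2_norm I (\<lambda>x. u t \<omega> x - v t x))\<^sup>2) \<in> borel_measurable (time T)"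
        by (intro borel_measurable_power L2_field_norm_measurable L2_field_diff path_L2_field elim v)
      from integral_cong_AE_time[OF this eq, of 0 T] show ?case by simp
    qed
  qed
qed

lemma random_variable_norm_measurable:
  assumes M: "complete_measure M" and X: "\<And>k. (\<lambda>\<omega>. coef (X \<omega>) k) \<in> borel_measurable M"
    and L: "AE \<omega> in M. X \<omega> \<in> L2 I" and v: "v \<in> L2 I"
  shows "(\<lambda>\<omega>. (L2_norm I (\<lambda>x. X \<omega> x - v x))\<^sup>2) \<in> borel_measurable M"
proof (rule complete_measure.borel_measurable_AE_LIMSEQ[OF M])
  show "(\<lambda>\<omega>. \<Sum>k<n. (coef (X \<omega>) k - coef v k)\<^sup>2) \<in> borel_measurable M" for n
    using X by (intro borel_measurable_sum borel_measurable_power borel_measurable_diff) auto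
  show "AE \<omega> in M. (\<lambda>n. \<Sum>k<n. (coef (X \<omega>) k - coef v k)\<^sup>2) \<longlonglongrightarrow> (L2_norm I (\<lambda>x. X \<omega> x - v x))\<^sup>2"
    using L
  proof eventually_elim
    case (elim \<omega>)
    from coef_Parseval_norm(1)[OF L2_diff[OF elim v]] show ?case
      by (simp add: coef_diff[OF elim v] sums_def)
  qed
qed

text \<open>
  The absolute value of \<open>U\<close> is taken because the supremum of a path that is not continuous, and may
  be unbounded, is unspecified.
\<close>

lemma state_space_paths:
  assumes M: "prob_space M" and F: "usual_filtration T M F" and T: "0 \<le> T" and u: "u \<in> state_space T I M F"
  defines "U \<equiv> \<lambda>\<omega>. SUP t\<in>{0..T}. L2_norm I (u t \<omega>)"
  shows "t \<in> {0..T} \<Longrightarrow> (\<lambda>\<omega>. coef (u t \<omega>) k) \<in> borel_measurable M"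
    and "AE \<omega> in M. bounded_path T (\<lambda>t. u t \<omega>) \<and> (AE t in time T. u t \<omega> \<in> H1 I) \<and>
      (\<forall>t\<in>{0..T}. L2_norm I (u t \<omega>) \<le> \<bar>U \<omega>\<bar>)"
    and "integrable M (\<lambda>\<omega>. \<bar>U \<omega>\<bar>)" "integrable M (\<lambda>\<omega>. (U \<omega>)\<^sup>2)"
proof -
  interpret prob_space M by fact
  interpret finite_measure "time T" by (rule finite_measure_time)
  interpret pair_sigma_finite "time T" M ..
  have ad: "adapted_L2 T I F u" and c: "AE \<omega> in M. L2_continuous_path T I (\<lambda>t. u t \<omega>)"
    and U6: "integrable M (\<lambda>\<omega>. U \<omega> ^ 6)" and H: "AE (t, \<omega>) in time T \<Otimes>\<^sub>M M. u t \<omega> \<in> H1 I"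
    and Hn: "integrable (completion (time T \<Otimes>\<^sub>M M)) (\<lambda>(t, \<omega>). (H1_norm I (u t \<omega>))\<^sup>2)"
    using u by (auto simp: state_space_def U_def)
  show "(\<lambda>\<omega>. coef (u t \<omega>) k) \<in> borel_measurable M" if t: "t \<in> {0..T}" for t k
  proof (rule measurable_from_subalg)
    show "subalgebra M (F t)" using F t by (auto simp: usual_filtration_def)
    show "(\<lambda>\<omega>. coef (u t \<omega>) k) \<in> borel_measurable (F t)"
      using ad t cosine_L2(1) unfolding adapted_L2_def L2_measurable_def coef_def by blast
  qed
  have "AE \<omega> in M. AE t in time T. u t \<omega> \<in> H1 I"
    using AE_pair_swapped[OF H] by simp
  moreover have "AE \<omega> in M. integrable (time T) (\<lambda>t. (H1_norm I (u t \<omega>))\<^sup>2)"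
    using AE_integrable_completion[OF Hn complete_time] by simp
  ultimately show "AE \<omega> in M. bounded_path T (\<lambda>t. u t \<omega>) \<and> (AE t in time T. u t \<omega> \<in> H1 I) \<and>
      (\<forall>t\<in>{0..T}. L2_norm I (u t \<omega>) \<le> \<bar>U \<omega>\<bar>)"
    using c
  proof eventually_elim
    case (elim \<omega>)
    obtain N where N: "\<And>t. t \<in> {0..T} \<Longrightarrow> L2_norm I (u t \<omega>) \<le> N"
      using path_norm_bounded[OF elim(3)] by blast
    have "bdd_above ((\<lambda>t. L2_norm I (u t \<omega>)) ` {0..T})" by (rule bdd_aboveI2[OF N])
    then have "L2_norm I (u t \<omega>) \<le> U \<omega>" if "t \<in> {0..T}" for t
      unfolding U_def by (rule cSUP_upper[OF that])
    then have "\<forall>t\<in>{0..T}. L2_norm I (u t \<omega>) \<le> \<bar>U \<omega>\<bar>" by (meson abs_ge_self order_trans)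
    with H1_path_bounded[OF elim(3,1,2)] elim(1) show ?case by blast
  qed
  have Um: "(\<lambda>\<omega>. \<bar>U \<omega>\<bar>) \<in> borel_measurable M"
  proof -
    have "(\<lambda>\<omega>. root 6 (U \<omega> ^ 6)) \<in> borel_measurable M"
      using U6 by (intro measurable_compose[OF borel_measurable_integrable borel_measurable_root])
    moreover have "root 6 (U \<omega> ^ 6) = \<bar>U \<omega>\<bar>" for \<omega>
      using real_root_power_cancel[of 6 "\<bar>U \<omega>\<bar>"] by (simp add: power_even_abs)
    ultimately show ?thesis by simp
  qed
  have i: "integrable M (\<lambda>\<omega>. 1 + U \<omega> ^ 6)" using U6 by simp
  have pow: "\<bar>a\<bar> \<le> 1 + a ^ 6" "a\<^sup>2 \<le> 1 + a ^ 6" for a :: real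
    using abs_power_le_one_plus_power[of 1 6 a] abs_power_le_one_plus_power[of 2 6 a] by (simp_all add: power_even_abs)
  show "integrable M (\<lambda>\<omega>. \<bar>U \<omega>\<bar>)"
    by (rule Bochner_Integration.integrable_bound[OF i Um]) (use pow in \<open>auto intro!: AE_I2 order_trans[OF pow(1)]\<close>)
  have "(\<lambda>\<omega>. (U \<omega>)\<^sup>2) \<in> borel_measurable M" using borel_measurable_power[OF Um, of 2] by simp
  then show "integrable M (\<lambda>\<omega>. (U \<omega>)\<^sup>2)"
    by (rule Bochner_Integration.integrable_bound[OF i]) (use pow in \<open>auto intro!: AE_I2 order_trans[OF pow(2)]\<close>)
qed

end

section \<open>The cost along a path\<close>

context bounded_interval
begin

definition path_cost :: "real \<Rightarrow> real \<Rightarrow> real \<Rightarrow> (real \<Rightarrow> real \<Rightarrow> real) \<Rightarrow> (real \<Rightarrow> real)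
    \<Rightarrow> (real \<Rightarrow> real \<Rightarrow> real) \<Rightarrow> real" where
  "path_cost T c d u v y = c / 2 * (LINT t|time T. (L2_norm I (\<lambda>x. y t x - u t x))\<^sup>2) +
     d / 2 * (L2_norm I (\<lambda>x. y T x - v x))\<^sup>2"

lemma path_cost_increment:
  assumes y: "L2_continuous_path T I y" and z: "L2_continuous_path T I z" and T: "0 \<le> T"
    and u: "L1_L2_field T u" "integrable (time T) (\<lambda>t. (L2_norm I (u t))\<^sup>2)" and v: "v \<in> L2 I"
  shows "path_cost T c d u v z - path_cost T c d u v y =
      (c * (LINT t|time T. L2_inner I (\<lambda>x. z t x - y t x) (\<lambda>x. y t x - u t x)) +
       d * L2_inner I (\<lambda>x. z T x - y T x) (\<lambda>x. y T x - v x)) +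
      (c / 2 * (LINT t|time T. (L2_norm I (\<lambda>x. z t x - y t x))\<^sup>2) + d / 2 * (L2_norm I (\<lambda>x. z T x - y T x))\<^sup>2)"
proof -
  have TT: "T \<in> {0..T}" using T by simp
  have w: "L2_continuous_path T I (\<lambda>t x. z t x - y t x)" by (intro path_diff y z)
  have expand: "(L2_norm I (\<lambda>x. a x - m x))\<^sup>2 = (L2_norm I (\<lambda>x. a' x - m x))\<^sup>2 +
      2 * L2_inner I (\<lambda>x. a x - a' x) (\<lambda>x. a' x - m x) + (L2_norm I (\<lambda>x. a x - a' x))\<^sup>2"
    if "a \<in> L2 I" "a' \<in> L2 I" "m \<in> L2 I" for a a' m
    using L2_norm_square_add[OF L2_diff[OF that(2,3)] L2_diff[OF that(1,2)]]
      L2_inner_commute[of I "\<lambda>x. a' x - m x"] by simp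
  have yu: "L1_L2_field T (\<lambda>t x. y t x - u t x)" by (intro L1_L2_field_diff path_L1_L2_field y u)
  have sq: "integrable (time T) (\<lambda>t. (L2_norm I (\<lambda>x. p t x - u t x))\<^sup>2)" if p: "L2_continuous_path T I p" for p
  proof (rule Bochner_Integration.integrable_bound)
    show "integrable (time T) (\<lambda>t. 2 * (L2_norm I (p t))\<^sup>2 + 2 * (L2_norm I (u t))\<^sup>2)"
      using u(2) integrable_time_continuous[OF continuous_on_power[OF path_norm_continuous[OF p], of 2]] by simp
    have "L1_L2_field T (\<lambda>t x. p t x - u t x)" by (intro L1_L2_field_diff path_L1_L2_field p u)
    then show "(\<lambda>t. (L2_norm I (\<lambda>x. p t x - u t x))\<^sup>2) \<in> borel_measurable (time T)"
      unfolding L1_L2_field_def by (intro borel_measurable_power L2_field_norm_measurable) blast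
    show "AE t in time T. norm ((L2_norm I (\<lambda>x. p t x - u t x))\<^sup>2) \<le> norm (2 * (L2_norm I (p t))\<^sup>2 + 2 * (L2_norm I (u t))\<^sup>2)"
      using L1_L2_field_L2[OF u(1)] L1_L2_field_L2[OF path_L1_L2_field[OF p]]
      by eventually_elim (use L2_norm_square_diff_le in auto)
  qed
  have i: "integrable (time T) (\<lambda>t. L2_inner I (\<lambda>x. z t x - y t x) (\<lambda>x. y t x - u t x))"
    using field_path_integrable(3)[OF _ _ w, of "\<lambda>t x. y t x - u t x"] yu
    by (simp add: L1_L2_field_def L2_inner_commute[of I "\<lambda>x. y _ x - u _ x"])
  have iw: "integrable (time T) (\<lambda>t. (L2_norm I (\<lambda>x. z t x - y t x))\<^sup>2)"
    by (intro integrable_time_continuous continuous_intros path_norm_continuous[OF w])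
  have "(LINT t|time T. (L2_norm I (\<lambda>x. z t x - u t x))\<^sup>2) =
      (LINT t|time T. (L2_norm I (\<lambda>x. y t x - u t x))\<^sup>2 +
        2 * L2_inner I (\<lambda>x. z t x - y t x) (\<lambda>x. y t x - u t x) + (L2_norm I (\<lambda>x. z t x - y t x))\<^sup>2)"
  proof (rule integral_cong_AE_time)
    show "AE t in time T. (L2_norm I (\<lambda>x. z t x - u t x))\<^sup>2 = (L2_norm I (\<lambda>x. y t x - u t x))\<^sup>2 +
        2 * L2_inner I (\<lambda>x. z t x - y t x) (\<lambda>x. y t x - u t x) + (L2_norm I (\<lambda>x. z t x - y t x))\<^sup>2"
      using L1_L2_field_L2[OF u(1)] L1_L2_field_L2[OF path_L1_L2_field[OF y]] L1_L2_field_L2[OF path_L1_L2_field[OF z]]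
      by eventually_elim (rule expand)
  qed (use sq[OF y] i iw in auto)
  also have "\<dots> = (LINT t|time T. (L2_norm I (\<lambda>x. y t x - u t x))\<^sup>2) +
      2 * (LINT t|time T. L2_inner I (\<lambda>x. z t x - y t x) (\<lambda>x. y t x - u t x)) +
      (LINT t|time T. (L2_norm I (\<lambda>x. z t x - y t x))\<^sup>2)"
    using sq[OF y] i iw by simp
  finally have 1: "(LINT t|time T. (L2_norm I (\<lambda>x. z t x - u t x))\<^sup>2) = \<dots>" .
  show ?thesis
    unfolding path_cost_def 1 expand[OF path_L2[OF z TT] path_L2[OF y TT] v] by (simp add: algebra_simps)
qed

text \<open>
  The two parts of the increment are of first and of second order in the perturbation. Divided by \<open>\<epsilon>\<close>,
  the first stays below a multiple of \<open>1 + U\<close> and the second tends to zero.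
\<close>

lemma path_cost_increment_le:
  assumes y: "L2_continuous_path T I y" and z: "L2_continuous_path T I z" and T: "0 \<le> T"
    and u: "L1_L2_field T u" "integrable (time T) (\<lambda>t. (L2_norm I (u t))\<^sup>2)" and v: "v \<in> L2 I"
    and c: "0 \<le> c" "0 \<le> d" and e: "0 \<le> \<epsilon>" and b: "0 \<le> b"
    and w: "\<And>t. t \<in> {0..T} \<Longrightarrow> L2_norm I (\<lambda>x. z t x - y t x) \<le> \<epsilon> * b"
    and U: "\<And>t. t \<in> {0..T} \<Longrightarrow> L2_norm I (y t) \<le> U"
  shows "\<bar>c * (LINT t|time T. L2_inner I (\<lambda>x. z t x - y t x) (\<lambda>x. y t x - u t x)) +
       d * L2_inner I (\<lambda>x. z T x - y T x) (\<lambda>x. y T x - v x)\<bar>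
      \<le> \<epsilon> * (b * (c * (T * U + (LINT t|time T. L2_norm I (u t))) + d * (U + L2_norm I v)))"
    and "\<bar>c / 2 * (LINT t|time T. (L2_norm I (\<lambda>x. z t x - y t x))\<^sup>2) + d / 2 * (L2_norm I (\<lambda>x. z T x - y T x))\<^sup>2\<bar>
      \<le> \<epsilon>\<^sup>2 * (b\<^sup>2 * (c * T + d))"
proof -
  have TT: "T \<in> {0..T}" using T by simp
  have wp: "L2_continuous_path T I (\<lambda>t x. z t x - y t x)" by (intro path_diff y z)
  have yu: "L1_L2_field T (\<lambda>t x. y t x - u t x)" by (intro L1_L2_field_diff path_L1_L2_field y u)
  have cs: "\<bar>L2_inner I (\<lambda>x. z t x - y t x) (\<lambda>x. y t x - m x)\<bar> \<le> \<epsilon> * b * (U + L2_norm I m)"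
    if t: "t \<in> {0..T}" and m: "m \<in> L2 I" for t m
  proof -
    have "L2_norm I (\<lambda>x. y t x - m x) \<le> L2_norm I (y t) + L2_norm I m"
      by (rule L2_triangle_minus[OF path_L2[OF y t] m])
    then have "L2_norm I (\<lambda>x. y t x - m x) \<le> U + L2_norm I m" using U[OF t] by linarith
    then have "L2_norm I (\<lambda>x. z t x - y t x) * L2_norm I (\<lambda>x. y t x - m x) \<le> \<epsilon> * b * (U + L2_norm I m)"
      using w[OF t] e b by (intro mult_mono) (auto simp: L2_norm_nonneg)
    then show ?thesis
      using L2_Cauchy_Schwarz[OF path_L2[OF wp t] L2_diff[OF path_L2[OF y t] m]] by linarith
  qed
  have i: "integrable (time T) (\<lambda>t. L2_inner I (\<lambda>x. z t x - y t x) (\<lambda>x. y t x - u t x))"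
    using field_path_integrable(3)[OF _ _ wp, of "\<lambda>t x. y t x - u t x"] yu
    by (simp add: L1_L2_field_def L2_inner_commute[of I "\<lambda>x. y _ x - u _ x"])
  have const: "integrable (time T) (\<lambda>_. a)" "(LINT t|time T. a) = T * a" for a :: real
    using T finite_measure.integrable_const[OF finite_measure_time, of a T] by (auto simp: measure_restrict_space)
  have iu: "integrable (time T) (\<lambda>t. L2_norm I (u t))" using u(1) by (simp add: L1_L2_field_def)
  have "\<bar>LINT t|time T. L2_inner I (\<lambda>x. z t x - y t x) (\<lambda>x. y t x - u t x)\<bar>
      \<le> (LINT t|time T. \<bar>L2_inner I (\<lambda>x. z t x - y t x) (\<lambda>x. y t x - u t x)\<bar>)"
    by (rule integral_abs_bound)
  also have "\<dots> \<le> (LINT t|time T. \<epsilon> * b * (U + L2_norm I (u t)))"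
  proof (rule integral_mono_AE)
    have "AE t in time T. t \<in> {0..T}" by (rule AE_I2) simp
    with L1_L2_field_L2[OF u(1)]
    show "AE t in time T. \<bar>L2_inner I (\<lambda>x. z t x - y t x) (\<lambda>x. y t x - u t x)\<bar> \<le> \<epsilon> * b * (U + L2_norm I (u t))"
      by eventually_elim (rule cs)
  qed (use i iu const(1) in auto)
  also have "\<dots> = \<epsilon> * b * (T * U + (LINT t|time T. L2_norm I (u t)))"
    using iu const by simp
  finally have A: "\<bar>LINT t|time T. L2_inner I (\<lambda>x. z t x - y t x) (\<lambda>x. y t x - u t x)\<bar>
      \<le> \<epsilon> * b * (T * U + (LINT t|time T. L2_norm I (u t)))" .
  have "\<bar>c * (LINT t|time T. L2_inner I (\<lambda>x. z t x - y t x) (\<lambda>x. y t x - u t x)) +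
       d * L2_inner I (\<lambda>x. z T x - y T x) (\<lambda>x. y T x - v x)\<bar>
      \<le> c * \<bar>LINT t|time T. L2_inner I (\<lambda>x. z t x - y t x) (\<lambda>x. y t x - u t x)\<bar> +
       d * \<bar>L2_inner I (\<lambda>x. z T x - y T x) (\<lambda>x. y T x - v x)\<bar>"
    using c by (intro order_trans[OF abs_triangle_ineq]) (simp add: abs_mult)
  also have "\<dots> \<le> c * (\<epsilon> * b * (T * U + (LINT t|time T. L2_norm I (u t)))) + d * (\<epsilon> * b * (U + L2_norm I v))"
    by (intro add_mono mult_left_mono A cs TT v c)
  finally show "\<bar>c * (LINT t|time T. L2_inner I (\<lambda>x. z t x - y t x) (\<lambda>x. y t x - u t x)) +
       d * L2_inner I (\<lambda>x. z T x - y T x) (\<lambda>x. y T x - v x)\<bar>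
      \<le> \<epsilon> * (b * (c * (T * U + (LINT t|time T. L2_norm I (u t))) + d * (U + L2_norm I v)))"
    by (simp add: algebra_simps)
  have sq: "(L2_norm I (\<lambda>x. z t x - y t x))\<^sup>2 \<le> \<epsilon>\<^sup>2 * b\<^sup>2" if "t \<in> {0..T}" for t
    using power_mono[OF w[OF that] L2_norm_nonneg, of 2] by (simp add: power_mult_distrib)
  have "(LINT t|time T. (L2_norm I (\<lambda>x. z t x - y t x))\<^sup>2) \<le> (LINT t|time T. \<epsilon>\<^sup>2 * b\<^sup>2)"
    by (rule integral_mono) (auto intro!: integrable_time_continuous continuous_intros path_norm_continuous[OF wp] sq)
  then have S: "(LINT t|time T. (L2_norm I (\<lambda>x. z t x - y t x))\<^sup>2) \<le> T * (\<epsilon>\<^sup>2 * b\<^sup>2)" by (simp only: const)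
  have S0: "0 \<le> (LINT t|time T. (L2_norm I (\<lambda>x. z t x - y t x))\<^sup>2)" by (rule Bochner_Integration.integral_nonneg) simp
  have "c / 2 * (LINT t|time T. (L2_norm I (\<lambda>x. z t x - y t x))\<^sup>2) + d / 2 * (L2_norm I (\<lambda>x. z T x - y T x))\<^sup>2
      \<le> c * (T * (\<epsilon>\<^sup>2 * b\<^sup>2)) + d * (\<epsilon>\<^sup>2 * b\<^sup>2)"
    using S S0 sq[OF TT] c by (intro add_mono mult_mono) auto
  moreover have "0 \<le> c / 2 * (LINT t|time T. (L2_norm I (\<lambda>x. z t x - y t x))\<^sup>2) + d / 2 * (L2_norm I (\<lambda>x. z T x - y T x))\<^sup>2"
    using S0 c by (intro add_nonneg_nonneg mult_nonneg_nonneg) auto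
  ultimately show "\<bar>c / 2 * (LINT t|time T. (L2_norm I (\<lambda>x. z t x - y t x))\<^sup>2) + d / 2 * (L2_norm I (\<lambda>x. z T x - y T x))\<^sup>2\<bar>
      \<le> \<epsilon>\<^sup>2 * (b\<^sup>2 * (c * T + d))"
    by (simp add: algebra_simps)
qed

lemma path_cost_integrable:
  assumes M: "prob_space M" and F: "usual_filtration T M F" and T: "0 \<le> T" and X: "X \<in> state_space T I M F"
    and u: "L1_L2_field T u" "integrable (time T) (\<lambda>t. (L2_norm I (u t))\<^sup>2)" and v: "v \<in> L2 I"
    and c: "0 \<le> c" "0 \<le> d"
  shows "integrable M (\<lambda>\<omega>. path_cost T c d u v (\<lambda>t. X t \<omega>))"
proof (rule Bochner_Integration.integrable_bound)
  interpret prob_space M by fact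
  have TT: "T \<in> {0..T}" using T by simp
  note P = state_space_paths[OF M F T X]
  let ?U = "\<lambda>\<omega>. SUP t\<in>{0..T}. L2_norm I (X t \<omega>)"
  let ?A = "c * (LINT t|time T. (L2_norm I (u t))\<^sup>2) + d * (L2_norm I v)\<^sup>2"
  show "integrable M (\<lambda>\<omega>. (c * T + d) * (?U \<omega>)\<^sup>2 + ?A)" using P(4) by simp
  have complete: "complete_measure M" by (rule complete_measure_usual_filtration[OF F T])
  have paths: "AE \<omega> in M. L2_continuous_path T I (\<lambda>t. X t \<omega>)"
    using P(2) by eventually_elim (auto dest: bounded_pathD(1))
  have uf: "L2_field T u" using u(1) by (simp add: L1_L2_field_def)
  have XL: "AE \<omega> in M. X T \<omega> \<in> L2 I" using paths by eventually_elim (rule path_L2[OF _ TT])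
  show "(\<lambda>\<omega>. path_cost T c d u v (\<lambda>t. X t \<omega>)) \<in> borel_measurable M"
    unfolding path_cost_def
    by (intro borel_measurable_add borel_measurable_times borel_measurable_const
        process_norm_measurable[OF complete P(1) paths uf] random_variable_norm_measurable[OF complete P(1)[OF TT] XL v])
  have sq: "(L2_norm I (\<lambda>x. p x - m x))\<^sup>2 \<le> 2 * U\<^sup>2 + 2 * (L2_norm I m)\<^sup>2"
    if "p \<in> L2 I" "m \<in> L2 I" "L2_norm I p \<le> \<bar>U\<bar>" for p m and U :: real
  proof -
    have "(L2_norm I p)\<^sup>2 \<le> U\<^sup>2" using power_mono[OF that(3) L2_norm_nonneg, of 2] by simp
    then show ?thesis using L2_norm_square_diff_le[OF that(1,2)] by linarith
  qed
  show "AE \<omega> in M. norm (path_cost T c d u v (\<lambda>t. X t \<omega>)) \<le> norm ((c * T + d) * (?U \<omega>)\<^sup>2 + ?A)"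
    using P(2)
  proof eventually_elim
    case (elim \<omega>)
    then have p: "L2_continuous_path T I (\<lambda>t. X t \<omega>)" and U: "\<And>t. t \<in> {0..T} \<Longrightarrow> L2_norm I (X t \<omega>) \<le> \<bar>?U \<omega>\<bar>"
      by (auto dest: bounded_pathD(1))
    have const: "integrable (time T) (\<lambda>_. a)" "(LINT t|time T. a) = T * a" for a :: real
      using T finite_measure.integrable_const[OF finite_measure_time, of a T] by (auto simp: measure_restrict_space)
    have i: "integrable (time T) (\<lambda>t. 2 * (?U \<omega>)\<^sup>2 + 2 * (L2_norm I (u t))\<^sup>2)"
      using u(2) const(1) by auto
    have ineq: "AE t in time T. (L2_norm I (\<lambda>x. X t \<omega> x - u t x))\<^sup>2 \<le> 2 * (?U \<omega>)\<^sup>2 + 2 * (L2_norm I (u t))\<^sup>2"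
    proof -
      have "AE t in time T. t \<in> {0..T}" by (rule AE_I2) simp
      with L1_L2_field_L2[OF u(1)] show ?thesis
        by eventually_elim (intro sq U path_L2[OF p])
    qed
    have "(\<lambda>t. (L2_norm I (\<lambda>x. X t \<omega> x - u t x))\<^sup>2) \<in> borel_measurable (time T)"
      by (intro borel_measurable_power L2_field_norm_measurable L2_field_diff path_L2_field[OF p] uf)
    then have "integrable (time T) (\<lambda>t. (L2_norm I (\<lambda>x. X t \<omega> x - u t x))\<^sup>2)"
      by (rule Bochner_Integration.integrable_bound[OF i]) (use ineq in \<open>auto elim!: eventually_mono\<close>)
    from integral_mono_AE[OF this i ineq]
    have 1: "(LINT t|time T. (L2_norm I (\<lambda>x. X t \<omega> x - u t x))\<^sup>2) \<le>
        2 * (T * (?U \<omega>)\<^sup>2 + (LINT t|time T. (L2_norm I (u t))\<^sup>2))"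
      using u(2) const(1) T by (simp add: measure_restrict_space)
    have 2: "(L2_norm I (\<lambda>x. X T \<omega> x - v x))\<^sup>2 \<le> 2 * ((?U \<omega>)\<^sup>2 + (L2_norm I v)\<^sup>2)"
      using sq[OF path_L2[OF p TT] v U[OF TT]] by simp
    have "path_cost T c d u v (\<lambda>t. X t \<omega>) \<le> c / 2 * (2 * (T * (?U \<omega>)\<^sup>2 + (LINT t|time T. (L2_norm I (u t))\<^sup>2))) +
        d / 2 * (2 * ((?U \<omega>)\<^sup>2 + (L2_norm I v)\<^sup>2))"
      unfolding path_cost_def using c by (intro add_mono mult_left_mono 1 2) auto
    also have "\<dots> = (c * T + d) * (?U \<omega>)\<^sup>2 + ?A" by (simp add: algebra_simps)
    finally have "path_cost T c d u v (\<lambda>t. X t \<omega>) \<le> (c * T + d) * (?U \<omega>)\<^sup>2 + ?A" .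
    moreover have "0 \<le> path_cost T c d u v (\<lambda>t. X t \<omega>)"
      unfolding path_cost_def using c
      by (intro add_nonneg_nonneg mult_nonneg_nonneg Bochner_Integration.integral_nonneg) auto
    ultimately show ?case by simp
  qed
qed

end

section \<open>The minimum principle\<close>

context reaction_diffusion
begin

text \<open>
  The difference quotients of the cost converge along almost every path; by the deterministic
  Lipschitz constant they are dominated by a multiple of \<open>1 + sup\<^sub>t \<parallel>u t\<parallel>\<close>, so the expectation of the limit
  is the limit of the expectations.
\<close>

lemma expected_cost_derivative:
  fixes X :: "real \<Rightarrow> 'w \<Rightarrow> real \<Rightarrow> real"
  assumes M: "prob_space M" and F: "usual_filtration T M F" and T: "0 \<le> T"
    and X: "X \<in> state_space T I M F" and Z: "\<And>n. Z n \<in> state_space T I M F"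
    and u: "L1_L2_field T u" "integrable (time T) (\<lambda>t. (L2_norm I (u t))\<^sup>2)" and v: "v \<in> L2 I"
    and c: "0 \<le> c" "0 \<le> d"
    and \<beta>: "L1_L2_field T \<beta>" "integrable (time T) (\<lambda>t. (L2_norm I (\<beta> t))\<^sup>2)"
    and w: "AE \<omega> in M. \<forall>n. heat_equation T (\<lambda>t x. Z n t \<omega> x - X t \<omega> x)
      (\<lambda>s x. (f (Z n s \<omega> x) - f (X s \<omega> x)) + (1 / 2) ^ n * \<beta> s x)"
    and p: "AE \<omega> in M. bounded_path T (\<lambda>t. p t \<omega>) \<and>
      backward_heat_equation T (\<lambda>t. p t \<omega>) (\<lambda>s x. f' (X s \<omega> x) * p s \<omega> x + c * (X s \<omega> x - u s x)) \<and>
      (\<forall>k. coef (p T \<omega>) k = d * coef (\<lambda>x. X T \<omega> x - v x) k)"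
  shows "integrable M (\<lambda>\<omega>. LINT t|time T. L2_inner I (\<beta> t) (p t \<omega>))"
    and "(\<lambda>n. 2 ^ n * ((LINT \<omega>|M. path_cost T c d u v (\<lambda>t. Z n t \<omega>)) - (LINT \<omega>|M. path_cost T c d u v (\<lambda>t. X t \<omega>))))
      \<longlonglongrightarrow> (LINT \<omega>|M. LINT t|time T. L2_inner I (\<beta> t) (p t \<omega>))"
proof -
  interpret prob_space M by fact
  have TT: "T \<in> {0..T}" using T by simp
  define j where "j Y \<omega> = path_cost T c d u v (\<lambda>t. Y t \<omega>)" for Y :: "real \<Rightarrow> 'w \<Rightarrow> real \<Rightarrow> real" and \<omega>
  define U where "U \<omega> = \<bar>SUP t\<in>{0..T}. L2_norm I (X t \<omega>)\<bar>" for \<omega>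
  define B where "B = stability_const K T * (LINT s|time T. (L2_norm I (\<beta> s))\<^sup>2)"
  have B: "0 \<le> B"
    unfolding B_def stability_const_def using T K_nonneg
    by (intro mult_nonneg_nonneg add_nonneg_nonneg Bochner_Integration.integral_nonneg) auto
  define \<Psi> where "\<Psi> \<omega> = sqrt B * (c * (T * U \<omega> + (LINT t|time T. L2_norm I (u t))) + d * (U \<omega> + L2_norm I v))
      + (sqrt B)\<^sup>2 * (c * T + d)" for \<omega>
  let ?lim = "\<lambda>\<omega>. LINT t|time T. L2_inner I (\<beta> t) (p t \<omega>)"
  let ?D = "\<lambda>n \<omega>. 2 ^ n * (j (Z n) \<omega> - j X \<omega>)"
  note ji = path_cost_integrable[OF M F T _ u v c, folded j_def]
  have jX: "integrable M (j X)" and jZ: "integrable M (j (Z n))" for n by (rule ji, rule X, rule ji, rule Z)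
  have Dm: "?D n \<in> borel_measurable M" for n using jX jZ[of n] by auto
  have Ui: "integrable M U" unfolding U_def[abs_def] by (rule state_space_paths(3)[OF M F T X])
  have \<Psi>i: "integrable M \<Psi>" unfolding \<Psi>_def[abs_def] using Ui by auto
  have \<beta>f: "L2_field T \<beta>" using \<beta>(1) by (simp add: L1_L2_field_def)
  have good: "AE \<omega> in M. bounded_path T (\<lambda>t. X t \<omega>) \<and> (\<forall>t\<in>{0..T}. L2_norm I (X t \<omega>) \<le> U \<omega>) \<and>
      (\<forall>n. bounded_path T (\<lambda>t. Z n t \<omega>)) \<and> (\<forall>n. heat_equation T (\<lambda>t x. Z n t \<omega> x - X t \<omega> x)
        (\<lambda>s x. (f (Z n s \<omega> x) - f (X s \<omega> x)) + (1 / 2) ^ n * \<beta> s x))"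
  proof -
    have "AE \<omega> in M. \<forall>n. bounded_path T (\<lambda>t. Z n t \<omega>)"
      unfolding AE_all_countable using state_space_paths(2)[OF M F T Z] by (auto elim: eventually_mono)
    with w state_space_paths(2)[OF M F T X] show ?thesis
      by eventually_elim (auto simp: U_def)
  qed
  let ?L = "\<lambda>n \<omega>. c * (LINT t|time T. L2_inner I (\<lambda>x. Z n t \<omega> x - X t \<omega> x) (\<lambda>x. X t \<omega> x - u t x)) +
      d * L2_inner I (\<lambda>x. Z n T \<omega> x - X T \<omega> x) (\<lambda>x. X T \<omega> x - v x)"
  let ?Q = "\<lambda>n \<omega>. c / 2 * (LINT t|time T. (L2_norm I (\<lambda>x. Z n t \<omega> x - X t \<omega> x))\<^sup>2) +
      d / 2 * (L2_norm I (\<lambda>x. Z n T \<omega> x - X T \<omega> x))\<^sup>2"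
  \<comment> \<open>\<open>L\<close> and \<open>Q\<close> are the linear and the quadratic part of the increment of the cost\<close>
  have est: "AE \<omega> in M. \<forall>n. ?D n \<omega> = 2 ^ n * ?L n \<omega> + 2 ^ n * ?Q n \<omega> \<and>
      \<bar>2 ^ n * ?L n \<omega>\<bar> \<le> sqrt B * (c * (T * U \<omega> + (LINT t|time T. L2_norm I (u t))) + d * (U \<omega> + L2_norm I v)) \<and>
      \<bar>2 ^ n * ?Q n \<omega>\<bar> \<le> (1 / 2) ^ n * ((sqrt B)\<^sup>2 * (c * T + d))"
    using good
  proof eventually_elim
    case (elim \<omega>)
    show ?case
    proof
      fix n
      have y: "bounded_path T (\<lambda>t. X t \<omega>)" and z: "bounded_path T (\<lambda>t. Z n t \<omega>)"
        and h: "heat_equation T (\<lambda>t x. Z n t \<omega> x - X t \<omega> x)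
          (\<lambda>s x. (f (Z n s \<omega> x) - f (X s \<omega> x)) + (1 / 2) ^ n * \<beta> s x)"
        and U: "\<And>t. t \<in> {0..T} \<Longrightarrow> L2_norm I (X t \<omega>) \<le> U \<omega>"
        using elim by blast+
      note yp = bounded_pathD(1)[OF y] and zp = bounded_pathD(1)[OF z]
      have lip: "L2_norm I (\<lambda>x. Z n t \<omega> x - X t \<omega> x) \<le> (1 / 2) ^ n * sqrt B" if "t \<in> {0..T}" for t
      proof (rule power2_le_imp_le)
        show "(L2_norm I (\<lambda>x. Z n t \<omega> x - X t \<omega> x))\<^sup>2 \<le> ((1 / 2) ^ n * sqrt B)\<^sup>2"
          using state_lipschitz(1)[OF h y z T \<beta>f \<beta>(2) that, folded B_def] B by (simp add: power_mult_distrib)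
      qed (use B in simp)
      have b0: "0 \<le> sqrt B" "(0::real) \<le> (1 / 2) ^ n" using B by auto
      note bounds = path_cost_increment_le[OF yp zp T u v c b0(2,1) lip U]
      have "?D n \<omega> = 2 ^ n * (?L n \<omega> + ?Q n \<omega>)"
        unfolding j_def by (subst path_cost_increment[OF yp zp T u v]) (rule refl)
      moreover have "\<bar>2 ^ n * ?L n \<omega>\<bar> \<le> 2 ^ n * ((1 / 2) ^ n * (sqrt B * (c * (T * U \<omega> + (LINT t|time T. L2_norm I (u t))) + d * (U \<omega> + L2_norm I v))))"
        unfolding abs_mult using bounds(1) by (simp add: mult_left_mono)
      moreover have "\<bar>2 ^ n * ?Q n \<omega>\<bar> \<le> 2 ^ n * (((1 / 2) ^ n)\<^sup>2 * ((sqrt B)\<^sup>2 * (c * T + d)))"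
        unfolding abs_mult using bounds(2) by (simp add: mult_left_mono)
      moreover have "(2::real) ^ n * ((1 / 2) ^ n * a) = a" "(2::real) ^ n * (((1 / 2) ^ n)\<^sup>2 * a) = (1 / 2) ^ n * a" for a
        by (simp_all add: power_one_over power2_eq_square)
      ultimately show "?D n \<omega> = 2 ^ n * ?L n \<omega> + 2 ^ n * ?Q n \<omega> \<and>
          \<bar>2 ^ n * ?L n \<omega>\<bar> \<le> sqrt B * (c * (T * U \<omega> + (LINT t|time T. L2_norm I (u t))) + d * (U \<omega> + L2_norm I v)) \<and>
          \<bar>2 ^ n * ?Q n \<omega>\<bar> \<le> (1 / 2) ^ n * ((sqrt B)\<^sup>2 * (c * T + d))"
        by (simp only: distrib_left)
    qed
  qed
  have lim: "AE \<omega> in M. (\<lambda>n. ?D n \<omega>) \<longlonglongrightarrow> ?lim \<omega>"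
    using good p est
  proof eventually_elim
    case (elim \<omega>)
    have "(\<lambda>n. 2 ^ n * ?L n \<omega>) \<longlonglongrightarrow> ?lim \<omega>"
      by (rule pathwise_derivative[OF _ _ _ T \<beta> _ u(1) v]) (use elim in blast)+
    moreover have "(\<lambda>n. 2 ^ n * ?Q n \<omega>) \<longlonglongrightarrow> 0"
    proof (rule Lim_null_comparison)
      show "\<forall>\<^sub>F n in sequentially. norm (2 ^ n * ?Q n \<omega>) \<le> (1 / 2) ^ n * ((sqrt B)\<^sup>2 * (c * T + d))"
        using elim(3) by (intro always_eventually) (simp only: real_norm_def, blast)
      show "(\<lambda>n. (1 / 2) ^ n * ((sqrt B)\<^sup>2 * (c * T + d))) \<longlonglongrightarrow> 0"
        by (intro tendsto_mult_left_zero LIMSEQ_power_zero) simp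
    qed
    ultimately have "(\<lambda>n. 2 ^ n * ?L n \<omega> + 2 ^ n * ?Q n \<omega>) \<longlonglongrightarrow> ?lim \<omega> + 0" by (rule tendsto_add)
    moreover have "(\<lambda>n. ?D n \<omega>) = (\<lambda>n. 2 ^ n * ?L n \<omega> + 2 ^ n * ?Q n \<omega>)" using elim(3) by blast
    ultimately show ?case by simp
  qed
  have limm: "?lim \<in> borel_measurable M"
    by (rule complete_measure.borel_measurable_AE_LIMSEQ[OF complete_measure_usual_filtration[OF F T] Dm lim])
  have dom: "AE \<omega> in M. norm (?D n \<omega>) \<le> \<Psi> \<omega>" for n
    using est
  proof eventually_elim
    case (elim \<omega>)
    have "(1 / 2) ^ n * ((sqrt B)\<^sup>2 * (c * T + d)) \<le> 1 * ((sqrt B)\<^sup>2 * (c * T + d))"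
      using c T by (intro mult_right_mono power_le_one mult_nonneg_nonneg add_nonneg_nonneg) auto
    with elim[rule_format, of n] show ?case unfolding \<Psi>_def real_norm_def by linarith
  qed
  show "integrable M ?lim" by (rule integrable_dominated_convergence[OF limm Dm \<Psi>i lim dom])
  have "(\<lambda>n. LINT \<omega>|M. ?D n \<omega>) \<longlonglongrightarrow> (LINT \<omega>|M. ?lim \<omega>)"
    by (rule integral_dominated_convergence[OF limm Dm \<Psi>i lim dom])
  moreover have "(LINT \<omega>|M. ?D n \<omega>) = 2 ^ n * ((LINT \<omega>|M. j (Z n) \<omega>) - (LINT \<omega>|M. j X \<omega>))" for n
    using jX jZ by simp
  ultimately show "(\<lambda>n. 2 ^ n * ((LINT \<omega>|M. path_cost T c d u v (\<lambda>t. Z n t \<omega>)) - (LINT \<omega>|M. path_cost T c d u v (\<lambda>t. X t \<omega>))))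
      \<longlonglongrightarrow> (LINT \<omega>|M. ?lim \<omega>)"
    by (simp add: j_def)
qed

end

lemma open_connected_bounded_real:
  fixes \<Lambda> :: "real set"
  assumes "open \<Lambda>" "connected \<Lambda>" "\<Lambda> \<noteq> {}" "bounded \<Lambda>"
  obtains a b where "a < b" "\<Lambda> = {a<..<b}"
proof -
  have bdd: "bdd_below \<Lambda>" "bdd_above \<Lambda>" using assms(4) by (auto intro: bounded_imp_bdd_below bounded_imp_bdd_above)
  have in1: "Inf \<Lambda> < x \<and> x < Sup \<Lambda>" if x: "x \<in> \<Lambda>" for x
  proof -
    obtain e where e: "e > 0" "ball x e \<subseteq> \<Lambda>" using assms(1) x by (auto simp: open_contains_ball)
    then have "x - e / 2 \<in> \<Lambda>" "x + e / 2 \<in> \<Lambda>" by (auto simp: dist_real_def subset_eq)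
    then show ?thesis using e(1) cInf_lower[OF _ bdd(1)] cSup_upper[OF _ bdd(2)] by fastforce
  qed
  have in2: "x \<in> \<Lambda>" if x: "Inf \<Lambda> < x" "x < Sup \<Lambda>" for x
  proof -
    obtain y z where "y \<in> \<Lambda>" "y < x" "z \<in> \<Lambda>" "x < z"
      using x assms(3) bdd by (auto simp: cInf_less_iff less_cSup_iff)
    then show ?thesis using connected_contains_Icc[OF assms(2), of y z] by auto
  qed
  obtain x where "x \<in> \<Lambda>" using assms(3) by blast
  show thesis
    by (rule that[of "Inf \<Lambda>" "Sup \<Lambda>"]) (use in1[OF \<open>x \<in> \<Lambda>\<close>] in1 in2 in auto)
qed

theorem theorem4p2:
  fixes \<Lambda> :: "real set" and T :: real
    and M :: "'w measure" and F :: "real \<Rightarrow> 'w measure"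
    and Q :: "(real \<Rightarrow> real) \<Rightarrow> real \<Rightarrow> real" and W :: "real \<Rightarrow> 'w \<Rightarrow> real \<Rightarrow> real"
    and \<sigma> c c\<^sub>T l \<kappa> :: real and f :: "real \<Rightarrow> real" and b :: "real \<times> real \<Rightarrow> real"
    and u0 :: "'w \<Rightarrow> real \<Rightarrow> real" and u\<^sub>\<Lambda> :: "real \<times> real \<Rightarrow> real" and u\<^sub>T :: "real \<Rightarrow> real"
    and u :: "(real \<times> real \<Rightarrow> real) \<Rightarrow> real \<Rightarrow> 'w \<Rightarrow> real \<Rightarrow> real"
    and p :: "real \<Rightarrow> 'w \<Rightarrow> real \<Rightarrow> real" and g' :: "real \<times> real \<Rightarrow> real"
  assumes domain: "open \<Lambda>" "connected \<Lambda>" "\<Lambda> \<noteq> {}" "bounded \<Lambda>"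
    and horizon: "T > 0"
    and basis: "prob_space M" "usual_filtration T M F"
    and noise: "covariance_operator \<Lambda> Q" "Q_Wiener_process T \<Lambda> M F Q W"
    and initial: "L6_initial_value \<Lambda> M (F 0) u0"
    and coeff: "b \<in> Linf (time_space T \<Lambda>)" "admissible_nonlinearity f"
    and const: "c \<ge> 0" "c\<^sub>T \<ge> 0" "l \<ge> 0" "\<kappa> \<ge> 0"
    and target: "u\<^sub>\<Lambda> \<in> Lp 2 (time_space T \<Lambda>)" "u\<^sub>T \<in> L2 \<Lambda>"
    and state: "\<And>g. g \<in> Lp 6 (time_space T \<Lambda>) \<Longrightarrow> state_solution T \<Lambda> M F W \<sigma> f b u0 g (u g)"
    and minimum: "local_min_over T \<Lambda> (admissible_controls T \<Lambda> \<kappa>)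
                    (cost T \<Lambda> M c c\<^sub>T l u\<^sub>\<Lambda> u\<^sub>T u) g'"
    and adjoint: "AE \<omega> in M. adjoint_path_solution T \<Lambda> f c c\<^sub>T u\<^sub>\<Lambda> u\<^sub>T (\<lambda>t. u g' t \<omega>) (\<lambda>t. p t \<omega>)"
  shows "\<forall>h \<in> admissible_controls T \<Lambda> \<kappa>.
    integrable M (\<lambda>\<omega>. LINT t|lebesgue_on {0..T}. LINT x|lebesgue_on \<Lambda>.
      (b (t, x) * p t \<omega> x + l * g' (t, x)) * (h (t, x) - g' (t, x))) \<and>
    0 \<le> (LINT \<omega>|M. LINT t|lebesgue_on {0..T}. LINT x|lebesgue_on \<Lambda>.
      (b (t, x) * p t \<omega> x + l * g' (t, x)) * (h (t, x) - g' (t, x)))"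
proof
  fix h assume h: "h \<in> admissible_controls T \<Lambda> \<kappa>"
  obtain lo hi where lohi: "lo < hi" and \<Lambda>: "\<Lambda> = {lo<..<hi}"
    using open_connected_bounded_real[OF domain] by blast
  have T: "0 \<le> T" using horizon by simp
  obtain C where C: "\<And>x. \<bar>deriv f x\<bar> < C * (1 + \<bar>x\<bar>\<^sup>2)"
    using coeff(2) unfolding admissible_nonlinearity_def by blast
  obtain K where K: "\<And>x. deriv f x \<le> K"
    using coeff(2) unfolding admissible_nonlinearity_def bdd_above_def by auto
  obtain f' where f': "\<And>x. (f has_real_derivative f' x) (at x)" "continuous_on UNIV f'"
    using coeff(2) unfolding admissible_nonlinearity_def C1_differentiable_on_def
    by (auto simp: has_real_derivative_iff_has_vector_derivative)
  have "deriv f = f'" using f'(1) by (auto intro: DERIV_imp_deriv)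
  \<comment> \<open>the upper bound of the derivative may be negative, the locale wants it nonnegative\<close>
  interpret reaction_diffusion lo hi f "deriv f" C "\<bar>K\<bar>"
  proof
    show "f 0 = 0" using coeff(2) by (simp add: admissible_nonlinearity_def)
    show "deriv f x \<le> \<bar>K\<bar>" for x using K[of x] by linarith
    show "\<bar>deriv f x\<bar> \<le> C * (1 + x\<^sup>2)" for x using C[of x] by simp
  qed (use lohi f' \<open>deriv f = f'\<close> in auto)
  note state = state[unfolded \<Lambda>] and target = target[unfolded \<Lambda>] and b = coeff(1)[unfolded \<Lambda>]
  let ?P = "time_space T I"
  have P: "finite_measure ?P"
  proof (rule finite_measure_lebesgue_on, rule bounded_set_imp_lmeasurable)
    show "bounded ({0..T} \<times> I)" by (intro bounded_Times) auto
    show "{0..T} \<times> I \<in> sets lebesgue"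
      by (rule sets_completionI_sets) (simp add: lborel_prod[symmetric] pair_measureI)
  qed
  have g': "g' \<in> Lp 6 ?P" "Lp_norm 6 ?P g' \<le> \<kappa>" and h6: "h \<in> Lp 6 ?P" "Lp_norm 6 ?P h \<le> \<kappa>"
    using minimum h by (auto simp: local_min_over_def admissible_controls_def \<Lambda>)
  \<comment> \<open>the segment from \<open>g'\<close> to \<open>h\<close> stays in the convex admissible set\<close>
  define dir where "dir z = h z - g' z" for z
  define \<beta> where "\<beta> t x = b (t, x) * dir (t, x)" for t x
  define g where "g n z = g' z + (1 / 2) ^ n * dir z" for n :: nat and z
  have g: "g n \<in> Lp 6 ?P" "Lp_norm 6 ?P (g n) \<le> \<kappa>" for n
    unfolding g_def[abs_def] dir_def
    by (rule Lp_ball_convex[OF g' h6 _ _ _ _ const(4)]; simp add: power_le_one)+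
  have L6_2: "k \<in> Lp 2 ?P" if "k \<in> Lp 6 ?P" for k by (rule Lp_exponent_mono[OF P that]) simp
  have dir2: "dir \<in> Lp 2 ?P" unfolding dir_def[abs_def] by (intro Lp_2_diff L6_2 h6 g')
  note dirF = Lp_2_field[OF dir2] and g'F = Lp_2_field[OF L6_2[OF g'(1)]] and uF = Lp_2_field[OF target(1)]
  have \<beta>F: "L1_L2_field T \<beta>" "integrable (time T) (\<lambda>t. (L2_norm I (\<beta> t))\<^sup>2)"
    using Lp_2_field[OF Linf_mult_Lp_2[OF b dir2]] by (simp_all add: \<beta>_def[abs_def])
  have bg: "L1_L2_field T (\<lambda>t x. b (t, x) * k (t, x))" if "k \<in> Lp 6 ?P" for k
    by (rule Lp_2_field[OF Linf_mult_Lp_2[OF b L6_2[OF that]]])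
  have spaces: "u g' \<in> state_space T I M F" "u (g n) \<in> state_space T I M F" for n
    using state[OF g'(1)] state[OF g(1)] by (auto simp: state_solution_def)
  \<comment> \<open>initial value and noise, the same for all controls\<close>
  define N where "N \<omega> t v = L2_inner I (u0 \<omega>) v + \<sigma> * L2_inner I (W t \<omega>) v" for \<omega> t v
  have eqn: "AE \<omega> in M. \<forall>t\<in>{0..T}. \<forall>v\<in>H1 I. L2_inner I (u k t \<omega>) v = N \<omega> t v +
      (LINT s|time t. - L2_inner I (weak_deriv I (u k s \<omega>)) (weak_deriv I v) +
        (LINT x|lebesgue_on I. (f (u k s \<omega> x) + b (s, x) * k (s, x)) * v x))" if "k \<in> Lp 6 ?P" for k
    using state[OF that] unfolding state_solution_def N_def
    by (auto elim!: eventually_mono)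
  have paths: "AE \<omega> in M. bounded_path T (\<lambda>t. u k t \<omega>) \<and> (AE t in time T. u k t \<omega> \<in> H1 I)"
    if "u k \<in> state_space T I M F" for k
    using state_space_paths(2)[OF basis T that] by eventually_elim blast
  have heat: "AE \<omega> in M. \<forall>n. heat_equation T (\<lambda>t x. u (g n) t \<omega> x - u g' t \<omega> x)
      (\<lambda>s x. (f (u (g n) s \<omega> x) - f (u g' s \<omega> x)) + (1 / 2) ^ n * \<beta> s x)"
    unfolding AE_all_countable
  proof
    fix n
    show "AE \<omega> in M. heat_equation T (\<lambda>t x. u (g n) t \<omega> x - u g' t \<omega> x)
      (\<lambda>s x. (f (u (g n) s \<omega> x) - f (u g' s \<omega> x)) + (1 / 2) ^ n * \<beta> s x)"
      using eqn[OF g'(1)] eqn[OF g(1)[of n]] paths[OF spaces(1)] paths[OF spaces(2)[of n]]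
    proof eventually_elim
      case (elim \<omega>)
      have "heat_equation T (\<lambda>t x. u (g n) t \<omega> x - u g' t \<omega> x)
        (\<lambda>s x. (f (u (g n) s \<omega> x) - f (u g' s \<omega> x)) + (b (s, x) * g n (s, x) - b (s, x) * g' (s, x)))"
        by (rule state_difference[where N = "N \<omega>" and a = "\<lambda>s x. b (s, x) * g' (s, x)"])
          (use elim bg[OF g'(1)] bg[OF g(1)[of n]] in blast)+
      moreover have "b (s, x) * g n (s, x) - b (s, x) * g' (s, x) = (1 / 2) ^ n * \<beta> s x" for s x
        by (simp add: g_def \<beta>_def distrib_left)
      ultimately show ?case by simp
    qed
  qed
  have adj: "AE \<omega> in M. bounded_path T (\<lambda>t. p t \<omega>) \<and>
      backward_heat_equation T (\<lambda>t. p t \<omega>)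
        (\<lambda>s x. deriv f (u g' s \<omega> x) * p s \<omega> x + c * (u g' s \<omega> x - u\<^sub>\<Lambda> (s, x))) \<and>
      (\<forall>k. coef (p T \<omega>) k = c\<^sub>T * coef (\<lambda>x. u g' T \<omega> x - u\<^sub>T x) k)"
    using adjoint[unfolded \<Lambda>] paths[OF spaces(1)]
  proof eventually_elim
    case (elim \<omega>)
    have q: "bounded_path T (\<lambda>t. p t \<omega>)" "AE t in time T. p t \<omega> \<in> H1 I"
      using elim(1) unfolding adjoint_path_solution_def by (auto intro: H1_path_bounded)
    have y: "bounded_path T (\<lambda>t. u g' t \<omega>)" using elim(2) by blast
    note adj = adjoint_backward[where N = "\<lambda>v. c\<^sub>T * L2_inner I (\<lambda>x. u g' T \<omega> x - u\<^sub>T x) v" and c = c, OF y q uF(1) T]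
    have "backward_heat_equation T (\<lambda>t. p t \<omega>)
        (\<lambda>s x. deriv f (u g' s \<omega> x) * p s \<omega> x + c * (u g' s \<omega> x - u\<^sub>\<Lambda> (s, x)))"
      by (rule adj(1)) (use elim(1) in \<open>unfold adjoint_path_solution_def, blast\<close>)
    moreover have "coef (p T \<omega>) k = c\<^sub>T * coef (\<lambda>x. u g' T \<omega> x - u\<^sub>T x) k" for k
      unfolding coef_def[of "\<lambda>x. u g' T \<omega> x - u\<^sub>T x"]
      by (rule adj(2)) (use elim(1) in \<open>unfold adjoint_path_solution_def, blast\<close>)
    ultimately show ?case using q(1) by blast
  qed
  let ?j = "\<lambda>k \<omega>. path_cost T c c\<^sub>T (\<lambda>t x. u\<^sub>\<Lambda> (t, x)) u\<^sub>T (\<lambda>t. u k t \<omega>)"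
  note deriv = expected_cost_derivative[OF basis T spaces uF target(2) const(1,2) \<beta>F heat adj]
  let ?Z = "\<lambda>\<omega>. LINT t|time T. L2_inner I (\<beta> t) (p t \<omega>)"
  define \<gamma> where "\<gamma> = (LINT t|time T. L2_inner I (\<lambda>x. g' (t, x)) (\<lambda>x. dir (t, x)))"
  define \<rho> where "\<rho> = (LINT t|time T. (L2_norm I (\<lambda>x. dir (t, x)))\<^sup>2)"
  have cost_eq: "cost T I M c c\<^sub>T l u\<^sub>\<Lambda> u\<^sub>T u k = (LINT \<omega>|M. ?j k \<omega>) +
      l / 2 * (LINT t|time T. (L2_norm I (\<lambda>x. k (t, x)))\<^sup>2)" for k
    by (simp add: cost_def path_cost_def L2_norm_square_integral)
  have inner_m: "(\<lambda>t. L2_inner I (\<lambda>x. g' (t, x)) (\<lambda>x. dir (t, x))) \<in> borel_measurable (time T)"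
    using L2_field_inner_measurable[of T "\<lambda>t x. g' (t, x)" "\<lambda>t x. dir (t, x)"] g'F(1) dirF(1)
    by (simp add: L1_L2_field_def)
  have inner_i: "integrable (time T) (\<lambda>t. L2_inner I (\<lambda>x. g' (t, x)) (\<lambda>x. dir (t, x)))"
  proof (rule Bochner_Integration.integrable_bound[OF _ inner_m])
    show "integrable (time T) (\<lambda>t. (L2_norm I (\<lambda>x. g' (t, x)))\<^sup>2 + (L2_norm I (\<lambda>x. dir (t, x)))\<^sup>2)"
      using g'F(2) dirF(2) by simp
    show "AE t in time T. norm (L2_inner I (\<lambda>x. g' (t, x)) (\<lambda>x. dir (t, x)))
        \<le> norm ((L2_norm I (\<lambda>x. g' (t, x)))\<^sup>2 + (L2_norm I (\<lambda>x. dir (t, x)))\<^sup>2)"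
      using L1_L2_field_L2[OF g'F(1)] L1_L2_field_L2[OF dirF(1)]
    proof eventually_elim
      case (elim t)
      let ?a = "L2_norm I (\<lambda>x. g' (t, x))" and ?b = "L2_norm I (\<lambda>x. dir (t, x))"
      have "2 * (?a * ?b) \<le> ?a\<^sup>2 + ?b\<^sup>2" using sum_squares_bound[of ?a ?b] by simp
      moreover have "0 \<le> ?a * ?b" by (simp add: L2_norm_nonneg)
      ultimately show ?case using L2_Cauchy_Schwarz[OF elim] by simp
    qed
  qed
  have control: "(LINT t|time T. (L2_norm I (\<lambda>x. g n (t, x)))\<^sup>2) =
      (LINT t|time T. (L2_norm I (\<lambda>x. g' (t, x)))\<^sup>2) + (2 * (1 / 2) ^ n * \<gamma> + ((1 / 2) ^ n)\<^sup>2 * \<rho>)" for n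
  proof -
    have "(LINT t|time T. (L2_norm I (\<lambda>x. g n (t, x)))\<^sup>2) = (LINT t|time T. (L2_norm I (\<lambda>x. g' (t, x)))\<^sup>2 +
        (2 * (1 / 2) ^ n * L2_inner I (\<lambda>x. g' (t, x)) (\<lambda>x. dir (t, x)) + ((1 / 2) ^ n)\<^sup>2 * (L2_norm I (\<lambda>x. dir (t, x)))\<^sup>2))"
    proof (rule integral_cong_AE_time)
      show "AE t in time T. (L2_norm I (\<lambda>x. g n (t, x)))\<^sup>2 = (L2_norm I (\<lambda>x. g' (t, x)))\<^sup>2 +
        (2 * (1 / 2) ^ n * L2_inner I (\<lambda>x. g' (t, x)) (\<lambda>x. dir (t, x)) + ((1 / 2) ^ n)\<^sup>2 * (L2_norm I (\<lambda>x. dir (t, x)))\<^sup>2)"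
        using L1_L2_field_L2[OF g'F(1)] L1_L2_field_L2[OF dirF(1)]
      proof eventually_elim
        case (elim t)
        from L2_norm_square_add[OF elim(1) L2_scale[OF elim(2), of "(1 / 2) ^ n"]] show ?case
          by (simp add: g_def L2_norm_scale power_mult_distrib L2_inner_scale_left
              L2_inner_commute[of I "\<lambda>x. g' (t, x)"])
      qed
    qed (use g'F(2) dirF(2) inner_i in auto)
    also have "\<dots> = (LINT t|time T. (L2_norm I (\<lambda>x. g' (t, x)))\<^sup>2) + (2 * (1 / 2) ^ n * \<gamma> + ((1 / 2) ^ n)\<^sup>2 * \<rho>)"
      unfolding \<gamma>_def \<rho>_def using g'F(2) dirF(2) inner_i by simp
    finally show ?thesis .
  qed
  obtain \<delta> where \<delta>: "\<delta> > 0" "\<And>k. k \<in> admissible_controls T I \<kappa> \<Longrightarrow>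
      Lp_norm 6 ?P (\<lambda>z. k z - g' z) < \<delta> \<Longrightarrow> cost T I M c c\<^sub>T l u\<^sub>\<Lambda> u\<^sub>T u g' \<le> cost T I M c c\<^sub>T l u\<^sub>\<Lambda> u\<^sub>T u k"
    using minimum unfolding local_min_over_def \<Lambda> by blast
  \<comment> \<open>the difference quotient of the cost towards \<open>h\<close> is nonnegative near the minimum\<close>
  have nonneg: "\<forall>\<^sub>F n in sequentially.
      0 \<le> 2 ^ n * ((LINT \<omega>|M. ?j (g n) \<omega>) - (LINT \<omega>|M. ?j g' \<omega>)) + (l * \<gamma> + l / 2 * \<rho> * (1 / 2) ^ n)"
  proof -
    have "(\<lambda>n. (1 / 2) ^ n * Lp_norm 6 ?P dir) \<longlonglongrightarrow> 0"
      by (intro tendsto_mult_left_zero LIMSEQ_power_zero) simp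
    then have "\<forall>\<^sub>F n in sequentially. (1 / 2) ^ n * Lp_norm 6 ?P dir < \<delta>"
      using \<delta>(1) by (rule order_tendstoD)
    then show ?thesis
    proof eventually_elim
      case (elim n)
      have "Lp_norm 6 ?P (\<lambda>z. g n z - g' z) < \<delta>"
        using elim Lp_norm_scale[of 6 ?P "(1 / 2) ^ n" dir] by (simp add: g_def)
      with g[of n] have "cost T I M c c\<^sub>T l u\<^sub>\<Lambda> u\<^sub>T u g' \<le> cost T I M c c\<^sub>T l u\<^sub>\<Lambda> u\<^sub>T u (g n)"
        by (intro \<delta>(2)) (auto simp: admissible_controls_def)
      then have "0 \<le> ((LINT \<omega>|M. ?j (g n) \<omega>) - (LINT \<omega>|M. ?j g' \<omega>)) + l / 2 * (2 * (1 / 2) ^ n * \<gamma> + ((1 / 2) ^ n)\<^sup>2 * \<rho>)"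
        unfolding cost_eq control by (simp add: distrib_left)
      then have "0 \<le> 2 ^ n * (((LINT \<omega>|M. ?j (g n) \<omega>) - (LINT \<omega>|M. ?j g' \<omega>)) + l / 2 * (2 * (1 / 2) ^ n * \<gamma> + ((1 / 2) ^ n)\<^sup>2 * \<rho>))"
        by (intro mult_nonneg_nonneg) auto
      also have "\<dots> = 2 ^ n * ((LINT \<omega>|M. ?j (g n) \<omega>) - (LINT \<omega>|M. ?j g' \<omega>)) +
          (2 ^ n * (1 / 2) ^ n) * (l * \<gamma> + l / 2 * \<rho> * (1 / 2) ^ n)"
        by (simp only: distrib_left power2_eq_square) (simp add: mult_ac)
      also have "(2::real) ^ n * (1 / 2) ^ n = 1" by (simp add: power_one_over)
      finally show ?case by simp
    qed
  qed
  have "(\<lambda>n. 2 ^ n * ((LINT \<omega>|M. ?j (g n) \<omega>) - (LINT \<omega>|M. ?j g' \<omega>)) + (l * \<gamma> + l / 2 * \<rho> * (1 / 2) ^ n))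
      \<longlonglongrightarrow> (LINT \<omega>|M. ?Z \<omega>) + (l * \<gamma> + l / 2 * \<rho> * 0)"
    by (intro tendsto_add tendsto_mult tendsto_const deriv(2) LIMSEQ_power_zero) simp
  from tendsto_lowerbound[OF this nonneg] have pos: "0 \<le> (LINT \<omega>|M. ?Z \<omega>) + l * \<gamma>" by simp
  let ?\<Psi> = "\<lambda>\<omega>. LINT t|time T. LINT x|lebesgue_on I. (b (t, x) * p t \<omega> x + l * g' (t, x)) * (h (t, x) - g' (t, x))"
  \<comment> \<open>its limit is the expectation in the claim\<close>
  have \<Psi>: "AE \<omega> in M. ?Z \<omega> + l * \<gamma> = ?\<Psi> \<omega>"
    using adj
  proof eventually_elim
    case (elim \<omega>)
    then have q: "L2_continuous_path T I (\<lambda>t. p t \<omega>)" by (auto dest: bounded_pathD(1))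
    have i: "integrable (time T) (\<lambda>t. L2_inner I (\<beta> t) (p t \<omega>))"
      using field_path_integrable(3)[OF _ _ q] \<beta>F(1) unfolding L1_L2_field_def by blast
    have "?\<Psi> \<omega> = (LINT t|time T. L2_inner I (\<beta> t) (p t \<omega>) + l * L2_inner I (\<lambda>x. g' (t, x)) (\<lambda>x. dir (t, x)))"
    proof (rule integral_cong_AE_time)
      show "AE t in time T. (LINT x|lebesgue_on I. (b (t, x) * p t \<omega> x + l * g' (t, x)) * (h (t, x) - g' (t, x))) =
          L2_inner I (\<beta> t) (p t \<omega>) + l * L2_inner I (\<lambda>x. g' (t, x)) (\<lambda>x. dir (t, x))"
        using L1_L2_field_L2[OF g'F(1)] L1_L2_field_L2[OF dirF(1)] L1_L2_field_L2[OF \<beta>F(1)]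
          L1_L2_field_L2[OF path_L1_L2_field[OF q]]
      proof eventually_elim
        case (elim t)
        have "(LINT x|lebesgue_on I. (b (t, x) * p t \<omega> x + l * g' (t, x)) * (h (t, x) - g' (t, x))) =
            (LINT x|lebesgue_on I. \<beta> t x * p t \<omega> x + l * (g' (t, x) * dir (t, x)))"
          by (intro Bochner_Integration.integral_cong) (auto simp: \<beta>_def dir_def algebra_simps)
        then show ?case
          using L2_mult_integrable[OF elim(3,4)] L2_mult_integrable[OF elim(1,2)] by (simp add: L2_inner_def)
      qed
    qed (use i inner_i in auto)
    also have "\<dots> = ?Z \<omega> + l * \<gamma>" using i inner_i by (simp add: \<gamma>_def)
    finally show ?case by simp
  qed
  interpret M: prob_space M by (rule basis(1))
  have Zi: "integrable M (\<lambda>\<omega>. ?Z \<omega> + l * \<gamma>)" using deriv(1) by simp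
  have \<Psi>m: "?\<Psi> \<in> borel_measurable M"
    by (rule complete_measure.borel_measurable_AE_cong[OF complete_measure_usual_filtration[OF basis(2) T]
          borel_measurable_integrable[OF Zi] \<Psi>])
  have "(LINT \<omega>|M. ?\<Psi> \<omega>) = (LINT \<omega>|M. ?Z \<omega> + l * \<gamma>)"
    by (rule integral_cong_AE[symmetric, OF borel_measurable_integrable[OF Zi] \<Psi>m \<Psi>])
  also have "\<dots> = (LINT \<omega>|M. ?Z \<omega>) + l * \<gamma>" using deriv(1) by (simp add: M.prob_space)
  finally show "integrable M (\<lambda>\<omega>. LINT t|lebesgue_on {0..T}. LINT x|lebesgue_on \<Lambda>.
      (b (t, x) * p t \<omega> x + l * g' (t, x)) * (h (t, x) - g' (t, x))) \<and>
    0 \<le> (LINT \<omega>|M. LINT t|lebesgue_on {0..T}. LINT x|lebesgue_on \<Lambda>.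
      (b (t, x) * p t \<omega> x + l * g' (t, x)) * (h (t, x) - g' (t, x)))"
    unfolding \<Lambda> using pos integrable_cong_AE_imp[OF Zi \<Psi>m \<Psi>] by simp
qed

end
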